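(* Let $F$ be a field, and let $a$ and $r$ be relatively prime positive integers such that $a, a+r, a+2r, a+3r$ non-redundantly generate their numerical semigroup. Let $A=F[[t^a,t^{a+r},t^{a+2r},t^{a+3r}]]\subset F[[t]]$, let $R=F[[x,y,z,w]]$, and let $P$ be the defining ideal of $A$ in $R$, so that $A\cong R/P$. \begin{enumerate} \item If $a=3k$ or $a=3k+1$ for some positive integer $k$, then $R/P$ is not Gorenstein and $P^2\neq P^{(2)}$. \item If $a=3k+2$ for some positive integer $k$, then $R/P$ is Gorenstein, $P^2=P^{(2)}$ and $P^3\neq P^{(3)}$. \end{enumerate}
   Context: The defining ideal $P$ of $A$ is the kernel of the $F$-algebra homomorphism $F[[x,y,z,w]]\to F[[t]]$ sending $x\mapsto t^a$, $y\mapsto t^{a+r}$, $z\mapsto t^{a+2r}$, $w\mapsto t^{a+3r}$; its image is $A$. Positive integers $a_1,\dots,a_d$ non-redundantly generate their numerical semigroup if no $a_i$ is a non-negative integer linear combination of the others. For a prime ideal $P$ of a Noetherian ring $R$ and a positive integer $n$, the $n$-th symbolic power is $P^{(n)}=P^nR_P\cap R=\{x\in R \mid \exists\, s\in R\setminus P,\ sx\in P^n\}$. *)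

theory Defs
  imports
    "HOL-Computational_Algebra.Formal_Power_Series"
    "HOL-Algebra.QuotRing"
    "HOL-Algebra.Ideal_Product"
    "HOL-Algebra.Ring_Divisibility"
    "HOL-Algebra.Module"
    "HOL-Algebra.Algebraic_Closure_Type"
begin

section \<open>Numerical semigroups\<close>

definition nonredundant_generators :: "nat list \<Rightarrow> bool" where
  "nonredundant_generators as \<longleftrightarrow>
     (\<forall>i<length as. \<not> (\<exists>c :: nat \<Rightarrow> nat. as ! i = (\<Sum>j\<in>{..<length as} - {i}. c j * as ! j)))"


section \<open>The ring \<open>F[[x,y,z,w]]\<close> and its maps to \<open>F[[t]]\<close>\<close>

text \<open>\<open>F[[x,y,z,w]]\<close> is taken as the iterated power series ring \<open>F[[x]][[y]][[z]][[w]]\<close>: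
  \<open>x\<close> is the innermost variable, so the coefficient of \<open>x^i y^j z^k w^l\<close> in \<open>f\<close> is
  \<open>f $ l $ k $ j $ i\<close>.\<close>

type_synonym 'k fps4 = "'k fps fps fps fps"

definition coeff4 :: "'k::zero fps4 \<Rightarrow> nat \<times> nat \<times> nat \<times> nat \<Rightarrow> 'k" where
  "coeff4 f = (\<lambda>(i, j, k, l). f $ l $ k $ j $ i)"

abbreviation var_x :: "'k::comm_ring_1 fps4" where "var_x \<equiv> fps_const (fps_const (fps_const fps_X))"
abbreviation var_y :: "'k::comm_ring_1 fps4" where "var_y \<equiv> fps_const (fps_const fps_X)"
abbreviation var_z :: "'k::comm_ring_1 fps4" where "var_z \<equiv> fps_const fps_X"
abbreviation var_w :: "'k::comm_ring_1 fps4" where "var_w \<equiv> fps_X"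

definition exps_of_weight :: "nat \<Rightarrow> nat \<Rightarrow> nat \<Rightarrow> nat \<Rightarrow> nat \<Rightarrow> (nat \<times> nat \<times> nat \<times> nat) set" where
  "exps_of_weight p q s u n = {(i, j, k, l). i * p + j * q + k * s + l * u = n}"

text \<open>The substitution \<open>x \<mapsto> t^p\<close>, \<open>y \<mapsto> t^q\<close>, \<open>z \<mapsto> t^s\<close>, \<open>w \<mapsto> t^u\<close>. It is meaningful only for
  positive exponents, when each \<^const>\<open>exps_of_weight\<close> is finite; the lemmas below show that it is
  then the \<open>F\<close>-algebra homomorphism with these values on the variables.\<close>

definition monomial_subst ::
    "nat \<Rightarrow> nat \<Rightarrow> nat \<Rightarrow> nat \<Rightarrow> 'k::comm_ring_1 fps4 \<Rightarrow> 'k fps" where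
  "monomial_subst p q s u f = Abs_fps (\<lambda>n. \<Sum>e\<in>exps_of_weight p q s u n. coeff4 f e)"

lemma finite_exps_of_weight:
  assumes "p > 0" "q > 0" "s > 0" "u > 0"
  shows "finite (exps_of_weight p q s u n)"
proof (rule finite_subset)
  show "exps_of_weight p q s u n \<subseteq> {..n} \<times> {..n} \<times> {..n} \<times> {..n}"
  proof
    fix e assume "e \<in> exps_of_weight p q s u n"
    then obtain i j k l where e: "e = (i, j, k, l)" and n: "i * p + j * q + k * s + l * u = n"
      by (auto simp: exps_of_weight_def)
    have "i \<le> i * p" "j \<le> j * q" "k \<le> k * s" "l \<le> l * u"
      using assms by simp_all
    with n have "i \<le> n" "j \<le> n" "k \<le> n" "l \<le> n"
      by linarith+
    then show "e \<in> {..n} \<times> {..n} \<times> {..n} \<times> {..n}"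
      by (simp add: e)
  qed
qed simp

lemma coeff4_mult:
  "coeff4 (f * g) (i, j, k, l) =
     (\<Sum>(i', j', k', l')\<in>{..i} \<times> {..j} \<times> {..k} \<times> {..l}.
        coeff4 f (i', j', k', l') * coeff4 g (i - i', j - j', k - k', l - l'))"
proof -
  have "coeff4 (f * g) (i, j, k, l) =
     (\<Sum>l'\<le>l. \<Sum>k'\<le>k. \<Sum>j'\<le>j. \<Sum>i'\<le>i.
        coeff4 f (i', j', k', l') * coeff4 g (i - i', j - j', k - k', l - l'))"
    by (simp add: coeff4_def fps_mult_nth fps_sum_nth atLeast0AtMost)
  also have "\<dots> = (\<Sum>(l', k', j', i')\<in>{..l} \<times> {..k} \<times> {..j} \<times> {..i}.
        coeff4 f (i', j', k', l') * coeff4 g (i - i', j - j', k - k', l - l'))"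
    by (simp add: sum.cartesian_product split_def)
  also have "\<dots> = (\<Sum>(i', j', k', l')\<in>{..i} \<times> {..j} \<times> {..k} \<times> {..l}.
        coeff4 f (i', j', k', l') * coeff4 g (i - i', j - j', k - k', l - l'))"
    by (rule sum.reindex_bij_witness
          [of _ "\<lambda>(i, j, k, l). (l, k, j, i)" "\<lambda>(l, k, j, i). (i, j, k, l)"]) auto
  finally show ?thesis .
qed

lemma monomial_subst_add:
  "monomial_subst p q s u (f + g) = monomial_subst p q s u f + monomial_subst p q s u g"
  by (rule fps_ext) (simp add: monomial_subst_def coeff4_def split_def sum.distrib)

lemma monomial_subst_mult:
  assumes "p > 0" "q > 0" "s > 0" "u > 0"
  shows "monomial_subst p q s u (f * g) = monomial_subst p q s u f * monomial_subst p q s u g"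
proof (rule fps_ext)
  fix n
  define W where "W = exps_of_weight p q s u"
  define B :: "nat \<times> nat \<times> nat \<times> nat \<Rightarrow> (nat \<times> nat \<times> nat \<times> nat) set"
    where "B = (\<lambda>(i, j, k, l). {..i} \<times> {..j} \<times> {..k} \<times> {..l})"
  define D :: "nat \<times> nat \<times> nat \<times> nat \<Rightarrow> nat \<times> nat \<times> nat \<times> nat \<Rightarrow> nat \<times> nat \<times> nat \<times> nat"
    where "D = (\<lambda>(i, j, k, l) (i', j', k', l'). (i - i', j - j', k - k', l - l'))"
  define A :: "nat \<times> nat \<times> nat \<times> nat \<Rightarrow> nat \<times> nat \<times> nat \<times> nat \<Rightarrow> nat \<times> nat \<times> nat \<times> nat"
    where "A = (\<lambda>(i, j, k, l) (i', j', k', l'). (i + i', j + j', k + k', l + l'))"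
  define wt :: "nat \<times> nat \<times> nat \<times> nat \<Rightarrow> nat"
    where "wt = (\<lambda>(i, j, k, l). i * p + j * q + k * s + l * u)"
  have W: "e \<in> W m \<longleftrightarrow> wt e = m" for e m
    by (auto simp: W_def exps_of_weight_def wt_def)
  have wt_A: "wt (A e e') = wt e + wt e'" for e e'
    by (cases e; cases e') (simp add: wt_def A_def algebra_simps)
  have A_D: "A e' (D e e') = e" if "e' \<in> B e" for e e'
    using that by (cases e; cases e') (simp add: A_def B_def D_def)
  have D_A: "D (A e' e'') e' = e''" for e' e''
    by (cases e'; cases e'') (simp add: A_def D_def)
  have A_B: "e' \<in> B (A e' e'')" for e' e''
    by (cases e'; cases e'') (simp add: A_def B_def)
  have wt_D: "wt e = wt e' + wt (D e e')" if "e' \<in> B e" for e e'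
    using wt_A[of e' "D e e'"] A_D[OF that] by simp
  have fin_W: "finite (W m)" for m
    unfolding W_def by (rule finite_exps_of_weight[OF assms])
  have fin_B: "finite (B e)" for e
    by (cases e) (simp add: B_def)
  have cm: "coeff4 (f * g) e = (\<Sum>e'\<in>B e. coeff4 f e' * coeff4 g (D e e'))" for e
    by (cases e) (simp add: coeff4_mult split_def B_def D_def)
  have "monomial_subst p q s u (f * g) $ n =
      (\<Sum>e\<in>W n. \<Sum>e'\<in>B e. coeff4 f e' * coeff4 g (D e e'))"
    by (simp only: monomial_subst_def fps_nth_Abs_fps cm W_def)
  also have "\<dots> = (\<Sum>(e, e')\<in>(SIGMA e:W n. B e). coeff4 f e' * coeff4 g (D e e'))"
    by (rule sum.Sigma) (auto simp: fin_W fin_B)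
  also have "\<dots> = (\<Sum>(m, e', e'')\<in>(SIGMA m:{..n}. W m \<times> W (n - m)). coeff4 f e' * coeff4 g e'')"
    by (rule sum.reindex_bij_witness
          [of _ "\<lambda>(m, e', e''). (A e' e'', e')" "\<lambda>(e, e'). (wt e', e', D e e')"])
       (auto simp: W A_D D_A A_B wt_A dest: wt_D)
  also have "\<dots> = (\<Sum>m\<le>n. \<Sum>(e', e'')\<in>W m \<times> W (n - m). coeff4 f e' * coeff4 g e'')"
    by (subst sum.Sigma) (auto simp: fin_W split_def)
  also have "\<dots> = (monomial_subst p q s u f * monomial_subst p q s u g) $ n"
    by (simp add: monomial_subst_def fps_mult_nth atLeast0AtMost sum_product
                  sum.cartesian_product W_def)
  finally show "monomial_subst p q s u (f * g) $ n =
    (monomial_subst p q s u f * monomial_subst p q s u g) $ n" .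
qed

lemma monomial_subst_monomial:
  assumes pos: "p > 0" "q > 0" "s > 0" "u > 0"
    and f: "\<And>e. coeff4 f e = (if e = (i, j, k, l) then c else 0)"
  shows "monomial_subst p q s u f = fps_const c * fps_X ^ (i * p + j * q + k * s + l * u)"
  by (rule fps_ext)
     (use finite_exps_of_weight[OF pos] in
       \<open>auto simp: monomial_subst_def f sum.delta fps_X_power_iff exps_of_weight_def\<close>)

lemma monomial_subst_const:
  assumes "p > 0" "q > 0" "s > 0" "u > 0"
  shows "monomial_subst p q s u (fps_const (fps_const (fps_const (fps_const c)))) = fps_const c"
  by (subst monomial_subst_monomial[OF assms, of _ 0 0 0 0 c]) (auto simp: coeff4_def split: if_splits)

lemma monomial_subst_var:
  assumes "p > 0" "q > 0" "s > 0" "u > 0"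
  shows "monomial_subst p q s u var_x = fps_X ^ p"
    and "monomial_subst p q s u var_y = fps_X ^ q"
    and "monomial_subst p q s u var_z = fps_X ^ s"
    and "monomial_subst p q s u var_w = fps_X ^ u"
     apply (subst monomial_subst_monomial[OF assms, of _ 1 0 0 0 1]; auto simp: coeff4_def fps_X_def split: if_splits)
    apply (subst monomial_subst_monomial[OF assms, of _ 0 1 0 0 1]; auto simp: coeff4_def fps_X_def split: if_splits)
   apply (subst monomial_subst_monomial[OF assms, of _ 0 0 1 0 1]; auto simp: coeff4_def fps_X_def split: if_splits)
  apply (subst monomial_subst_monomial[OF assms, of _ 0 0 0 1 1]; auto simp: coeff4_def fps_X_def split: if_splits)
  done

definition defining_ideal :: "nat \<Rightarrow> nat \<Rightarrow> 'k::field fps4 set" where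
  "defining_ideal a r =
     a_kernel ring_of_type_algebra ring_of_type_algebra
       (monomial_subst a (a + r) (a + 2 * r) (a + 3 * r))"


section \<open>Symbolic powers\<close>

text \<open>Ordinary powers of ideals are powers in the monoid \<^const>\<open>ideals_set\<close>.\<close>

definition symbolic_power :: "('r, 's) ring_scheme \<Rightarrow> 'r set \<Rightarrow> nat \<Rightarrow> 'r set" where
  "symbolic_power R P n =
     {x \<in> carrier R. \<exists>s \<in> carrier R - P. s \<otimes>\<^bsub>R\<^esub> x \<in> P [^]\<^bsub>ideals_set R\<^esub> n}"


section \<open>Gorenstein local rings\<close>

definition linear_maps ::
    "('r, 's) ring_scheme \<Rightarrow> ('r, 'm) module \<Rightarrow> ('r, 'n) module \<Rightarrow> ('m \<Rightarrow> 'n) set" where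
  "linear_maps R M N = {f \<in> carrier M \<rightarrow> carrier N.
     (\<forall>x\<in>carrier M. \<forall>y\<in>carrier M. f (x \<oplus>\<^bsub>M\<^esub> y) = f x \<oplus>\<^bsub>N\<^esub> f y) \<and>
     (\<forall>c\<in>carrier R. \<forall>x\<in>carrier M. f (c \<odot>\<^bsub>M\<^esub> x) = c \<odot>\<^bsub>N\<^esub> f x)}"

text \<open>HOL cannot quantify over the modules of all types inside a definition, so injectivity is
  tested on the modules whose carrier lies in the type of the carrier of \<open>E\<close>. By Baer's criterion this
  is the absolute notion as soon as that type has room for a copy of \<open>R\<close>.\<close>

definition injective_module :: "('r, 's) ring_scheme \<Rightarrow> ('r, 'u) module \<Rightarrow> bool" where
  "injective_module R E \<longleftrightarrow> module R E \<and>
     (\<forall>(N :: ('r, 'u) module) M f.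
        module R N \<and> submodule M R N \<and> f \<in> linear_maps R (N\<lparr>carrier := M\<rparr>) E \<longrightarrow>
        (\<exists>g \<in> linear_maps R N E. \<forall>x\<in>M. g x = f x))"

text \<open>Existence of a finite injective resolution \<open>0 \<rightarrow> M \<rightarrow> E 0 \<rightarrow> E 1 \<rightarrow> \<dots>\<close>. The first argument
  fixes the type in which the modules of the resolution live.\<close>

definition finite_injective_dimension ::
    "'u itself \<Rightarrow> ('r, 's) ring_scheme \<Rightarrow> ('r, 'm) module \<Rightarrow> bool" where
  "finite_injective_dimension _ R M \<longleftrightarrow>
     (\<exists>(E :: nat \<Rightarrow> ('r, 'u) module) (\<epsilon> :: 'm \<Rightarrow> 'u) (d :: nat \<Rightarrow> 'u \<Rightarrow> 'u) n.
        (\<forall>i. injective_module R (E i)) \<and>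
        (\<forall>i>n. carrier (E i) = {\<zero>\<^bsub>E i\<^esub>}) \<and>
        \<epsilon> \<in> linear_maps R M (E 0) \<and>
        (\<forall>i. d i \<in> linear_maps R (E i) (E (Suc i))) \<and>
        inj_on \<epsilon> (carrier M) \<and>
        \<epsilon> ` carrier M = a_kernel (E 0) (E 1) (d 0) \<and>
        (\<forall>i. d i ` carrier (E i) = a_kernel (E (Suc i)) (E (Suc (Suc i))) (d (Suc i))))"

definition self_module :: "('r, 's) ring_scheme \<Rightarrow> ('r, 'r) module" where
  "self_module R = \<lparr>carrier = carrier R, monoid.mult = monoid.mult R, one = one R, zero = zero R, add = add R,
     module.smult = monoid.mult R\<rparr>"

definition local_ring :: "('r, 's) ring_scheme \<Rightarrow> bool" where
  "local_ring R \<longleftrightarrow> cring R \<and> (\<exists>!m. maximalideal m R)"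

text \<open>The type \<open>'r list\<close> is large enough for the resolution: over a Noetherian ring \<open>R\<close> the injective
  hull of a module of cardinality at most \<open>max |R| \<aleph>\<^sub>0\<close> again has cardinality at most
  \<open>max |R| \<aleph>\<^sub>0\<close>, so the minimal injective resolution of \<open>R\<close> has an isomorphic copy in it.\<close>

definition gorenstein_local_ring :: "('r, 's) ring_scheme \<Rightarrow> bool" where
  "gorenstein_local_ring R \<longleftrightarrow> noetherian_ring R \<and> local_ring R \<and>
     finite_injective_dimension TYPE('r list) R (self_module R)"

end

theory Submission
  imports Defs "HOL-Computational_Algebra.Formal_Laurent_Series"
begin

text \<open>
  Every integer is \<open>N a + I r\<close> for unique \<open>N\<close> and \<open>0 \<le> I < a\<close>, and it lies in the semigroup \<open>H\<close> iff
  \<open>I \<le> 3 N\<close>. For \<open>a = 3 k + 2\<close> this makes \<open>H\<close> symmetric, and then \<open>0 \<rightarrow> A \<rightarrow> K \<rightarrow> K/A \<rightarrow> 0\<close>, with \<open>K\<close> the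
  fraction field, is an injective resolution: the residue functional at the Frobenius number turns
  maps into \<open>K/A\<close> into linear functionals. For \<open>a = 3 k\<close> and \<open>a = 3 k + 1\<close> the images of
  \<open>z w^(k - 1)\<close> and \<open>y w^(k - 1)\<close> are independent socle elements of \<open>A/xA\<close>, and walking down a finite
  injective resolution one finds that such a pair cannot exist.

  The vanishing \<open>\<phi> p = 0\<close> forces the coefficient of a monomial to be zero in all \<open>p \<in> P\<close> if no other
  monomial has the same weight. This gives monomials that no element of \<open>P\<^sup>2\<close> or \<open>P\<^sup>3\<close> contains, but that
  occur in an explicit \<open>D\<close> with \<open>x D \<in> P\<^sup>2\<close> or \<open>x D \<in> P\<^sup>3\<close>: a \<open>3 \<times> 3\<close> determinant in the first case, a
  minor of the Jacobian dual of the Pfaffian syzygies, divided by \<open>x\<close>, in the second.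

  For \<open>a = 3 k + 2\<close> the ideal \<open>P\<close> is generated by five Pfaffians \<open>p\<^sub>i\<close>. An element of the symbolic square and
  all its partial derivatives lie in \<open>P\<close>. Writing it as \<open>\<Sum> g\<^sub>i p\<^sub>i\<close>, the images of the \<open>g\<^sub>i\<close> lie in the kernel of
  the Jacobian matrix over \<open>A\<close>; the structure of \<open>H\<close> shows that this kernel is spanned by the five Pfaffian
  syzygies, so the \<open>g\<^sub>i\<close> can be corrected to lie in \<open>P\<close>.
\<close>


section \<open>Numerical semigroups generated by four terms of an arithmetic progression\<close>

text \<open>Injectivity is tested in one type only, whereas Baer's criterion speaks of ideals alone.
  It is therefore used in both directions: to exploit the modules of a given resolution, and to move
  a constructed resolution into the prescribed type. The negative half about Gorenstein rings is the
  classical fact that finite injective dimension forces type one, carried out with elements: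
  extending maps from the maximal ideal into a cosyzygy amounts to the vanishing of Ext^1 of the
  residue field. The constants come from one exchange: \<open>a\<close> steps of length
  \<open>r\<close> weigh as much as \<open>r\<close> copies of \<open>a\<close>. For
  \<open>a = 3 k + 2\<close> the monomial \<open>w^k z\<close> takes exactly \<open>a\<close> steps
  and \<open>w^(k + 1)\<close> takes \<open>a + 1\<close>, which gives the two generators beyond the
  minors of the twisted cubic. The characteristic is arbitrary, so a spurious kernel of the Jacobian
  has to be excluded. The integers in its equations combine to \<open>a\<close> and
  \<open>r\<close>, which are coprime and hence do not both vanish in \<open>F\<close>.\<close>

definition arith_semigroup :: "nat \<Rightarrow> nat \<Rightarrow> int set" where
  "arith_semigroup a r = {N * int a + I * int r | N I. 0 \<le> I \<and> I \<le> 3 * N}"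

lemma arith_semigroupI: "0 \<le> I \<Longrightarrow> I \<le> 3 * N \<Longrightarrow> N * int a + I * int r \<in> arith_semigroup a r"
  unfolding arith_semigroup_def by blast

lemma arith_semigroup_0: "0 \<in> arith_semigroup a r"
  using arith_semigroupI[of 0 0 a r] by simp

lemma arith_semigroup_add:
  assumes "m \<in> arith_semigroup a r" "n \<in> arith_semigroup a r"
  shows "m + n \<in> arith_semigroup a r"
proof -
  from assms obtain N I N' I' where "m = N * int a + I * int r" "0 \<le> I" "I \<le> 3 * N"
    "n = N' * int a + I' * int r" "0 \<le> I'" "I' \<le> 3 * N'"
    unfolding arith_semigroup_def by blast
  then show ?thesis
    using arith_semigroupI[of "I + I'" "N + N'" a r] by (simp add: algebra_simps)
qed

lemma arith_semigroup_nonneg: "n \<in> arith_semigroup a r \<Longrightarrow> 0 \<le> n"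
  unfolding arith_semigroup_def by auto

lemma arith_semigroup_gen: "int a \<in> arith_semigroup a r"
  using arith_semigroupI[of 0 1 a r] by simp

locale arith_pair =
  fixes a r :: nat
  assumes a_pos: "a > 0" and r_pos: "r > 0" and coprime: "coprime a r"
begin

abbreviation H :: "int set" where "H \<equiv> arith_semigroup a r"

lemma same_weight:
  assumes "N * int a + I * int r = N' * int a + I' * int r"
  obtains s where "I' = I + s * int a" "N = N' + s * int r"
proof -
  have e: "(N - N') * int a = (I' - I) * int r"
    using assms by (simp add: algebra_simps)
  then have "int a dvd (I' - I) * int r"
    by (metis dvd_triv_right)
  moreover have "coprime (int a) (int r)"
    using coprime by simp
  ultimately have "int a dvd I' - I"
    by (simp add: coprime_dvd_mult_left_iff)
  then obtain s where s: "I' - I = int a * s" ..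
  with e have "(N - N') * int a = (s * int r) * int a"
    by simp
  then have "N - N' = s * int r"
    using a_pos by simp
  with s that[of s] show thesis
    by (simp add: algebra_simps)
qed

text \<open>By \<open>same_weight\<close>, any other representation with a nonnegative number of
  steps has more steps and fewer summands. So the reduced one satisfies the inequality as soon as
  some representation does.\<close>

lemma mem_iff:
  assumes "0 \<le> I" "I < int a"
  shows "N * int a + I * int r \<in> H \<longleftrightarrow> I \<le> 3 * N"
proof
  assume "N * int a + I * int r \<in> H"
  then obtain N' I' where *: "N * int a + I * int r = N' * int a + I' * int r" "0 \<le> I'" "I' \<le> 3 * N'"
    unfolding arith_semigroup_def by blast
  from same_weight[OF *(1)] obtain s where s: "I' = I + s * int a" "N = N' + s * int r" .
  have "s \<ge> 0"
  proof (rule ccontr)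
    assume "\<not> s \<ge> 0"
    then have "s * int a \<le> (-1) * int a" by (intro mult_right_mono) auto
    with s * assms show False by linarith
  qed
  then have "0 \<le> s * int a" "0 \<le> s * int r" by simp_all
  with s * show "I \<le> 3 * N" by linarith
qed (use assms in \<open>auto intro: arith_semigroupI\<close>)

lemma normal_form:
  obtains N I where "n = N * int a + I * int r" "0 \<le> I" "I < int a"
proof -
  have "coprime (int a) (int r)"
    using coprime by simp
  then obtain p q where pq: "p * int a + q * int r = 1"
    by (metis bezout_int coprime_iff_gcd_eq_1)
  define I where "I = (n * q) mod int a"
  define d where "d = (n * q) div int a"
  have nq: "n * q = d * int a + I"
    unfolding I_def d_def by simp
  have "n = n * (p * int a + q * int r)"
    using pq by simp
  also have "\<dots> = (n * p) * int a + (n * q) * int r"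
    by (simp add: algebra_simps)
  also have "\<dots> = (n * p + d * int r) * int a + I * int r"
    unfolding nq by (simp add: algebra_simps)
  finally have "n = (n * p + d * int r) * int a + I * int r" .
  moreover have "0 \<le> I" "I < int a"
    using a_pos by (simp_all add: I_def)
  ultimately show thesis
    by (rule that)
qed

lemma conductor: "\<exists>C. \<forall>n\<ge>C. n \<in> H"
proof (intro exI allI impI)
  \<comment> \<open>A crude bound: at most \<open>a r\<close> of the weight is due to
    \<open>I\<close>, so \<open>N\<close> is at least \<open>3 a\<close>, well above
    \<open>I / 3\<close>.\<close>
  fix n assume n: "n \<ge> 3 * int a * int a + int a * int r"
  obtain N I where NI: "n = N * int a + I * int r" "0 \<le> I" "I < int a"
    by (rule normal_form)
  have "I * int r \<le> int a * int r"
    using NI by (intro mult_right_mono) auto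
  with n NI have "3 * int a * int a \<le> N * int a" by linarith
  then have "3 * int a \<le> N"
    using a_pos by simp
  with NI show "n \<in> H"
    by (auto simp: mem_iff)
qed

text \<open>The weight is that of the monomial \<open>z^i w^j\<close>.\<close>

lemma unique_weight:
  fixes i j :: nat
  assumes "i \<le> 1" "2 * i + 3 * j < a"
    and w: "e1 * a + e2 * (a + r) + e3 * (a + 2 * r) + e4 * (a + 3 * r) = i * (a + 2 * r) + j * (a + 3 * r)"
  shows "e1 = 0 \<and> e2 = 0 \<and> e3 = i \<and> e4 = j"
proof -
  have "int (e1 * a + e2 * (a + r) + e3 * (a + 2 * r) + e4 * (a + 3 * r)) = int (i * (a + 2 * r) + j * (a + 3 * r))"
    using w by simp
  then have "int (i + j) * int a + int (2 * i + 3 * j) * int r =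
     int (e1 + e2 + e3 + e4) * int a + int (e2 + 2 * e3 + 3 * e4) * int r"
    by (simp add: algebra_simps)
  from same_weight[OF this] obtain s where
    s: "int (e2 + 2 * e3 + 3 * e4) = int (2 * i + 3 * j) + s * int a"
       "int (i + j) = int (e1 + e2 + e3 + e4) + s * int r" .
  have "s = 0"
  proof (rule ccontr)
    assume "s \<noteq> 0"
    then consider "s \<le> -1" | "s \<ge> 1" by linarith
    then show False
    proof cases
      case 1
      then have "s * int a \<le> (-1) * int a" by (intro mult_right_mono) auto
      with s assms(2) show False by linarith
    next
      case 2
      then have "1 * int a \<le> s * int a" "1 * int r \<le> s * int r" by (intro mult_right_mono; simp)+
      with s assms(1) a_pos r_pos show False by simp
    qed
  qed
  with s have "e2 + 2 * e3 + 3 * e4 = 2 * i + 3 * j" "i + j = e1 + e2 + e3 + e4"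
    by simp_all
  \<comment> \<open>The slack \<open>3 N - I\<close> of a monomial is
    \<open>3 e1 + 2 e2 + e3\<close>. Slack at most one rules out \<open>x\<close> and
    \<open>y\<close>.\<close>
  then have "3 * e1 + 2 * e2 + e3 = i" and "e1 + e2 + e3 + e4 = i + j"
    by linarith+
  with assms(1) show ?thesis by auto
qed

lemma frobenius_gap:
  assumes a: "a = 3 * k + 2" 
  shows "int k * (int a + 3 * int r) + int r \<notin> H"
proof -
  have "int k * (int a + 3 * int r) + int r = int k * int a + int (3 * k + 1) * int r"
    by (simp add: algebra_simps)
  moreover have "int (3 * k + 1) < int a" "\<not> int (3 * k + 1) \<le> 3 * int k"
    using a by simp_all
  ultimately show ?thesis using mem_iff[of "int (3 * k + 1)" "int k"] by simp
qed

text \<open>The reflection sends the pair \<open>(N, I)\<close> to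
  \<open>(k - N, a - 1 - I)\<close>, which is again reduced. Since \<open>a - 1 = 3 k + 1\<close>,
  exactly one of the two pairs satisfies \<open>I \<le> 3 N\<close>; the extra 1 is what the other
  residues of \<open>a\<close> modulo 3 do not provide.\<close>

lemma symmetric:
  assumes a: "a = 3 * k + 2" 
  shows "n \<in> H \<longleftrightarrow> int k * (int a + 3 * int r) + int r - n \<notin> H"
proof -
  obtain N I where NI: "n = N * int a + I * int r" "0 \<le> I" "I < int a"
    by (rule normal_form)
  have e: "int k * (int a + 3 * int r) + int r - n = (int k - N) * int a + (int (3 * k + 1) - I) * int r"
    by (simp add: algebra_simps NI)
  show ?thesis
    unfolding e unfolding NI(1) using NI a by (subst (1 2) mem_iff) auto
qed

text \<open>Call \<open>3 N - I\<close> the slack. Slack at least 3 allows the removal of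
  \<open>a\<close>, slack 2 with \<open>I > 0\<close> that of \<open>a + r\<close>. With slack at
  most 1 the shifted element lies in \<open>H\<close> only if \<open>I + 2\<close> wraps past
  \<open>a\<close>, which leaves just the weight of \<open>w^k\<close>.\<close>

lemma shift_two:
  assumes a: "a = 3 * k + 2" "k > 0" and n: "n \<in> H" "n + 2 * int r \<in> H"
  shows "n - int a \<in> H \<or> n - int a - int r \<in> H \<or> n = int k * (int a + 3 * int r)"
proof -
  obtain N I where NI: "n = N * int a + I * int r" "0 \<le> I" "I < int a"
    by (rule normal_form)
  have IN: "I \<le> 3 * N" using n(1) NI by (simp add: mem_iff)
  have m1: "n - int a = (N - 1) * int a + I * int r"
    and m2: "n - int a - int r = (N - 1) * int a + (I - 1) * int r"
    and m3: "n + 2 * int r = N * int a + (I + 2) * int r"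
    by (simp_all add: NI algebra_simps)
  have "I \<le> 3 * (N - 1) \<or> (I > 0 \<and> I - 1 \<le> 3 * (N - 1)) \<or> (I = 0 \<and> N = 0) \<or> (I > 0 \<and> 3 * N < I + 2)"
    using IN NI(2) by (smt (verit))
  then consider "I \<le> 3 * (N - 1)" | "I > 0" "I - 1 \<le> 3 * (N - 1)" | "I = 0" "N = 0" 
    | "I > 0" "3 * N < I + 2"
    by blast
  then show ?thesis
  proof cases
    case 1
    then have "n - int a \<in> H" unfolding m1 using NI by (subst mem_iff) auto
    then show ?thesis by simp
  next
    case 2 then show ?thesis using m2 NI by (auto simp: mem_iff)
  next
    case 3
    then have "I + 2 \<le> 3 * N"
      using n(2) NI a mem_iff[of "I + 2" N] unfolding m3 by simp
    with 3 show ?thesis by simp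
  next
    case 4
    have "\<not> I + 2 < int a"
      using n(2) 4 NI unfolding m3 by (auto simp: mem_iff)
    then have "I = 3 * int k \<or> I = 3 * int k + 1" using NI a by auto
    with 4 IN have "I = 3 * int k \<and> N = int k" by presburger
    then show ?thesis using NI by (simp add: algebra_simps)
  qed
qed

text \<open>Again by slack: at least 3 pays for \<open>a\<close>, and at least 1 with
  \<open>I \<ge> 2\<close> pays for \<open>a + 2 r\<close>. Slack 0 would need \<open>I + 1\<close>
  to wrap, but \<open>a - 1 = 3 k + 1\<close> is not a multiple of 3. What remains is the weight of
  \<open>y\<close>.\<close>

lemma shift_one:
  assumes a: "a = 3 * k + 2" "k > 0" and n: "n \<in> H" "n + int r \<in> H"
  shows "n - int a \<in> H \<or> n - int a - 2 * int r \<in> H \<or> n = int a + int r"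
proof -
  obtain N I where NI: "n = N * int a + I * int r" "0 \<le> I" "I < int a"
    by (rule normal_form)
  have IN: "I \<le> 3 * N" using n(1) NI by (simp add: mem_iff)
  have m1: "n - int a = (N - 1) * int a + I * int r"
    and m2: "n - int a - 2 * int r = (N - 1) * int a + (I - 2) * int r"
    and m3: "n + int r = N * int a + (I + 1) * int r"
    by (simp_all add: NI algebra_simps)
  have "I \<le> 3 * (N - 1) \<or> (I > 1 \<and> I - 2 \<le> 3 * (N - 1)) \<or> (I = 0 \<and> N = 0) \<or> (I = 1 \<and> N = 1)
    \<or> (I > 1 \<and> 3 * N = I)"
    using IN NI(2) by (smt (verit))
  then consider "I \<le> 3 * (N - 1)" | "I > 1" "I - 2 \<le> 3 * (N - 1)" | "I = 0" "N = 0" | "I = 1" "N = 1"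
    | "I > 1" "3 * N = I"
    by blast
  then show ?thesis
  proof cases
    case 1
    then have "n - int a \<in> H" unfolding m1 using NI by (subst mem_iff) auto
    then show ?thesis by simp
  next
    case 2 then show ?thesis using m2 NI by (auto simp: mem_iff)
  next
    case 3
    then have "I + 1 \<le> 3 * N"
      using n(2) NI a mem_iff[of "I + 1" N] unfolding m3 by simp
    with 3 show ?thesis by simp
  next
    case 4 then show ?thesis using NI by simp
  next
    case 5
    then have "\<not> I + 1 < int a"
      using n(2) NI unfolding m3 by (auto simp: mem_iff)
    then have "I = 3 * int k + 1" using NI a by auto
    with 5 show ?thesis by presburger
  qed
qed

text \<open>For \<open>j = 1\<close> and \<open>j = 2\<close> these are the weights of \<open>z w^(k - 1)\<close> and \<open>y w^(k - 1)\<close>.\<close>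

lemma socle_weight:
  assumes a: "a = 3 * k \<or> a = 3 * k + 1" "k > 0" and j: "j = 1 \<or> j = 2"
  shows "int k * int a + (3 * int k - j) * int r \<in> H"
    and "int k * int a + (3 * int k - j) * int r - int a \<notin> H"
    and "h \<in> H \<Longrightarrow> h \<noteq> 0 \<Longrightarrow> int k * int a + (3 * int k - j) * int r + h - int a \<in> H"
proof -
  have j': "0 \<le> 3 * int k - j" "3 * int k - j < int a"
    using a j by auto
  then show "int k * int a + (3 * int k - j) * int r \<in> H"
    using j by (subst mem_iff) auto
  have "int k * int a + (3 * int k - j) * int r - int a = (int k - 1) * int a + (3 * int k - j) * int r"
    by (simp add: algebra_simps)
  then show "int k * int a + (3 * int k - j) * int r - int a \<notin> H"
    using j j' by (simp only:) (subst mem_iff; auto)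
  assume h: "h \<in> H" "h \<noteq> 0"
  obtain N I where NI: "h = N * int a + I * int r" "0 \<le> I" "I < int a"
    by (rule normal_form)
  have IN: "I \<le> 3 * N" using h(1) NI by (simp add: mem_iff)
  with h NI have N: "N \<ge> 1" by (cases "N = 0") auto
  have "int k * int a + (3 * int k - j) * int r + h - int a 
     = (int k + N - 1) * int a + (3 * int k - j + I) * int r"
    by (simp add: NI algebra_simps)
  also have "\<dots> \<in> H"
  \<comment> \<open>Without wrapping, \<open>a \<le> 3 k + 1\<close> gives \<open>I \<le> j\<close>,
    and \<open>N \<ge> 1\<close> pays for the removed \<open>a\<close>. With wrapping,
    \<open>a\<close> steps are exchanged for \<open>r\<close> further summands.\<close>
  proof (cases "3 * int k - j + I < int a")
    case True
    with j j' NI IN N a show ?thesis by (subst mem_iff) auto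
  next
    case False
    have e: "(int k + N - 1) * int a + (3 * int k - j + I) * int r =
       (int k + N - 1 + int r) * int a + (3 * int k - j + I - int a) * int r"
      by (simp add: algebra_simps)
    show ?thesis unfolding e using False j j' NI IN N a r_pos by (intro arith_semigroupI) auto
  qed
  finally show "int k * int a + (3 * int k - j) * int r + h - int a \<in> H" .
qed

end


section \<open>Baer's criterion\<close>

text \<open>A homomorphism on a submodule of \<open>N\<close> is encoded by its graph, so that the domain need not be
  tracked and unions of chains are again graphs.\<close>

definition module_graph :: "('r, 's) ring_scheme \<Rightarrow> ('r, 'n) module \<Rightarrow> ('r, 'e) module \<Rightarrow> ('n \<times> 'e) set \<Rightarrow> bool" where
  "module_graph Q N E G \<longleftrightarrow> G \<subseteq> carrier N \<times> carrier E \<and> (\<zero>\<^bsub>N\<^esub>, \<zero>\<^bsub>E\<^esub>) \<in> G \<and>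
     (\<forall>x y x' y'. (x, y) \<in> G \<longrightarrow> (x', y') \<in> G \<longrightarrow> (x \<oplus>\<^bsub>N\<^esub> x', y \<oplus>\<^bsub>E\<^esub> y') \<in> G) \<and>
     (\<forall>q\<in>carrier Q. \<forall>x y. (x, y) \<in> G \<longrightarrow> (q \<odot>\<^bsub>N\<^esub> x, q \<odot>\<^bsub>E\<^esub> y) \<in> G) \<and>
     (\<forall>y. (\<zero>\<^bsub>N\<^esub>, y) \<in> G \<longrightarrow> y = \<zero>\<^bsub>E\<^esub>)"

lemma module_graphD:
  assumes "module_graph Q N E G"
  shows "(x, y) \<in> G \<Longrightarrow> x \<in> carrier N" "(x, y) \<in> G \<Longrightarrow> y \<in> carrier E"
    "(\<zero>\<^bsub>N\<^esub>, \<zero>\<^bsub>E\<^esub>) \<in> G"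
    "(x, y) \<in> G \<Longrightarrow> (x', y') \<in> G \<Longrightarrow> (x \<oplus>\<^bsub>N\<^esub> x', y \<oplus>\<^bsub>E\<^esub> y') \<in> G"
    "q \<in> carrier Q \<Longrightarrow> (x, y) \<in> G \<Longrightarrow> (q \<odot>\<^bsub>N\<^esub> x, q \<odot>\<^bsub>E\<^esub> y) \<in> G"
    "(\<zero>\<^bsub>N\<^esub>, y) \<in> G \<Longrightarrow> y = \<zero>\<^bsub>E\<^esub>"
  using assms unfolding module_graph_def by blast+

lemma (in module) smult_minus_one:
  assumes "x \<in> carrier M"
  shows "(\<ominus> \<one>) \<odot>\<^bsub>M\<^esub> x = \<ominus>\<^bsub>M\<^esub> x"
  using assms by (simp add: smult_l_minus)

lemma module_graph_uminus:
  assumes "module Q N" "module Q E" "module_graph Q N E G" "(x, y) \<in> G"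
  shows "(\<ominus>\<^bsub>N\<^esub> x, \<ominus>\<^bsub>E\<^esub> y) \<in> G"
proof -
  interpret N: module Q N by fact
  interpret E: module Q E by fact
  note D = module_graphD[OF assms(3)]
  have "(\<ominus>\<^bsub>Q\<^esub> \<one>\<^bsub>Q\<^esub> \<odot>\<^bsub>N\<^esub> x, \<ominus>\<^bsub>Q\<^esub> \<one>\<^bsub>Q\<^esub> \<odot>\<^bsub>E\<^esub> y) \<in> G"
    using D(5)[OF _ assms(4)] by simp
  then show ?thesis
    using D(1,2)[OF assms(4)] by (simp add: N.smult_minus_one E.smult_minus_one)
qed

lemma module_graph_unique:
  assumes "module Q N" "module Q E" "module_graph Q N E G" "(x, y) \<in> G" "(x, y') \<in> G"
  shows "y = y'"
proof -
  interpret N: module Q N by fact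
  interpret E: module Q E by fact
  note D = module_graphD[OF assms(3)]
  have "(x \<oplus>\<^bsub>N\<^esub> (\<ominus>\<^bsub>N\<^esub> x), y \<oplus>\<^bsub>E\<^esub> (\<ominus>\<^bsub>E\<^esub> y')) \<in> G"
    using assms by (intro D(4) module_graph_uminus[of Q N E]) auto
  then have "(\<zero>\<^bsub>N\<^esub>, y \<oplus>\<^bsub>E\<^esub> (\<ominus>\<^bsub>E\<^esub> y')) \<in> G"
    using D(1)[OF assms(4)] by (simp add: N.M.r_neg)
  then have "y \<oplus>\<^bsub>E\<^esub> (\<ominus>\<^bsub>E\<^esub> y') = \<zero>\<^bsub>E\<^esub>"
    by (rule D(6))
  then show ?thesis
    using D(2)[OF assms(4)] D(2)[OF assms(5)]
    by (metis E.M.minus_equality E.M.minus_minus E.M.a_inv_closed)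
qed

text \<open>One step of an extension. By \<open>cz\<close> the value \<open>z\<close> proposed for
  \<open>c\<close> agrees with the graph on those multiples of \<open>c\<close> already in its
  domain, which is what keeps the larger relation single-valued.\<close>

lemma module_graph_adjoin:
  assumes N: "module Q N" and E: "module Q E" and G: "module_graph Q N E G"
    and c: "c \<in> carrier N" and z: "z \<in> carrier E"
    and cz: "\<And>q z'. q \<in> carrier Q \<Longrightarrow> (q \<odot>\<^bsub>N\<^esub> c, z') \<in> G \<Longrightarrow> z' = q \<odot>\<^bsub>E\<^esub> z"
  defines "G' \<equiv> {(x \<oplus>\<^bsub>N\<^esub> q \<odot>\<^bsub>N\<^esub> c, y \<oplus>\<^bsub>E\<^esub> q \<odot>\<^bsub>E\<^esub> z) | x y q. (x, y) \<in> G \<and> q \<in> carrier Q}"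
  shows "module_graph Q N E G'" "G \<subseteq> G'" "c \<in> Domain G'"
proof -
  interpret N: module Q N by fact
  interpret E: module Q E by fact
  note D = module_graphD[OF G]
  have I: "(x \<oplus>\<^bsub>N\<^esub> q \<odot>\<^bsub>N\<^esub> c, y \<oplus>\<^bsub>E\<^esub> q \<odot>\<^bsub>E\<^esub> z) \<in> G'" if "(x, y) \<in> G" "q \<in> carrier Q" for x y q
    using that unfolding G'_def by blast
  show sub: "G \<subseteq> G'"
  proof clarify
    fix x y assume xy: "(x, y) \<in> G"
    then show "(x, y) \<in> G'"
      using I[OF xy, of "\<zero>\<^bsub>Q\<^esub>"] D(1,2)[OF xy] c z by simp
  qed
  show "c \<in> Domain G'"
    using I[OF D(3), of "\<one>\<^bsub>Q\<^esub>"] c z by auto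
  show "module_graph Q N E G'"
    unfolding module_graph_def
  proof (intro conjI allI impI ballI)
    show "G' \<subseteq> carrier N \<times> carrier E"
      unfolding G'_def using D(1,2) c z by auto
    show "(\<zero>\<^bsub>N\<^esub>, \<zero>\<^bsub>E\<^esub>) \<in> G'"
      using sub D(3) by blast
  next
    fix x1 y1 x2 y2 assume "(x1, y1) \<in> G'" "(x2, y2) \<in> G'"
    then obtain x y q x' y' q' where *: "(x, y) \<in> G" "q \<in> carrier Q" "(x', y') \<in> G" "q' \<in> carrier Q"
      "x1 = x \<oplus>\<^bsub>N\<^esub> q \<odot>\<^bsub>N\<^esub> c" "y1 = y \<oplus>\<^bsub>E\<^esub> q \<odot>\<^bsub>E\<^esub> z" 
      "x2 = x' \<oplus>\<^bsub>N\<^esub> q' \<odot>\<^bsub>N\<^esub> c" "y2 = y' \<oplus>\<^bsub>E\<^esub> q' \<odot>\<^bsub>E\<^esub> z"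
      unfolding G'_def by blast
    have "x1 \<oplus>\<^bsub>N\<^esub> x2 = (x \<oplus>\<^bsub>N\<^esub> x') \<oplus>\<^bsub>N\<^esub> (q \<oplus>\<^bsub>Q\<^esub> q') \<odot>\<^bsub>N\<^esub> c"
      using * D(1) c by (simp add: N.smult_l_distr N.M.a_ac)
    moreover have "y1 \<oplus>\<^bsub>E\<^esub> y2 = (y \<oplus>\<^bsub>E\<^esub> y') \<oplus>\<^bsub>E\<^esub> (q \<oplus>\<^bsub>Q\<^esub> q') \<odot>\<^bsub>E\<^esub> z"
      using * D(2) z by (simp add: E.smult_l_distr E.M.a_ac)
    ultimately show "(x1 \<oplus>\<^bsub>N\<^esub> x2, y1 \<oplus>\<^bsub>E\<^esub> y2) \<in> G'"
      using I[OF D(4)[OF *(1,3)], of "q \<oplus>\<^bsub>Q\<^esub> q'"] * by simp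
  next
    fix p x1 y1 assume p: "p \<in> carrier Q" and "(x1, y1) \<in> G'"
    then obtain x y q where *: "(x, y) \<in> G" "q \<in> carrier Q"
      "x1 = x \<oplus>\<^bsub>N\<^esub> q \<odot>\<^bsub>N\<^esub> c" "y1 = y \<oplus>\<^bsub>E\<^esub> q \<odot>\<^bsub>E\<^esub> z"
      unfolding G'_def by blast
    then show "(p \<odot>\<^bsub>N\<^esub> x1, p \<odot>\<^bsub>E\<^esub> y1) \<in> G'"
      using I[OF D(5)[OF p *(1)], of "p \<otimes>\<^bsub>Q\<^esub> q"] p c z D(1,2)[OF *(1)]
      by (simp add: N.smult_r_distr E.smult_r_distr N.smult_assoc1 E.smult_assoc1)
  next
    fix y1 assume "(\<zero>\<^bsub>N\<^esub>, y1) \<in> G'"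
    then obtain x y q where *: "(x, y) \<in> G" "q \<in> carrier Q"
      "\<zero>\<^bsub>N\<^esub> = x \<oplus>\<^bsub>N\<^esub> q \<odot>\<^bsub>N\<^esub> c" "y1 = y \<oplus>\<^bsub>E\<^esub> q \<odot>\<^bsub>E\<^esub> z"
      unfolding G'_def by blast
    have cl: "x \<in> carrier N" "y \<in> carrier E" "q \<odot>\<^bsub>N\<^esub> c \<in> carrier N" "q \<odot>\<^bsub>E\<^esub> z \<in> carrier E"
      using * D(1,2) c z by auto
    have "q \<odot>\<^bsub>N\<^esub> c = \<ominus>\<^bsub>N\<^esub> x"
      using *(3) cl by (metis N.M.minus_equality N.M.a_comm)
    then have "(q \<odot>\<^bsub>N\<^esub> c, \<ominus>\<^bsub>E\<^esub> y) \<in> G"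
      using module_graph_uminus[OF N E G *(1)] by simp
    from cz[OF *(2) this] *(4) cl show "y1 = \<zero>\<^bsub>E\<^esub>"
      by (metis E.M.r_neg)
  qed
qed

text \<open>Zorn's lemma with the extension step left open. For Baer's criterion any new element
  \<open>c\<close> will do; for maps into a cosyzygy \<open>c\<close> has to be chosen as a socle
  element modulo the current domain.\<close>

lemma module_graph_extend:
  assumes N: "module Q N" and E: "module Q E" and G0: "module_graph Q N E G0"
    and step: "\<And>G. module_graph Q N E G \<Longrightarrow> G0 \<subseteq> G \<Longrightarrow> Domain G \<noteq> carrier N \<Longrightarrow>
      \<exists>c\<in>carrier N - Domain G. \<exists>z\<in>carrier E. \<forall>q\<in>carrier Q. \<forall>z'. (q \<odot>\<^bsub>N\<^esub> c, z') \<in> G \<longrightarrow> z' = q \<odot>\<^bsub>E\<^esub> z"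
  shows "\<exists>g\<in>linear_maps Q N E. \<forall>(x, y)\<in>G0. g x = y"
proof -
  let ?S = "{G. module_graph Q N E G \<and> G0 \<subseteq> G}"
  have "\<exists>M\<in>?S. \<forall>G\<in>?S. M \<subseteq> G \<longrightarrow> G = M"
  proof (rule subset_Zorn_nonempty)
    show "?S \<noteq> {}" using G0 by blast
  next
    fix C assume C: "C \<noteq> {}" "subset.chain ?S C"
    then have mem: "\<And>G. G \<in> C \<Longrightarrow> module_graph Q N E G \<and> G0 \<subseteq> G"
      and ch: "\<And>G G'. G \<in> C \<Longrightarrow> G' \<in> C \<Longrightarrow> G \<subseteq> G' \<or> G' \<subseteq> G"
      unfolding subset.chain_def by blast+
    have "module_graph Q N E (\<Union> C)"
      unfolding module_graph_def
    proof (intro conjI allI impI ballI)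
      show "\<Union> C \<subseteq> carrier N \<times> carrier E"
        using mem unfolding module_graph_def by blast
      show "(\<zero>\<^bsub>N\<^esub>, \<zero>\<^bsub>E\<^esub>) \<in> \<Union> C"
        using mem C(1) module_graphD(3) by blast
    next
      fix x y x' y' assume "(x, y) \<in> \<Union> C" "(x', y') \<in> \<Union> C"
      then obtain G G' where "G \<in> C" "G' \<in> C" "(x, y) \<in> G" "(x', y') \<in> G'" by blast
      with ch[of G G'] obtain G'' where G'': "G'' \<in> C" "(x, y) \<in> G''" "(x', y') \<in> G''" by blast
      then show "(x \<oplus>\<^bsub>N\<^esub> x', y \<oplus>\<^bsub>E\<^esub> y') \<in> \<Union> C"
        using module_graphD(4)[OF conjunct1[OF mem[OF G''(1)]] G''(2,3)] by blast
    next
      fix q x y assume "q \<in> carrier Q" "(x, y) \<in> \<Union> C"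
      then obtain G where "q \<in> carrier Q" "G \<in> C" "(x, y) \<in> G" by blast
      then show "(q \<odot>\<^bsub>N\<^esub> x, q \<odot>\<^bsub>E\<^esub> y) \<in> \<Union> C"
        using mem module_graphD(5)[of Q N E G q x y] by blast
    next
      fix y assume "(\<zero>\<^bsub>N\<^esub>, y) \<in> \<Union> C"
      then obtain G where "G \<in> C" "(\<zero>\<^bsub>N\<^esub>, y) \<in> G" by blast
      then show "y = \<zero>\<^bsub>E\<^esub>"
        using mem module_graphD(6)[of Q N E G y] by blast
    qed
    moreover have "G0 \<subseteq> \<Union> C"
    proof -
      from C(1) obtain G where "G \<in> C" by blast
      with mem[OF this] show ?thesis by blast
    qed
    ultimately show "\<Union> C \<in> ?S" by simp
  qed
  then obtain M where "M \<in> ?S" and max': "\<forall>G\<in>?S. M \<subseteq> G \<longrightarrow> G = M" ..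
  then have M: "module_graph Q N E M" "G0 \<subseteq> M" by simp_all
  have max: "G = M" if "module_graph Q N E G" "M \<subseteq> G" for G
    using bspec[OF max', of G] that M(2) by simp
  note D = module_graphD[OF M(1)]
  have dom: "Domain M = carrier N"
  proof (rule ccontr)
    assume "Domain M \<noteq> carrier N"
    from step[OF M this] obtain c z where cz: "c \<in> carrier N" "c \<notin> Domain M" "z \<in> carrier E"
      "\<And>q z'. q \<in> carrier Q \<Longrightarrow> (q \<odot>\<^bsub>N\<^esub> c, z') \<in> M \<Longrightarrow> z' = q \<odot>\<^bsub>E\<^esub> z"
      by blast
    from max[OF module_graph_adjoin(1,2)[OF N E M(1) cz(1,3,4)]]
      module_graph_adjoin(3)[OF N E M(1) cz(1,3,4)] cz(2)
    show False by simp
  qed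
  define g where "g x = (THE y. (x, y) \<in> M)" for x
  have g: "g x = y" if "(x, y) \<in> M" for x y
    unfolding g_def using that module_graph_unique[OF N E M(1)] by blast
  have gM: "(x, g x) \<in> M" if "x \<in> carrier N" for x
    using that g dom by blast
  have "g \<in> linear_maps Q N E"
    unfolding linear_maps_def
    using gM D(2,4,5) by (auto intro!: g)
  then show ?thesis
    using g M(2) by blast
qed

text \<open>The test objects are ideals of \<open>Q\<close>, given as domains of graphs, and the
  extended map is determined by the image \<open>e\<close> of one. No type of test modules enters,
  so the property can be transported to any type.\<close>

definition baer_module :: "('r, 's) ring_scheme \<Rightarrow> ('r, 'e) module \<Rightarrow> bool" where
  "baer_module Q E \<longleftrightarrow> module Q E \<and> (\<forall>G. module_graph Q (self_module Q) E G \<longrightarrow>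
     (\<exists>e\<in>carrier E. \<forall>(q, z)\<in>G. z = q \<odot>\<^bsub>E\<^esub> e))"

lemma self_module_simps [simp]:
  "carrier (self_module Q) = carrier Q" "zero (self_module Q) = \<zero>\<^bsub>Q\<^esub>"
  "add (self_module Q) = add Q" "module.smult (self_module Q) = monoid.mult Q"
  by (simp_all add: self_module_def)

lemma module_self_module:
  assumes "cring Q"
  shows "module Q (self_module Q)"
proof -
  interpret cring Q by fact
  show ?thesis
    by (rule moduleI[OF assms abelian_groupI])
      (auto simp: self_module_def a_ac m_assoc l_distr r_distr intro: add.l_inv_ex)
qed

lemma baer_imp_injective:
  assumes "baer_module Q E"
  shows "injective_module Q E"
  unfolding injective_module_def
proof (intro conjI allI impI)
  show E: "module Q E" using assms by (simp add: baer_module_def)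
  fix N :: "('a, 'c) module" and M f
  assume *: "module Q N \<and> submodule M Q N \<and> f \<in> linear_maps Q (N\<lparr>carrier := M\<rparr>) E"
  then have N: "module Q N" by blast
  interpret N: module Q N by fact
  interpret E: module Q E by fact
  interpret M: submodule M Q N using * by blast
  have M: "M \<subseteq> carrier N" "\<zero>\<^bsub>N\<^esub> \<in> M" "\<And>x y. x \<in> M \<Longrightarrow> y \<in> M \<Longrightarrow> x \<oplus>\<^bsub>N\<^esub> y \<in> M"
    "\<And>q x. q \<in> carrier Q \<Longrightarrow> x \<in> M \<Longrightarrow> q \<odot>\<^bsub>N\<^esub> x \<in> M"
    using M.subset M.one_closed M.m_closed M.smult_closed by auto
  have f: "\<And>x. x \<in> M \<Longrightarrow> f x \<in> carrier E" "\<And>x y. x \<in> M \<Longrightarrow> y \<in> M \<Longrightarrow> f (x \<oplus>\<^bsub>N\<^esub> y) = f x \<oplus>\<^bsub>E\<^esub> f y"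
    "\<And>q x. q \<in> carrier Q \<Longrightarrow> x \<in> M \<Longrightarrow> f (q \<odot>\<^bsub>N\<^esub> x) = q \<odot>\<^bsub>E\<^esub> f x"
    using * by (auto simp: linear_maps_def)
  have f0: "f \<zero>\<^bsub>N\<^esub> = \<zero>\<^bsub>E\<^esub>"
    using f(3)[of "\<zero>\<^bsub>Q\<^esub>" "\<zero>\<^bsub>N\<^esub>"] f(1) M(2) by simp
  let ?G0 = "{(x, f x) | x. x \<in> M}"
  have G0: "module_graph Q N E ?G0"
    unfolding module_graph_def
  proof (intro conjI allI impI ballI)
    show "?G0 \<subseteq> carrier N \<times> carrier E" using M(1) f(1) by auto
    show "(\<zero>\<^bsub>N\<^esub>, \<zero>\<^bsub>E\<^esub>) \<in> ?G0" using M f0 by auto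
    show "(x \<oplus>\<^bsub>N\<^esub> x', y \<oplus>\<^bsub>E\<^esub> y') \<in> ?G0" if "(x, y) \<in> ?G0" "(x', y') \<in> ?G0" for x y x' y'
      using that M(3)[of x x'] f(2)[of x x'] by simp
    show "(q \<odot>\<^bsub>N\<^esub> x, q \<odot>\<^bsub>E\<^esub> y) \<in> ?G0" if "q \<in> carrier Q" "(x, y) \<in> ?G0" for q x y
      using that M(4)[of q x] f(3)[of q x] by simp
    show "y = \<zero>\<^bsub>E\<^esub>" if "(\<zero>\<^bsub>N\<^esub>, y) \<in> ?G0" for y
      using that f0 by simp
  qed
  have "\<exists>g\<in>linear_maps Q N E. \<forall>(x, y)\<in>?G0. g x = y"
  proof (rule module_graph_extend[OF N E G0])
    fix G assume G: "module_graph Q N E G" "Domain G \<noteq> carrier N"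
    note D = module_graphD[OF G(1)]
    have "Domain G \<subseteq> carrier N" using D(1) by (auto elim: DomainE)
    with G(2) obtain c where c: "c \<in> carrier N" "c \<notin> Domain G" by auto
    \<comment> \<open>The domain of this graph is the ideal of all \<open>q\<close> that carry
      \<open>c\<close> into the domain of \<open>G\<close>. Its Baer element is the value to be
      assigned to \<open>c\<close>.\<close>
    let ?J = "{(q, z). q \<in> carrier Q \<and> (q \<odot>\<^bsub>N\<^esub> c, z) \<in> G}"
    have "module_graph Q (self_module Q) E ?J"
      unfolding module_graph_def
    proof (intro conjI allI impI ballI)
      show "?J \<subseteq> carrier (self_module Q) \<times> carrier E" using D(2) by auto
      show "(\<zero>\<^bsub>self_module Q\<^esub>, \<zero>\<^bsub>E\<^esub>) \<in> ?J" using D(3) c by simp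
      show "(p \<oplus>\<^bsub>self_module Q\<^esub> p', y \<oplus>\<^bsub>E\<^esub> y') \<in> ?J" if "(p, y) \<in> ?J" "(p', y') \<in> ?J" for p y p' y'
        using that c D(4)[of "p \<odot>\<^bsub>N\<^esub> c" y "p' \<odot>\<^bsub>N\<^esub> c" y'] by (simp add: N.smult_l_distr)
      show "(q \<odot>\<^bsub>self_module Q\<^esub> p, q \<odot>\<^bsub>E\<^esub> y) \<in> ?J" if "q \<in> carrier Q" "(p, y) \<in> ?J" for q p y
        using that c D(5)[of q "p \<odot>\<^bsub>N\<^esub> c" y] by (simp add: N.smult_assoc1)
      show "y = \<zero>\<^bsub>E\<^esub>" if "(\<zero>\<^bsub>self_module Q\<^esub>, y) \<in> ?J" for y
        using that c D(6)[of y] by simp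
    qed
    then obtain e where "e \<in> carrier E" "\<forall>(q, z)\<in>?J. z = q \<odot>\<^bsub>E\<^esub> e"
      using assms unfolding baer_module_def by blast
    then show "\<exists>c\<in>carrier N - Domain G. \<exists>z\<in>carrier E. \<forall>q\<in>carrier Q. \<forall>z'. (q \<odot>\<^bsub>N\<^esub> c, z') \<in> G \<longrightarrow> z' = q \<odot>\<^bsub>E\<^esub> z"
      using c by (intro bexI[of _ c] bexI[of _ e]) auto
  qed
  then obtain g where "g \<in> linear_maps Q N E" "\<forall>(x, y)\<in>?G0. g x = y" ..
  then show "\<exists>g\<in>linear_maps Q N E. \<forall>x\<in>M. g x = f x"
    by (intro bexI[of _ g]) auto
qed

section \<open>Transport of module structures along injections\<close>

definition module_image :: "('m \<Rightarrow> 'n) \<Rightarrow> ('r, 'm) module \<Rightarrow> ('r, 'n) module" where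
  "module_image j M = (let i = inv_into (carrier M) j in
     \<lparr>carrier = j ` carrier M, monoid.mult = undefined, one = undefined, zero = j \<zero>\<^bsub>M\<^esub>,
      add = (\<lambda>u v. j (i u \<oplus>\<^bsub>M\<^esub> i v)), module.smult = (\<lambda>q u. j (q \<odot>\<^bsub>M\<^esub> i u))\<rparr>)"

context
  fixes Q :: "('r, 's) ring_scheme" and M :: "('r, 'm) module" and j :: "'m \<Rightarrow> 'n"
  assumes M: "module Q M" and j: "inj_on j (carrier M)"
begin

interpretation M: module Q M by (rule M)

lemma module_image_simps [simp]:
  "carrier (module_image j M) = j ` carrier M" "zero (module_image j M) = j \<zero>\<^bsub>M\<^esub>"
  "x \<in> carrier M \<Longrightarrow> y \<in> carrier M \<Longrightarrow> j x \<oplus>\<^bsub>module_image j M\<^esub> j y = j (x \<oplus>\<^bsub>M\<^esub> y)"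
  "x \<in> carrier M \<Longrightarrow> q \<odot>\<^bsub>module_image j M\<^esub> j x = j (q \<odot>\<^bsub>M\<^esub> x)"
  using j by (simp_all add: module_image_def Let_def)

lemma module_module_image: "module Q (module_image j M)"
proof (rule moduleI)
  show "cring Q" by (rule M.R.is_cring)
  show "abelian_group (module_image j M)"
  proof (rule abelian_groupI)
    fix x assume "x \<in> carrier (module_image j M)"
    then obtain x' where "x = j x'" "x' \<in> carrier M" by auto
    then show "\<exists>y\<in>carrier (module_image j M). y \<oplus>\<^bsub>module_image j M\<^esub> x = \<zero>\<^bsub>module_image j M\<^esub>"
      by (intro bexI[of _ "j (\<ominus>\<^bsub>M\<^esub> x')"]) (auto simp: M.M.l_neg)
  qed (auto simp: M.M.a_ac)
qed (auto simp: M.smult_l_distr M.smult_r_distr M.smult_assoc1)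

lemma baer_module_image:
  assumes "baer_module Q M"
  shows "baer_module Q (module_image j M)"
  unfolding baer_module_def
proof (intro conjI allI impI module_module_image)
  fix G assume G: "module_graph Q (self_module Q) (module_image j M) G"
  note D = module_graphD[OF G]
  let ?G = "{(q, z). z \<in> carrier M \<and> (q, j z) \<in> G}"
  have "module_graph Q (self_module Q) M ?G"
    unfolding module_graph_def
  proof (intro conjI allI impI ballI)
    show "?G \<subseteq> carrier (self_module Q) \<times> carrier M"
      using D(1) by auto
    show "(\<zero>\<^bsub>self_module Q\<^esub>, \<zero>\<^bsub>M\<^esub>) \<in> ?G"
      using D(3) by simp
    show "(x \<oplus>\<^bsub>self_module Q\<^esub> x', y \<oplus>\<^bsub>M\<^esub> y') \<in> ?G" if "(x, y) \<in> ?G" "(x', y') \<in> ?G" for x y x' y'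
      using that D(4)[of x "j y" x' "j y'"] by simp
    show "(q \<odot>\<^bsub>self_module Q\<^esub> x, q \<odot>\<^bsub>M\<^esub> y) \<in> ?G" if "q \<in> carrier Q" "(x, y) \<in> ?G" for q x y
      using that D(5)[of q x "j y"] by simp
    show "y = \<zero>\<^bsub>M\<^esub>" if "(\<zero>\<^bsub>self_module Q\<^esub>, y) \<in> ?G" for y
      using that D(6)[of "j y"] inj_onD[OF j, of y "\<zero>\<^bsub>M\<^esub>"] by simp
  qed
  then obtain e where e: "e \<in> carrier M" "\<And>q z. (q, z) \<in> ?G \<Longrightarrow> z = q \<odot>\<^bsub>M\<^esub> e"
    using assms unfolding baer_module_def by blast
  have "z = q \<odot>\<^bsub>module_image j M\<^esub> j e" if "(q, z) \<in> G" for q z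
    using that e D(2)[OF that] by force
  with e(1) show "\<exists>e\<in>carrier (module_image j M). \<forall>(q, z)\<in>G. z = q \<odot>\<^bsub>module_image j M\<^esub> e"
    by (intro bexI[of _ "j e"]) auto
qed

end

text \<open>Injectivity of \<open>E\<close> is only tested inside the type of \<open>E\<close>. The
  map \<open>j\<close> places a copy of \<open>Q\<close> there, and the image of its unit under the
  extended homomorphism is the Baer element.\<close>

lemma injective_imp_baer:
  fixes Q :: "('r, 's) ring_scheme" and E :: "('r, 'e) module" and j :: "'r \<Rightarrow> 'e"
  assumes inj: "injective_module Q E" and j: "inj_on j (carrier Q)"
  shows "baer_module Q E"
  unfolding baer_module_def
proof (intro conjI allI impI)
  show E: "module Q E" using inj by (simp add: injective_module_def)
  fix G assume G: "module_graph Q (self_module Q) E G"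
  note D = module_graphD[OF G]
  interpret E: module Q E by fact
  have S: "module Q (self_module Q)" by (rule module_self_module[OF E.R.is_cring])
  have j': "inj_on j (carrier (self_module Q))" using j by simp
  let ?N = "module_image j (self_module Q)"
  note I = module_image_simps[OF S j', unfolded self_module_simps]
  have N: "module Q ?N" by (rule module_module_image[OF S j'])
  interpret N: module Q ?N by fact
  define f where "f u = (THE z. \<exists>q. (q, z) \<in> G \<and> u = j q)" for u
  have f: "f (j q) = z" if "(q, z) \<in> G" for q z
    unfolding f_def
  proof (rule the_equality)
    fix z' assume "\<exists>q'. (q', z') \<in> G \<and> j q = j q'"
    then obtain q' where q': "(q', z') \<in> G" "j q = j q'" by blast
    then have "q = q'" using D(1)[OF that] D(1)[OF q'(1)] inj_onD[OF j'] by blast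
    with q' that show "z' = z" using module_graph_unique[OF S E G] by blast
  qed (use that in blast)
  have sub: "submodule (j ` Domain G) Q ?N"
  proof (rule N.submoduleI)
    show "j ` Domain G \<subseteq> carrier ?N" using D(1) I by auto
    show "\<zero>\<^bsub>?N\<^esub> \<in> j ` Domain G" using D(3) I by force
    show "\<ominus>\<^bsub>?N\<^esub> u \<in> j ` Domain G" if u: "u \<in> j ` Domain G" for u
    proof -
      from u obtain q z where q: "(q, z) \<in> G" "u = j q" by blast
      have qc: "q \<in> carrier Q" using D(1)[OF q(1)] by simp
      have "(\<ominus>\<^bsub>Q\<^esub> q, \<ominus>\<^bsub>E\<^esub> z) \<in> G" 
        using D(5)[of "\<ominus>\<^bsub>Q\<^esub> \<one>\<^bsub>Q\<^esub>", OF _ q(1)] qc D(2)[OF q(1)] by (simp add: E.smult_minus_one E.R.l_minus)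
      moreover have "\<ominus>\<^bsub>?N\<^esub> u = j (\<ominus>\<^bsub>Q\<^esub> q)"
        using qc q(2) I by (intro N.M.minus_equality) (auto simp: E.R.l_neg)
      ultimately show ?thesis by blast
    qed
    show "u \<oplus>\<^bsub>?N\<^esub> v \<in> j ` Domain G" if "u \<in> j ` Domain G" "v \<in> j ` Domain G" for u v
    proof -
      from that obtain q z q' z' where *: "(q, z) \<in> G" "(q', z') \<in> G" "u = j q" "v = j q'" by auto
      then show ?thesis
        using D(4)[OF *(1,2)] D(1)[OF *(1)] D(1)[OF *(2)] I by auto
    qed
    show "q \<odot>\<^bsub>?N\<^esub> u \<in> j ` Domain G" if "q \<in> carrier Q" "u \<in> j ` Domain G" for q u
    proof -
      from that obtain p z where *: "(p, z) \<in> G" "u = j p" by auto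
      then show ?thesis
        using D(5)[OF that(1) *(1)] D(1)[OF *(1)] I by auto
    qed
  qed
  have "f \<in> linear_maps Q (?N\<lparr>carrier := j ` Domain G\<rparr>) E"
    unfolding linear_maps_def
  proof (intro CollectI conjI ballI Pi_I)
    fix u assume "u \<in> carrier (?N\<lparr>carrier := j ` Domain G\<rparr>)"
    then show "f u \<in> carrier E" using f D(2) by auto
  next
    fix u v assume "u \<in> carrier (?N\<lparr>carrier := j ` Domain G\<rparr>)" "v \<in> carrier (?N\<lparr>carrier := j ` Domain G\<rparr>)"
    then obtain q z q' z' where *: "(q, z) \<in> G" "(q', z') \<in> G" "u = j q" "v = j q'" by auto
    then show "f (u \<oplus>\<^bsub>?N\<lparr>carrier := j ` Domain G\<rparr>\<^esub> v) = f u \<oplus>\<^bsub>E\<^esub> f v"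
      using f[OF *(1)] f[OF *(2)] f[OF D(4)[OF *(1,2)]] D(1)[OF *(1)] D(1)[OF *(2)] I by simp
  next
    fix p u assume p: "p \<in> carrier Q" and "u \<in> carrier (?N\<lparr>carrier := j ` Domain G\<rparr>)"
    then obtain q z where *: "(q, z) \<in> G" "u = j q" by auto
    then show "f (p \<odot>\<^bsub>?N\<lparr>carrier := j ` Domain G\<rparr>\<^esub> u) = p \<odot>\<^bsub>E\<^esub> f u"
      using f[OF *(1)] f[OF D(5)[OF p *(1)]] D(1)[OF *(1)] I by simp
  qed
  with N sub inj obtain g where g: "g \<in> linear_maps Q ?N E" "\<forall>u\<in>j ` Domain G. g u = f u"
    unfolding injective_module_def by blast
  have one: "j \<one>\<^bsub>Q\<^esub> \<in> carrier ?N" using I by simp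
  have "z = q \<odot>\<^bsub>E\<^esub> g (j \<one>\<^bsub>Q\<^esub>)" if "(q, z) \<in> G" for q z
  proof -
    have q: "q \<in> carrier Q" using D(1)[OF that] by simp
    have "z = g (j q)" using that g(2) f by force
    also have "j q = q \<odot>\<^bsub>?N\<^esub> j \<one>\<^bsub>Q\<^esub>" using q I by simp
    also have "g \<dots> = q \<odot>\<^bsub>E\<^esub> g (j \<one>\<^bsub>Q\<^esub>)" using q one g(1) unfolding linear_maps_def by blast
    finally show ?thesis .
  qed
  moreover have "g (j \<one>\<^bsub>Q\<^esub>) \<in> carrier E" using one g(1) unfolding linear_maps_def by blast
  ultimately show "\<exists>e\<in>carrier E. \<forall>(q, z)\<in>G. z = q \<odot>\<^bsub>E\<^esub> e" by blast
qed


section \<open>Finite injective resolutions and the socle\<close>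

lemma linear_mapsD:
  assumes "f \<in> linear_maps Q M N"
  shows "x \<in> carrier M \<Longrightarrow> f x \<in> carrier N"
    "x \<in> carrier M \<Longrightarrow> y \<in> carrier M \<Longrightarrow> f (x \<oplus>\<^bsub>M\<^esub> y) = f x \<oplus>\<^bsub>N\<^esub> f y"
    "q \<in> carrier Q \<Longrightarrow> x \<in> carrier M \<Longrightarrow> f (q \<odot>\<^bsub>M\<^esub> x) = q \<odot>\<^bsub>N\<^esub> f x"
  using assms by (auto simp: linear_maps_def)

lemma linear_maps_zero:
  assumes "module Q M" "module Q N" "f \<in> linear_maps Q M N"
  shows "f \<zero>\<^bsub>M\<^esub> = \<zero>\<^bsub>N\<^esub>"
proof -
  interpret M: module Q M by fact
  interpret N: module Q N by fact
  show ?thesis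
    using linear_mapsD(3)[OF assms(3), of "\<zero>\<^bsub>Q\<^esub>" "\<zero>\<^bsub>M\<^esub>"] linear_mapsD(1)[OF assms(3), of "\<zero>\<^bsub>M\<^esub>"] by simp
qed

lemma linear_maps_minus:
  assumes "module Q M" "module Q N" "f \<in> linear_maps Q M N" "x \<in> carrier M" "y \<in> carrier M"
  shows "f (x \<ominus>\<^bsub>M\<^esub> y) = f x \<ominus>\<^bsub>N\<^esub> f y"
proof -
  interpret M: module Q M by fact
  interpret N: module Q N by fact
  note f = linear_mapsD[OF assms(3)]
  have "f (\<ominus>\<^bsub>M\<^esub> y) = \<ominus>\<^bsub>N\<^esub> f y"
    using f(3)[of "\<ominus>\<^bsub>Q\<^esub> \<one>\<^bsub>Q\<^esub>" y] f(1)[OF assms(5)] assms(5)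
    by (simp add: M.smult_minus_one N.smult_minus_one)
  then show ?thesis
    using f(2)[of x "\<ominus>\<^bsub>M\<^esub> y"] assms(4,5) by (simp add: M.M.minus_eq N.M.minus_eq)
qed

lemma mem_a_kernel: "x \<in> a_kernel M N f \<longleftrightarrow> x \<in> carrier M \<and> f x = \<zero>\<^bsub>N\<^esub>"
  by (simp add: a_kernel_def')

lemma (in module) minus_self: "x \<in> carrier M \<Longrightarrow> x \<ominus>\<^bsub>M\<^esub> x = \<zero>\<^bsub>M\<^esub>"
  by (simp add: M.minus_eq M.r_neg)

lemma (in module) minus_zero: "x \<in> carrier M \<Longrightarrow> x \<ominus>\<^bsub>M\<^esub> \<zero>\<^bsub>M\<^esub> = x"
  by (simp add: M.minus_eq)

lemma (in module) smult_minus: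
  "q \<in> carrier R \<Longrightarrow> x \<in> carrier M \<Longrightarrow> y \<in> carrier M \<Longrightarrow> q \<odot>\<^bsub>M\<^esub> (x \<ominus>\<^bsub>M\<^esub> y) = q \<odot>\<^bsub>M\<^esub> x \<ominus>\<^bsub>M\<^esub> q \<odot>\<^bsub>M\<^esub> y"
  by (simp add: M.minus_eq smult_r_distr smult_r_minus)

lemma submodule_kernel:
  assumes "module Q M" "module Q N" "f \<in> linear_maps Q M N"
  shows "submodule (a_kernel M N f) Q M"
proof -
  interpret M: module Q M by fact
  interpret N: module Q N by fact
  note f = linear_mapsD[OF assms(3)]
  have "f (\<ominus>\<^bsub>M\<^esub> x) = \<zero>\<^bsub>N\<^esub>" if "x \<in> carrier M" "f x = \<zero>\<^bsub>N\<^esub>" for x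
    using f(3)[of "\<ominus>\<^bsub>Q\<^esub> \<one>\<^bsub>Q\<^esub>" x] that by (simp add: M.smult_minus_one)
  then show ?thesis
    using linear_maps_zero[OF assms] f
    by (intro M.submoduleI) (auto simp: mem_a_kernel)
qed

text \<open>In a domain a nonzero \<open>x\<close> generates a free ideal, so sending
  \<open>q x\<close> to \<open>q b\<close> is well defined; its Baer element divides
  \<open>b\<close> by \<open>x\<close>.\<close>

lemma baer_module_divisible:
  assumes E: "baer_module Q E" and "domain Q" and x: "x \<in> carrier Q" "x \<noteq> \<zero>\<^bsub>Q\<^esub>" and b: "b \<in> carrier E"
  shows "\<exists>e\<in>carrier E. b = x \<odot>\<^bsub>E\<^esub> e"
proof -
  interpret Q: domain Q by fact
  interpret E: module Q E using E by (simp add: baer_module_def)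
  let ?G = "{(q \<otimes>\<^bsub>Q\<^esub> x, q \<odot>\<^bsub>E\<^esub> b) | q. q \<in> carrier Q}"
  have "module_graph Q (self_module Q) E ?G"
    unfolding module_graph_def
  proof (intro conjI allI impI ballI)
    show "?G \<subseteq> carrier (self_module Q) \<times> carrier E" using x b by auto
    show "(\<zero>\<^bsub>self_module Q\<^esub>, \<zero>\<^bsub>E\<^esub>) \<in> ?G" using x b by (auto intro!: exI[of _ "\<zero>\<^bsub>Q\<^esub>"])
  next
    fix p y p' y' assume "(p, y) \<in> ?G" "(p', y') \<in> ?G"
    then obtain q q' where "q \<in> carrier Q" "q' \<in> carrier Q" "p = q \<otimes>\<^bsub>Q\<^esub> x" "p' = q' \<otimes>\<^bsub>Q\<^esub> x"
      "y = q \<odot>\<^bsub>E\<^esub> b" "y' = q' \<odot>\<^bsub>E\<^esub> b" by blast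
    then show "(p \<oplus>\<^bsub>self_module Q\<^esub> p', y \<oplus>\<^bsub>E\<^esub> y') \<in> ?G"
      using x b by (auto simp: Q.l_distr E.smult_l_distr intro!: exI[of _ "q \<oplus>\<^bsub>Q\<^esub> q'"])
  next
    fix s p y assume "s \<in> carrier Q" "(p, y) \<in> ?G"
    then obtain q where "q \<in> carrier Q" "p = q \<otimes>\<^bsub>Q\<^esub> x" "y = q \<odot>\<^bsub>E\<^esub> b" by blast
    then show "(s \<odot>\<^bsub>self_module Q\<^esub> p, s \<odot>\<^bsub>E\<^esub> y) \<in> ?G"
      using x b \<open>s \<in> carrier Q\<close> by (auto simp: Q.m_assoc E.smult_assoc1 intro!: exI[of _ "s \<otimes>\<^bsub>Q\<^esub> q"])
  next
    fix y assume "(\<zero>\<^bsub>self_module Q\<^esub>, y) \<in> ?G"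
    then obtain q where "q \<in> carrier Q" "\<zero>\<^bsub>Q\<^esub> = q \<otimes>\<^bsub>Q\<^esub> x" "y = q \<odot>\<^bsub>E\<^esub> b" by auto
    then show "y = \<zero>\<^bsub>E\<^esub>"
      using x b Q.integral[of q x] by auto
  qed
  then obtain e where "e \<in> carrier E" "\<forall>(q, z)\<in>?G. z = q \<odot>\<^bsub>E\<^esub> e"
    using E unfolding baer_module_def by blast
  moreover have "(x, b) \<in> ?G"
    using x b by (auto intro!: exI[of _ "\<one>\<^bsub>Q\<^esub>"])
  ultimately show ?thesis by blast
qed

text \<open>Here \<open>x\<close> is a parameter and \<open>u\<close>, \<open>v\<close> represent independent socle elements of \<open>Q/xQ\<close>; the clause
  \<open>artinian\<close> says that every proper ideal containing \<open>x\<close> has a socle element.\<close>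

locale type_two_resolution = domain Q for Q :: "('r, 's) ring_scheme" (structure) +
  fixes x u v :: 'r and E :: "nat \<Rightarrow> ('r, 'e) module" and \<epsilon> :: "'r \<Rightarrow> 'e" and d :: "nat \<Rightarrow> 'e \<Rightarrow> 'e" and n :: nat
  assumes xuv: "x \<in> carrier Q - Units Q" "u \<in> carrier Q" "v \<in> carrier Q" and x0: "x \<noteq> \<zero>"
    and socle_u: "\<And>q. q \<in> carrier Q - Units Q \<Longrightarrow> \<exists>p\<in>carrier Q. q \<otimes> u = x \<otimes> p"
    and socle_v: "\<And>q. q \<in> carrier Q - Units Q \<Longrightarrow> \<exists>p\<in>carrier Q. q \<otimes> v = x \<otimes> p"
    and u_notin: "\<And>p. p \<in> carrier Q \<Longrightarrow> u \<noteq> x \<otimes> p"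
    and v_notin: "\<And>b p. b \<in> carrier Q \<Longrightarrow> p \<in> carrier Q \<Longrightarrow> u \<otimes> b \<noteq> v \<oplus> x \<otimes> p"
    and artinian: "\<And>I. I \<subseteq> carrier Q \<Longrightarrow> I \<noteq> carrier Q \<Longrightarrow> x \<in> I \<Longrightarrow> (\<And>p q. p \<in> carrier Q \<Longrightarrow> q \<in> I \<Longrightarrow> p \<otimes> q \<in> I) \<Longrightarrow>
       \<exists>c\<in>carrier Q - I. \<forall>q\<in>carrier Q - Units Q. q \<otimes> c \<in> I"
    and E: "\<And>i. baer_module Q (E i)"
    and E_top: "\<And>i. i > n \<Longrightarrow> carrier (E i) = {\<zero>\<^bsub>E i\<^esub>}"
    and \<epsilon>: "\<epsilon> \<in> linear_maps Q (self_module Q) (E 0)" "inj_on \<epsilon> (carrier Q)"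
    and d: "\<And>i. d i \<in> linear_maps Q (E i) (E (Suc i))"
    and exact0: "\<epsilon> ` carrier Q = a_kernel (E 0) (E 1) (d 0)"
    and exact: "\<And>i. d i ` carrier (E i) = a_kernel (E (Suc i)) (E (Suc (Suc i))) (d (Suc i))"
begin

abbreviation Z :: "nat \<Rightarrow> 'e set" where "Z i \<equiv> a_kernel (E i) (E (Suc i)) (d i)"

lemma modE: "module Q (E i)"
  using E[of i] by (simp add: baer_module_def)

lemma modZ: "module Q (E i\<lparr>carrier := Z i\<rparr>)"
  by (rule submodule.submodule_is_module[OF submodule_kernel[OF modE modE d] modE])

text \<open>The property \<open>lifts i\<close> says that homomorphisms into the \<open>i\<close>-th cosyzygy extend from
  \<open>(x, u)/xQ\<close>, which is isomorphic to the residue field, to \<open>Q/xQ\<close>. It is trivial above the length of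
  the resolution and descends to \<open>i = 1\<close>, because all cosyzygies but the zeroth are divisible.\<close>

definition lifts :: "nat \<Rightarrow> bool" where
  "lifts i \<longleftrightarrow> (\<forall>e\<in>Z i. (\<forall>q\<in>carrier Q - Units Q. q \<odot>\<^bsub>E i\<^esub> e = \<zero>\<^bsub>E i\<^esub>) \<longrightarrow>
     (\<exists>y\<in>Z i. x \<odot>\<^bsub>E i\<^esub> y = \<zero>\<^bsub>E i\<^esub> \<and> u \<odot>\<^bsub>E i\<^esub> y = e))"

text \<open>Each such cosyzygy is the image of an injective module, and divisibility passes to
  images.\<close>

lemma Z_divisible:
  assumes "z \<in> Z (Suc i)"
  shows "\<exists>z'\<in>Z (Suc i). z = x \<odot>\<^bsub>E (Suc i)\<^esub> z'"
proof -
  from assms obtain b where b: "b \<in> carrier (E i)" "z = d i b"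
    using exact[of i] by blast
  obtain e where e: "e \<in> carrier (E i)" "b = x \<odot>\<^bsub>E i\<^esub> e"
    using baer_module_divisible[OF E domain_axioms _ x0 b(1)] xuv by auto
  then have "z = x \<odot>\<^bsub>E (Suc i)\<^esub> d i e"
    using b xuv linear_mapsD(3)[OF d] by simp
  moreover have "d i e \<in> Z (Suc i)"
    using e exact[of i] by blast
  ultimately show ?thesis by blast
qed

text \<open>Inside \<open>E (Suc i)\<close> the map is multiplication by some \<open>e\<close>, but
  \<open>e\<close> may lie outside the cosyzygy. Its image under \<open>d\<close> is killed by all
  nonunits, so it equals \<open>u y\<close> with \<open>x y = 0\<close> by \<open>lift\<close>. A
  preimage \<open>h'\<close> of \<open>y\<close> with \<open>x h' = 0\<close> yields the correction
  \<open>e - u h'\<close>; the map is unchanged because \<open>q u\<close> lies in \<open>xQ\<close>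
  for every nonunit \<open>q\<close>.\<close>

lemma extend_from_maximal:
  assumes lift: "lifts (Suc (Suc i))"
    and G: "module_graph Q (self_module Q) (E (Suc i)\<lparr>carrier := Z (Suc i)\<rparr>) G"
    and dom: "Domain G = carrier Q - Units Q"
  shows "\<exists>z\<in>Z (Suc i). \<forall>(q, z')\<in>G. z' = q \<odot>\<^bsub>E (Suc i)\<^esub> z"
proof -
  let ?i = "Suc i"
  interpret E: module Q "E ?i" by (rule modE)
  interpret E': module Q "E (Suc ?i)" by (rule modE)
  note d' = linear_mapsD[OF d[of ?i]]
  note dm = linear_maps_minus[OF modE modE d[of ?i]]
  have GZ: "z \<in> Z ?i" if "(q, z) \<in> G" for q z
    using module_graphD(2)[OF G that] by simp
  have "module_graph Q (self_module Q) (E ?i) G"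
    using G unfolding module_graph_def by (auto simp: mem_a_kernel)
  then obtain e where e: "e \<in> carrier (E ?i)" "\<And>q z. (q, z) \<in> G \<Longrightarrow> z = q \<odot>\<^bsub>E ?i\<^esub> e"
    using E[of ?i] unfolding baer_module_def by blast
  have "d ?i e \<in> Z (Suc ?i)"
    using e(1) exact[of ?i] by blast
  moreover have "q \<odot>\<^bsub>E (Suc ?i)\<^esub> d ?i e = \<zero>\<^bsub>E (Suc ?i)\<^esub>" if "q \<in> carrier Q - Units Q" for q
  proof -
    from that dom obtain z where z: "(q, z) \<in> G" by blast
    have "q \<odot>\<^bsub>E (Suc ?i)\<^esub> d ?i e = d ?i (q \<odot>\<^bsub>E ?i\<^esub> e)"
      using that e(1) d'(3) by simp
    also have "q \<odot>\<^bsub>E ?i\<^esub> e = z" using e(2)[OF z] by simp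
    finally show ?thesis using GZ[OF z] by (simp add: mem_a_kernel)
  qed
  ultimately obtain y where y: "y \<in> Z (Suc ?i)" "x \<odot>\<^bsub>E (Suc ?i)\<^esub> y = \<zero>\<^bsub>E (Suc ?i)\<^esub>" "u \<odot>\<^bsub>E (Suc ?i)\<^esub> y = d ?i e"
    using lift unfolding lifts_def by blast
  from y(1) obtain h where h: "h \<in> carrier (E ?i)" "y = d ?i h"
    using exact[of ?i] by blast
  have "x \<odot>\<^bsub>E ?i\<^esub> h \<in> Z ?i"
    using h y(2) xuv d'(3)[of x h] by (simp add: mem_a_kernel)
  \<comment> \<open>Only \<open>d (x h) = 0\<close> is known. Divisibility of the cosyzygy allows
    \<open>h\<close> to be changed within its fibre so that \<open>x h\<close> itself
    vanishes.\<close>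
  then obtain z0 where z0: "z0 \<in> Z ?i" "x \<odot>\<^bsub>E ?i\<^esub> h = x \<odot>\<^bsub>E ?i\<^esub> z0"
    using Z_divisible by blast
  define h' where "h' = h \<ominus>\<^bsub>E ?i\<^esub> z0"
  have z0c: "z0 \<in> carrier (E ?i)" "d ?i z0 = \<zero>\<^bsub>E (Suc ?i)\<^esub>" using z0 by (simp_all add: mem_a_kernel)
  have h': "h' \<in> carrier (E ?i)" "x \<odot>\<^bsub>E ?i\<^esub> h' = \<zero>\<^bsub>E ?i\<^esub>" "d ?i h' = y"
    using h z0 z0c xuv d'(1)[OF h(1)] by (simp_all add: h'_def E.smult_minus E.minus_self dm E'.M.minus_eq)
  define z where "z = e \<ominus>\<^bsub>E ?i\<^esub> u \<odot>\<^bsub>E ?i\<^esub> h'"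
  have "z \<in> carrier (E ?i)" using e h' xuv by (simp add: z_def)
  moreover have "d ?i z = \<zero>\<^bsub>E (Suc ?i)\<^esub>"
    using e h' xuv y d'(1)[OF e(1)] by (simp add: z_def dm d'(3) E'.minus_self)
  moreover have "z' = q \<odot>\<^bsub>E ?i\<^esub> z" if qz: "(q, z') \<in> G" for q z'
  proof -
    have q: "q \<in> carrier Q - Units Q" using qz dom by blast
    from socle_u[OF q] obtain p where p: "p \<in> carrier Q" "q \<otimes> u = x \<otimes> p" by blast
    have "q \<odot>\<^bsub>E ?i\<^esub> (u \<odot>\<^bsub>E ?i\<^esub> h') = (q \<otimes> u) \<odot>\<^bsub>E ?i\<^esub> h'"
      using q xuv h' by (simp add: E.smult_assoc1)
    also have "\<dots> = (p \<otimes> x) \<odot>\<^bsub>E ?i\<^esub> h'" using p xuv by (simp add: m_comm)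
    also have "\<dots> = \<zero>\<^bsub>E ?i\<^esub>" using p xuv h' by (simp add: E.smult_assoc1)
    finally have "q \<odot>\<^bsub>E ?i\<^esub> z = q \<odot>\<^bsub>E ?i\<^esub> e"
      using q e h' xuv by (simp add: z_def E.smult_minus E.minus_zero)
    with e(2)[OF qz] show ?thesis by simp
  qed
  ultimately show ?thesis by (intro bexI[of _ z]) (auto simp: mem_a_kernel)
qed

lemma lifts_step:
  assumes lift: "lifts (Suc (Suc i))"
  shows "lifts (Suc i)"
  unfolding lifts_def
proof (intro ballI impI)
  let ?E = "E (Suc i)" and ?Z = "E (Suc i)\<lparr>carrier := Z (Suc i)\<rparr>"
  interpret E: module Q ?E by (rule modE)
  interpret Z: module Q ?Z by (rule modZ)
  fix e0 assume e0: "e0 \<in> Z (Suc i)" "\<forall>q\<in>carrier Q - Units Q. q \<odot>\<^bsub>?E\<^esub> e0 = \<zero>\<^bsub>?E\<^esub>"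
  have e0': "e0 \<in> carrier ?E" using e0 by (simp add: mem_a_kernel)
  have S: "module Q (self_module Q)" by (rule module_self_module[OF is_cring])
  \<comment> \<open>The map on the ideal \<open>(x, u)\<close> that kills \<open>x\<close> and sends
    \<open>u\<close> to \<open>e0\<close>. Once it is extended to \<open>Q\<close>, the image of one
    is the required \<open>y\<close>.\<close>
  let ?G0 = "{(\<alpha> \<otimes> x \<oplus> \<beta> \<otimes> u, \<beta> \<odot>\<^bsub>?E\<^esub> e0) | \<alpha> \<beta>. \<alpha> \<in> carrier Q \<and> \<beta> \<in> carrier Q}"
  have G0I: "(p, y) \<in> ?G0" if "p = \<alpha> \<otimes> x \<oplus> \<beta> \<otimes> u" "y = \<beta> \<odot>\<^bsub>?E\<^esub> e0" "\<alpha> \<in> carrier Q" "\<beta> \<in> carrier Q" for p y \<alpha> \<beta>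
    using that by blast
  have xc: "x \<in> carrier Q" using xuv by simp
  have G0: "module_graph Q (self_module Q) ?Z ?G0"
    unfolding module_graph_def
  proof (intro conjI allI impI ballI)
    show "?G0 \<subseteq> carrier (self_module Q) \<times> carrier ?Z"
      using xuv e0(1) Z.smult_closed[of _ e0] by auto
    show "(\<zero>\<^bsub>self_module Q\<^esub>, \<zero>\<^bsub>?Z\<^esub>) \<in> ?G0"
      using xuv e0' by (intro G0I[of _ \<zero> \<zero>]) auto
  next
    fix p y p' y' assume "(p, y) \<in> ?G0" "(p', y') \<in> ?G0"
    then obtain \<alpha> \<beta> \<alpha>' \<beta>' where *: "\<alpha> \<in> carrier Q" "\<beta> \<in> carrier Q" "\<alpha>' \<in> carrier Q" "\<beta>' \<in> carrier Q"
      "p = \<alpha> \<otimes> x \<oplus> \<beta> \<otimes> u" "p' = \<alpha>' \<otimes> x \<oplus> \<beta>' \<otimes> u" "y = \<beta> \<odot>\<^bsub>?E\<^esub> e0" "y' = \<beta>' \<odot>\<^bsub>?E\<^esub> e0" by blast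
    then show "(p \<oplus>\<^bsub>self_module Q\<^esub> p', y \<oplus>\<^bsub>?Z\<^esub> y') \<in> ?G0"
      using xc xuv e0' by (intro G0I[of _ "\<alpha> \<oplus> \<alpha>'" "\<beta> \<oplus> \<beta>'"]) (auto simp: l_distr E.smult_l_distr a_ac E.M.a_ac)
  next
    fix s p y assume s: "s \<in> carrier Q" "(p, y) \<in> ?G0"
    then obtain \<alpha> \<beta> where *: "\<alpha> \<in> carrier Q" "\<beta> \<in> carrier Q"
      "p = \<alpha> \<otimes> x \<oplus> \<beta> \<otimes> u" "y = \<beta> \<odot>\<^bsub>?E\<^esub> e0" by blast
    then show "(s \<odot>\<^bsub>self_module Q\<^esub> p, s \<odot>\<^bsub>?Z\<^esub> y) \<in> ?G0"
      using s xc xuv e0' by (intro G0I[of _ "s \<otimes> \<alpha>" "s \<otimes> \<beta>"]) (auto simp: r_distr m_assoc E.smult_assoc1)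
  next
    fix y assume "(\<zero>\<^bsub>self_module Q\<^esub>, y) \<in> ?G0"
    then obtain \<alpha> \<beta> where *: "\<alpha> \<in> carrier Q" "\<beta> \<in> carrier Q"
      "\<zero> = \<alpha> \<otimes> x \<oplus> \<beta> \<otimes> u" "y = \<beta> \<odot>\<^bsub>?E\<^esub> e0" by auto
    \<comment> \<open>A unit \<open>\<beta>\<close> would put \<open>u\<close> into
      \<open>xQ\<close>, while a nonunit kills \<open>e0\<close>; so the map is well
      defined.\<close>
    have "\<beta> \<notin> Units Q"
    proof
      assume \<beta>: "\<beta> \<in> Units Q"
      have "\<beta> \<otimes> u = \<ominus> (\<alpha> \<otimes> x)"
        using * xc xuv by (metis m_closed minus_equality a_comm)
      then have "inv \<beta> \<otimes> (\<beta> \<otimes> u) = inv \<beta> \<otimes> (\<ominus> (\<alpha> \<otimes> x))" by simp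
      then have "u = inv \<beta> \<otimes> (\<ominus> (\<alpha> \<otimes> x))"
        using \<beta> xuv by (simp add: m_assoc[symmetric] Units_l_inv Units_closed)
      also have "\<dots> = x \<otimes> (\<ominus> (inv \<beta> \<otimes> \<alpha>))"
        using \<beta> *(1) xc m_comm[of x "inv \<beta> \<otimes> \<alpha>"] by (simp add: r_minus m_assoc)
      finally show False using u_notin[of "\<ominus> (inv \<beta> \<otimes> \<alpha>)"] \<beta> * by simp
    qed
    then show "y = \<zero>\<^bsub>?Z\<^esub>"
      using * e0 by simp
  qed
  have "\<exists>g\<in>linear_maps Q (self_module Q) ?Z. \<forall>(p, y)\<in>?G0. g p = y"
  proof (rule module_graph_extend[OF S modZ G0])
    fix G assume G: "module_graph Q (self_module Q) ?Z G" "?G0 \<subseteq> G" "Domain G \<noteq> carrier (self_module Q)"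
    note D = module_graphD[OF G(1)]
    have "(x, \<zero>\<^bsub>?E\<^esub>) \<in> ?G0"
      using xc xuv e0' by (intro G0I[of _ \<one> \<zero>]) auto
    with G(2) have xG: "x \<in> Domain G" by blast
    have cl: "p \<otimes> q \<in> Domain G" if "p \<in> carrier Q" "q \<in> Domain G" for p q
      using that D(5)[of p q] by auto
    have sub: "Domain G \<subseteq> carrier Q" using D(1) by (auto elim: DomainE)
    from artinian[OF sub _ xG cl] G(3) obtain c where
      c: "c \<in> carrier Q - Domain G" "\<And>q. q \<in> carrier Q - Units Q \<Longrightarrow> q \<otimes> c \<in> Domain G"
      by auto
    \<comment> \<open>The multipliers of \<open>c\<close> into the domain are exactly the nonunits:
      all of them by the choice of \<open>c\<close>, and no unit since \<open>c\<close> lies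
      outside. Hence \<open>extend_from_maximal\<close> supplies the value at
      \<open>c\<close>.\<close>
    let ?J = "{(q, z). q \<in> carrier Q \<and> (q \<otimes> c, z) \<in> G}"
    have "Domain ?J = carrier Q - Units Q"
    proof (intro subset_antisym subsetI)
      fix q assume "q \<in> Domain ?J"
      then have q: "q \<in> carrier Q" "q \<otimes> c \<in> Domain G" by auto
      have "q \<notin> Units Q"
      proof
        assume "q \<in> Units Q"
        then have "inv q \<otimes> (q \<otimes> c) = c"
          using c by (simp add: m_assoc[symmetric] Units_l_inv Units_closed)
        with cl[OF _ q(2), of "inv q"] \<open>q \<in> Units Q\<close> c show False by simp
      qed
      with q show "q \<in> carrier Q - Units Q" by simp
    qed (use c in auto)
    moreover have "module_graph Q (self_module Q) ?Z ?J"
      unfolding module_graph_def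
    proof (intro conjI allI impI ballI)
      show "?J \<subseteq> carrier (self_module Q) \<times> carrier ?Z" using D(2) by auto
      show "(\<zero>\<^bsub>self_module Q\<^esub>, \<zero>\<^bsub>?Z\<^esub>) \<in> ?J" using D(3) c by simp
      show "(p \<oplus>\<^bsub>self_module Q\<^esub> p', y \<oplus>\<^bsub>?Z\<^esub> y') \<in> ?J" if "(p, y) \<in> ?J" "(p', y') \<in> ?J" for p y p' y'
        using that c D(4)[of "p \<otimes> c" y "p' \<otimes> c" y'] by (simp add: l_distr)
      show "(q \<odot>\<^bsub>self_module Q\<^esub> p, q \<odot>\<^bsub>?Z\<^esub> y) \<in> ?J" if "q \<in> carrier Q" "(p, y) \<in> ?J" for q p y
        using that c D(5)[of q "p \<otimes> c" y] by (simp add: m_assoc)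
      show "y = \<zero>\<^bsub>?Z\<^esub>" if "(\<zero>\<^bsub>self_module Q\<^esub>, y) \<in> ?J" for y
        using that c D(6)[of y] by simp
    qed
    ultimately obtain z where "z \<in> Z (Suc i)" "\<forall>(q, z')\<in>?J. z' = q \<odot>\<^bsub>?E\<^esub> z"
      using extend_from_maximal[OF lift, of ?J] by auto
    then show "\<exists>c\<in>carrier (self_module Q) - Domain G. \<exists>z\<in>carrier ?Z.
        \<forall>q\<in>carrier Q. \<forall>z'. (q \<odot>\<^bsub>self_module Q\<^esub> c, z') \<in> G \<longrightarrow> z' = q \<odot>\<^bsub>?Z\<^esub> z"
      using c by (intro bexI[of _ c] bexI[of _ z]) auto
  qed
  then obtain g where g: "g \<in> linear_maps Q (self_module Q) ?Z" "\<forall>(p, y)\<in>?G0. g p = y" ..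
  note g' = linear_mapsD[OF g(1), simplified]
  have "g x = \<zero>\<^bsub>?E\<^esub>" using bspec[OF g(2) G0I[of x \<one> \<zero> "\<zero>\<^bsub>?E\<^esub>"]] xc xuv e0' by simp
  moreover have "g u = e0" using bspec[OF g(2) G0I[of u \<zero> \<one> e0]] xc xuv e0' by simp
  moreover have "g x = x \<odot>\<^bsub>?E\<^esub> g \<one>" "g u = u \<odot>\<^bsub>?E\<^esub> g \<one>"
    using g'(3)[of x \<one>] g'(3)[of u \<one>] xc xuv by simp_all
  ultimately show "\<exists>y\<in>Z (Suc i). x \<odot>\<^bsub>?E\<^esub> y = \<zero>\<^bsub>?E\<^esub> \<and> u \<odot>\<^bsub>?E\<^esub> y = e0"
    using g'(1)[of \<one>] by (intro bexI[of _ "g \<one>"]) auto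
qed

lemma lifts_1: "lifts (Suc 0)"
proof -
  have top: "lifts (Suc (n + j))" for j
  proof -
    interpret E: module Q "E (Suc (n + j))" by (rule modE)
    have Z0: "e = \<zero>\<^bsub>E (Suc (n + j))\<^esub>" if "e \<in> Z (Suc (n + j))" for e
      using that E_top[of "Suc (n + j)"] by (simp add: mem_a_kernel)
    show ?thesis
      unfolding lifts_def
    proof (intro ballI impI)
      fix e assume e: "e \<in> Z (Suc (n + j))"
      then show "\<exists>y\<in>Z (Suc (n + j)). x \<odot>\<^bsub>E (Suc (n + j))\<^esub> y = \<zero>\<^bsub>E (Suc (n + j))\<^esub> \<and> u \<odot>\<^bsub>E (Suc (n + j))\<^esub> y = e"
        using Z0[OF e] xuv by (intro bexI[of _ e]) auto
    qed
  qed
  \<comment> \<open>Descending induction from \<open>n + 1\<close>, where all modules vanish, to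
    index 1.\<close>
  have "lifts (Suc (n - j))" if "j \<le> n" for j
    using that
  proof (induction j)
    case 0
    then show ?case using top[of 0] by simp
  next
    case (Suc j)
    then have "Suc (Suc (n - Suc j)) = Suc (n - j)" by simp
    with Suc show ?case using lifts_step[of "n - Suc j"] by simp
  qed
  from this[of n] show ?thesis by simp
qed

text \<open>In \<open>E 0\<close>, which contains \<open>Q\<close> through
  \<open>\<epsilon>\<close>, the element \<open>hv\<close> acts as the fraction \<open>v/x\<close>.
  All nonunits kill its image in \<open>Z 1\<close>, so \<open>lifts_1\<close> writes that image as
  \<open>u\<close> times an element killed by \<open>x\<close>. Pulling back to \<open>E 0\<close>
  and multiplying by \<open>x\<close> puts \<open>v\<close> into \<open>uQ + xQ\<close>, contrary to
  independence.\<close>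

lemma no_resolution: False
proof -
  interpret E0: module Q "E 0" by (rule modE)
  interpret E1: module Q "E 1" by (rule modE)
  have d0: "d 0 \<in> linear_maps Q (E 0) (E 1)" using d[of 0] by simp
  note d' = linear_mapsD[OF d0]
  note dm = linear_maps_minus[OF modE modE d0]
  note \<epsilon>' = linear_mapsD[OF \<epsilon>(1), simplified]
  have S: "module Q (self_module Q)" by (rule module_self_module[OF is_cring])
  have xc: "x \<in> carrier Q" using xuv by simp
  have \<epsilon>0: "\<epsilon> \<zero> = \<zero>\<^bsub>E 0\<^esub>" using linear_maps_zero[OF S modE \<epsilon>(1)] by simp
  have d\<epsilon>: "d 0 (\<epsilon> p) = \<zero>\<^bsub>E 1\<^esub>" if "p \<in> carrier Q" for p
    using that exact0 mem_a_kernel[of "\<epsilon> p" "E 0" "E 1" "d 0"] by blast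
  \<comment> \<open>Multiplication by \<open>v/x\<close> on the ideal of all \<open>q\<close> with
    \<open>q v\<close> in \<open>xQ\<close>. This ideal contains \<open>x\<close>, so that
    \<open>x hv\<close> is the image of \<open>v\<close>.\<close>
  let ?G = "{(q, \<epsilon> p) | q p. q \<in> carrier Q \<and> p \<in> carrier Q \<and> q \<otimes> v = x \<otimes> p}"
  have "module_graph Q (self_module Q) (E 0) ?G"
    unfolding module_graph_def
  proof (intro conjI allI impI ballI)
    show "?G \<subseteq> carrier (self_module Q) \<times> carrier (E 0)" using \<epsilon>'(1) by auto
    show "(\<zero>\<^bsub>self_module Q\<^esub>, \<zero>\<^bsub>E 0\<^esub>) \<in> ?G" using xc xuv \<epsilon>0 by (auto intro!: exI[of _ \<zero>])
  next
    fix q y q' y' assume "(q, y) \<in> ?G" "(q', y') \<in> ?G"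
    then obtain p p' where "q \<in> carrier Q" "p \<in> carrier Q" "q \<otimes> v = x \<otimes> p" "y = \<epsilon> p"
       "q' \<in> carrier Q" "p' \<in> carrier Q" "q' \<otimes> v = x \<otimes> p'" "y' = \<epsilon> p'" by blast
    then show "(q \<oplus>\<^bsub>self_module Q\<^esub> q', y \<oplus>\<^bsub>E 0\<^esub> y') \<in> ?G"
      using xc xuv \<epsilon>'(2)[of p p'] by (auto simp: l_distr r_distr intro!: exI[of _ "p \<oplus> p'"])
  next
    fix s q y assume "s \<in> carrier Q" "(q, y) \<in> ?G"
    then obtain p where "q \<in> carrier Q" "p \<in> carrier Q" "q \<otimes> v = x \<otimes> p" "y = \<epsilon> p" by blast
    then show "(s \<odot>\<^bsub>self_module Q\<^esub> q, s \<odot>\<^bsub>E 0\<^esub> y) \<in> ?G"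
      using \<open>s \<in> carrier Q\<close> xc xuv \<epsilon>'(3)[of s p] m_lcomm[of x s p] by (auto simp: m_assoc intro!: exI[of _ "s \<otimes> p"])
  next
    fix y assume "(\<zero>\<^bsub>self_module Q\<^esub>, y) \<in> ?G"
    then obtain p where p: "p \<in> carrier Q" "\<zero> \<otimes> v = x \<otimes> p" "y = \<epsilon> p" by auto
    then have "p = \<zero>" using xc x0 xuv integral[of x p] by auto
    with p \<epsilon>0 show "y = \<zero>\<^bsub>E 0\<^esub>" by simp
  qed
  then obtain hv where hv: "hv \<in> carrier (E 0)" "\<forall>(q, z)\<in>?G. z = q \<odot>\<^bsub>E 0\<^esub> hv"
    using E[of 0] unfolding baer_module_def by blast
  have hv': "q \<odot>\<^bsub>E 0\<^esub> hv = \<epsilon> p" if "q \<in> carrier Q" "p \<in> carrier Q" "q \<otimes> v = x \<otimes> p" for q p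
  proof -
    have "(q, \<epsilon> p) \<in> ?G" using that by blast
    from bspec[OF hv(2) this] show ?thesis by simp
  qed
  have "d 0 hv \<in> Z 1" using hv(1) exact[of 0] by auto
  moreover have "q \<odot>\<^bsub>E 1\<^esub> d 0 hv = \<zero>\<^bsub>E 1\<^esub>" if "q \<in> carrier Q - Units Q" for q
  proof -
    from socle_v[OF that] obtain p where p: "p \<in> carrier Q" "q \<otimes> v = x \<otimes> p" by blast
    have "q \<odot>\<^bsub>E 1\<^esub> d 0 hv = d 0 (q \<odot>\<^bsub>E 0\<^esub> hv)" using d'(3) that hv(1) by simp
    with hv'[OF _ p] that d\<epsilon>[OF p(1)] show ?thesis by simp
  qed
  ultimately obtain y where y: "y \<in> Z 1" "x \<odot>\<^bsub>E 1\<^esub> y = \<zero>\<^bsub>E 1\<^esub>" "u \<odot>\<^bsub>E 1\<^esub> y = d 0 hv"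
    using lifts_1 unfolding lifts_def One_nat_def by blast
  from y(1) obtain h where h: "h \<in> carrier (E 0)" "y = d 0 h"
    using exact[of 0] by auto
  have "x \<odot>\<^bsub>E 0\<^esub> h \<in> a_kernel (E 0) (E 1) (d 0)"
    using h y(2) xc d'(3)[of x h] by (simp add: mem_a_kernel)
  then obtain b where b: "b \<in> carrier Q" "x \<odot>\<^bsub>E 0\<^esub> h = \<epsilon> b"
    using exact0 by (metis imageE)
  have "u \<odot>\<^bsub>E 0\<^esub> h \<ominus>\<^bsub>E 0\<^esub> hv \<in> a_kernel (E 0) (E 1) (d 0)"
    using h hv(1) xuv y d'(1)[OF hv(1)] by (simp add: mem_a_kernel dm d'(3) E1.minus_self[unfolded One_nat_def])
  then obtain p where p: "p \<in> carrier Q" "u \<odot>\<^bsub>E 0\<^esub> h \<ominus>\<^bsub>E 0\<^esub> hv = \<epsilon> p"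
    using exact0 by (metis imageE)
  have uh: "u \<odot>\<^bsub>E 0\<^esub> h = \<epsilon> p \<oplus>\<^bsub>E 0\<^esub> hv"
    using p h(1) hv(1) xuv \<epsilon>'(1)[OF p(1)]
    by (metis E0.M.add.inv_solve_right E0.M.minus_eq E0.smult_closed)
  have "\<epsilon> (u \<otimes> b) = u \<odot>\<^bsub>E 0\<^esub> (x \<odot>\<^bsub>E 0\<^esub> h)"
    using b xuv \<epsilon>'(3) by simp
  also have "\<dots> = (u \<otimes> x) \<odot>\<^bsub>E 0\<^esub> h"
    using h(1) xc xuv by (simp add: E0.smult_assoc1)
  also have "\<dots> = (x \<otimes> u) \<odot>\<^bsub>E 0\<^esub> h"
    using xc xuv by (simp add: m_comm)
  also have "\<dots> = x \<odot>\<^bsub>E 0\<^esub> (\<epsilon> p \<oplus>\<^bsub>E 0\<^esub> hv)"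
    using h(1) xc xuv uh by (simp add: E0.smult_assoc1)
  also have "\<dots> = \<epsilon> (x \<otimes> p) \<oplus>\<^bsub>E 0\<^esub> \<epsilon> v"
    using xc xuv p(1) \<epsilon>' hv(1) hv'[of x v] by (simp add: E0.smult_r_distr)
  also have "\<dots> = \<epsilon> (x \<otimes> p \<oplus> v)"
    using xc xuv p(1) \<epsilon>'(2) by simp
  finally have "u \<otimes> b = x \<otimes> p \<oplus> v"
    using \<epsilon>(2) b(1) p(1) xc xuv by (auto dest: inj_onD)
  then show False
    using v_notin[OF b(1) p(1)] xc xuv p(1) a_comm[of "x \<otimes> p" v] by auto
qed

end


section \<open>Semigroup rings inside a power series ring\<close>

notation fls_nth (infixl \<open>$$\<close> 75)

text \<open>Only the embedding \<open>\<psi>\<close> of \<open>Q\<close> into \<open>F[[t]]\<close>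
  is used, which spares all computations with cosets of \<open>P\<close>. The conductor condition
  makes \<open>F((t))\<close> the field of fractions.\<close>

locale semigroup_ring = cring Q for Q :: "('r, 's) ring_scheme" (structure) +
  fixes \<psi> :: "'r \<Rightarrow> 'k::field fps" and S :: "int set"
  assumes hom_mult: "\<And>p q. p \<in> carrier Q \<Longrightarrow> q \<in> carrier Q \<Longrightarrow> \<psi> (p \<otimes> q) = \<psi> p * \<psi> q"
    and hom_add: "\<And>p q. p \<in> carrier Q \<Longrightarrow> q \<in> carrier Q \<Longrightarrow> \<psi> (p \<oplus> q) = \<psi> p + \<psi> q"
    and hom_one: "\<psi> \<one> = 1"
    and inj: "inj_on \<psi> (carrier Q)"
    and range: "\<psi> ` carrier Q = {f. \<forall>n. f $ n \<noteq> 0 \<longrightarrow> int n \<in> S}"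
    and S_zero: "0 \<in> S" and S_add: "\<And>m n. m \<in> S \<Longrightarrow> n \<in> S \<Longrightarrow> m + n \<in> S"
    and S_nonneg: "\<And>n. n \<in> S \<Longrightarrow> 0 \<le> n" and S_conductor: "\<exists>C. \<forall>n\<ge>C. n \<in> S"
begin

lemma supp: "q \<in> carrier Q \<Longrightarrow> \<psi> q $ n \<noteq> 0 \<Longrightarrow> int n \<in> S"
proof -
  assume q: "q \<in> carrier Q" "\<psi> q $ n \<noteq> 0"
  from q(1) have "\<psi> q \<in> \<psi> ` carrier Q" by (rule imageI)
  with q(2) show "int n \<in> S" unfolding range by simp
qed

lemma elemE:
  assumes "\<And>n. f $ n \<noteq> 0 \<Longrightarrow> int n \<in> S"
  obtains q where "q \<in> carrier Q" "\<psi> q = f"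
proof -
  have "f \<in> \<psi> ` carrier Q" using assms by (simp add: range)
  then obtain q where "q \<in> carrier Q" "f = \<psi> q" by (elim imageE)
  then show thesis using that[of q] by simp
qed

lemma eqI: "p \<in> carrier Q \<Longrightarrow> q \<in> carrier Q \<Longrightarrow> \<psi> p = \<psi> q \<Longrightarrow> p = q"
  using inj by (auto dest: inj_onD)

lemma hom_zero: "\<psi> \<zero> = 0"
proof -
  have "\<psi> \<zero> = \<psi> \<zero> + \<psi> \<zero>" using hom_add[of \<zero> \<zero>] by simp
  then show ?thesis by (simp only: add_cancel_right_right)
qed

lemma hom_uminus: "q \<in> carrier Q \<Longrightarrow> \<psi> (\<ominus> q) = - \<psi> q"
  using hom_add[of q "\<ominus> q"] by (simp add: r_neg hom_zero eq_neg_iff_add_eq_0 add.commute)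

lemma hom_minus: "p \<in> carrier Q \<Longrightarrow> q \<in> carrier Q \<Longrightarrow> \<psi> (p \<ominus> q) = \<psi> p - \<psi> q"
  by (simp add: minus_eq hom_add hom_uminus)

lemma hom_zero_iff: "q \<in> carrier Q \<Longrightarrow> \<psi> q = 0 \<longleftrightarrow> q = \<zero>"
  using eqI[of q \<zero>] by (auto simp: hom_zero)

lemma domain: "domain Q"
proof
  show "\<one> \<noteq> \<zero>" using hom_one hom_zero by force
  fix p q assume "p \<otimes> q = \<zero>" "p \<in> carrier Q" "q \<in> carrier Q"
  then show "p = \<zero> \<or> q = \<zero>"
    using hom_mult[of p q] hom_zero by (auto simp: hom_zero_iff)
qed

text \<open>The recursion for coefficient \<open>n\<close> of the inverse involves products of
  coefficients at \<open>i\<close> and \<open>n - i\<close>. If \<open>n\<close> is a gap, one of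
  these exponents is a gap as well.\<close>

lemma inverse_supp:
  fixes f :: "'k fps"
  assumes "\<And>n. f $ n \<noteq> 0 \<Longrightarrow> int n \<in> S" and "f $ 0 \<noteq> 0"
  shows "inverse f $ n \<noteq> 0 \<Longrightarrow> int n \<in> S"
proof (induction n rule: less_induct)
  case (less n)
  show ?case
  proof (rule ccontr)
    assume n: "int n \<notin> S"
    then have "n > 0" using S_zero by (cases n) auto
    have "f $ i * inverse f $ (n - i) = 0" if "i \<in> {1..n}" for i
    proof (rule ccontr)
      assume "f $ i * inverse f $ (n - i) \<noteq> 0"
      then have "f $ i \<noteq> 0 \<and> inverse f $ (n - i) \<noteq> 0" by (rule mult_not_zero)
      then have "int i \<in> S" "int (n - i) \<in> S"
        using assms(1)[of i] less.IH[of "n - i"] that by auto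
      from S_add[OF this] n that show False by simp
    qed
    then have "(\<Sum>i=1..n. f $ i * inverse f $ (n - i)) = 0"
      by (intro sum.neutral) blast
    moreover have "(f * inverse f) $ n = 0"
      using \<open>n > 0\<close> assms(2) by (simp add: inverse_mult_eq_1')
    ultimately have "f $ 0 * inverse f $ n = 0"
      by (simp add: fps_mult_nth sum.atLeast_Suc_atMost)
    with less.prems assms(2) show False by simp
  qed
qed

lemma Units_iff:
  assumes "q \<in> carrier Q"
  shows "q \<in> Units Q \<longleftrightarrow> \<psi> q $ 0 \<noteq> 0"
proof
  assume "q \<in> Units Q"
  then have "\<psi> q * \<psi> (inv q) = 1"
    using assms by (metis Units_inv_closed Units_r_inv hom_mult hom_one)
  then have "\<psi> q $ 0 * \<psi> (inv q) $ 0 = 1"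
    by (metis fps_mult_nth_0 fps_one_nth)
  then show "\<psi> q $ 0 \<noteq> 0" by auto
next
  assume 0: "\<psi> q $ 0 \<noteq> 0"
  obtain p where p: "p \<in> carrier Q" "\<psi> p = inverse (\<psi> q)"
    using elemE[of "inverse (\<psi> q)"] inverse_supp[of "\<psi> q"] supp[OF assms] 0 by metis
  have "p \<otimes> q = \<one>"
    using p assms 0 by (intro eqI) (auto simp: hom_mult hom_one inverse_mult_eq_1)
  then show "q \<in> Units Q"
    unfolding Units_def using p assms m_comm[of p q] by auto
qed

definition max_ideal :: "'r set" where
  "max_ideal = {q \<in> carrier Q. \<psi> q $ 0 = 0}"

lemma max_ideal_eq: "max_ideal = carrier Q - Units Q"
  unfolding max_ideal_def using Units_iff by auto

lemma ideal_max_ideal: "ideal max_ideal Q"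
proof (rule idealI)
  show "subgroup max_ideal (add_monoid Q)"
    by (rule subgroup.intro)
       (auto simp: max_ideal_def hom_add hom_zero a_inv_def[symmetric] hom_uminus)
qed (auto simp: max_ideal_def hom_mult ring_axioms)

lemma ideal_subset_max_ideal:
  assumes J: "ideal J Q" "J \<noteq> carrier Q"
  shows "J \<subseteq> max_ideal"
proof
  interpret J: ideal J Q by fact
  fix q assume q: "q \<in> J"
  have "q \<notin> Units Q"
  proof
    assume u: "q \<in> Units Q"
    then have "inv q \<otimes> q \<in> J" using q by (intro J.I_l_closed) auto
    with u have "\<one> \<in> J" by simp
    with J.one_imp_carrier J(2) show False by simp
  qed
  with q J.Icarr show "q \<in> max_ideal" by (simp add: max_ideal_eq)
qed

lemma local_ring: "local_ring Q"
  unfolding local_ring_def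
proof (intro conjI ex1I)
  have ne: "carrier Q \<noteq> max_ideal"
    using Units_one_closed by (auto simp: max_ideal_eq)
  show "maximalideal max_ideal Q"
    using ideal_subset_max_ideal by (intro maximalidealI ideal_max_ideal ne) blast
  fix J assume "maximalideal J Q"
  then interpret J: maximalideal J Q .
  have "J \<subseteq> max_ideal"
    using ideal_subset_max_ideal J.is_ideal J.I_notcarr by blast
  then show "J = max_ideal"
    using J.I_maximal[OF ideal_max_ideal] ne by (auto simp: max_ideal_def)
qed (rule is_cring)

text \<open>Division by \<open>p\<close> in \<open>F[[t]]\<close> leaves a quotient of order beyond
  the conductor, which therefore lies in the ring. So a nonzero ideal contains everything of high
  order; this finiteness is behind Noetherianity, the existence of socle elements and the
  injectivity of \<open>K/A\<close>.\<close>

lemma high_order_in_ideal: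
  assumes p: "p \<in> carrier Q" "p \<noteq> \<zero>"
  obtains N where "\<And>q. q \<in> carrier Q \<Longrightarrow> (\<And>n. n < N \<Longrightarrow> \<psi> q $ n = 0) \<Longrightarrow> \<exists>s\<in>carrier Q. q = s \<otimes> p"
proof -
  obtain C where C: "\<And>n. n \<ge> C \<Longrightarrow> n \<in> S" using S_conductor by blast
  have p0: "\<psi> p \<noteq> 0" using p hom_zero_iff by simp
  show thesis
  proof (rule that[of "subdegree (\<psi> p) + nat C"])
    fix q assume q: "q \<in> carrier Q" "\<And>n. n < subdegree (\<psi> p) + nat C \<Longrightarrow> \<psi> q $ n = 0"
    show "\<exists>s\<in>carrier Q. q = s \<otimes> p"
    proof (cases "\<psi> q = 0")
      case True
      then show ?thesis using q p by (intro bexI[of _ \<zero>]) (auto simp: hom_zero_iff)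
    next
      case False
      then have sd: "subdegree (\<psi> q) \<ge> subdegree (\<psi> p) + nat C"
        using q(2) by (intro subdegree_geI)
      then have "\<psi> p dvd \<psi> q" using False p0 by (simp add: fps_dvd_iff)
      then obtain g where g: "\<psi> q = \<psi> p * g" by blast
      with False have "g \<noteq> 0" by auto
      with g p0 sd have "subdegree g \<ge> nat C" by simp
      then have "int n \<in> S" if "g $ n \<noteq> 0" for n
        using that C[of "int n"] nth_less_subdegree_zero[of n g] by linarith
      then obtain s where s: "s \<in> carrier Q" "\<psi> s = g" using elemE by metis
      with g p q show ?thesis
        by (intro bexI[of _ s] eqI) (auto simp: hom_mult mult.commute)
    qed
  qed
qed

lemma noetherian: "noetherian_ring Q"
proof (rule noetherian_ringI)
  fix I assume "ideal I Q"
  then interpret I: ideal I Q .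
  show "\<exists>A\<subseteq>carrier Q. finite A \<and> I = Idl A"
  proof (cases "I = {\<zero>}")
    case True
    then show ?thesis by (intro exI[of _ "{\<zero>}"]) (simp add: genideal_zero)
  next
    case False
    then obtain p where p: "p \<in> I" "p \<noteq> \<zero>" using I.zero_closed by auto
    obtain N where N: "\<And>q. q \<in> carrier Q \<Longrightarrow> (\<And>n. n < N \<Longrightarrow> \<psi> q $ n = 0) \<Longrightarrow> \<exists>s\<in>carrier Q. q = s \<otimes> p"
      using high_order_in_ideal p I.Icarr by metis
    \<comment> \<open>Orders are treated downwards from \<open>N\<close>: above \<open>N\<close> the
      single element \<open>p\<close> suffices, and each lower order costs at most one more
      generator. At \<open>i = N\<close> the condition on \<open>q\<close> is empty.\<close>
    have "\<exists>A\<subseteq>I. finite A \<and> (\<forall>q\<in>I. (\<forall>n<N - i. \<psi> q $ n = 0) \<longrightarrow> q \<in> Idl A)" for i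
    proof (induction i)
      case 0
      show ?case
      proof (intro exI[of _ "{p}"] conjI ballI impI)
        fix q assume "q \<in> I" "\<forall>n<N - 0. \<psi> q $ n = 0"
        then obtain s where "s \<in> carrier Q" "q = s \<otimes> p" using N[of q] I.Icarr[of q] by auto
        then show "q \<in> Idl {p}"
          using p I.Icarr by (simp add: ideal.I_l_closed[OF genideal_ideal] genideal_self')
      qed (use p in auto)
    next
      case (Suc i)
      then obtain A where A: "A \<subseteq> I" "finite A" "\<And>q. q \<in> I \<Longrightarrow> (\<And>n. n < N - i \<Longrightarrow> \<psi> q $ n = 0) \<Longrightarrow> q \<in> Idl A"
        by blast
      have Ac: "A \<subseteq> carrier Q" using A(1) I.Icarr by blast
      show ?case
      proof (cases "i < N \<and> (\<exists>g\<in>I. (\<forall>n<N - Suc i. \<psi> g $ n = 0) \<and> \<psi> g $ (N - Suc i) \<noteq> 0)")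
        case False
        have *: "\<forall>n<N - i. \<psi> q $ n = 0" if "q \<in> I" "\<forall>n<N - Suc i. \<psi> q $ n = 0" for q
        proof (intro allI impI)
          fix n assume n: "n < N - i"
          with False that have "\<psi> q $ (N - Suc i) = 0" by auto
          moreover have "n < N - Suc i \<or> n = N - Suc i" using n by linarith
          ultimately show "\<psi> q $ n = 0" using that by auto
        qed
        show ?thesis
        proof (intro exI[of _ A] conjI ballI impI)
          fix q assume q: "q \<in> I" "\<forall>n<N - Suc i. \<psi> q $ n = 0"
          show "q \<in> Idl A" using A(3)[OF q(1)] *[OF q] by simp
        qed (use A in simp_all)
      next
        case True
        then obtain g where g: "i < N" "g \<in> I" "\<And>n. n < N - Suc i \<Longrightarrow> \<psi> g $ n = 0" "\<psi> g $ (N - Suc i) \<noteq> 0" by blast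
        have gc: "g \<in> carrier Q" using g I.Icarr by blast
        let ?A = "insert g A"
        have Ac': "?A \<subseteq> carrier Q" using gc Ac by simp
        interpret J: ideal "Idl ?A" Q by (rule genideal_ideal[OF Ac'])
        have AJ: "Idl A \<subseteq> Idl ?A"
          using Ac' by (intro genideal_minimal[OF J.is_ideal]) (use genideal_self[OF Ac'] in blast)
        have gJ: "g \<in> Idl ?A" using genideal_self[OF Ac'] by blast
        show ?thesis
        proof (intro exI[of _ ?A] conjI ballI impI)
          fix q assume q: "q \<in> I" "\<forall>n<N - Suc i. \<psi> q $ n = 0"
          have qc: "q \<in> carrier Q" using q I.Icarr by blast
          define c where "c = \<psi> q $ (N - Suc i) / \<psi> g $ (N - Suc i)"
          obtain s where s: "s \<in> carrier Q" "\<psi> s = fps_const c"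
            using elemE[of "fps_const c"] S_zero by (metis fps_nth_fps_const of_nat_0)
          have "q \<ominus> s \<otimes> g \<in> Idl A"
          proof (rule A(3))
            show "q \<ominus> s \<otimes> g \<in> I"
              using q g s by (simp add: minus_eq I.a_closed I.a_inv_closed I.I_l_closed)
            fix n assume "n < N - i"
            then have "n < N - Suc i \<or> n = N - Suc i" by linarith
            then show "\<psi> (q \<ominus> s \<otimes> g) $ n = 0"
              using q g s qc gc by (auto simp: hom_minus hom_mult c_def)
          qed
          then have "(q \<ominus> s \<otimes> g) \<oplus> s \<otimes> g \<in> Idl ?A"
            using AJ gJ s by (intro J.a_closed J.I_l_closed) auto
          also have "(q \<ominus> s \<otimes> g) \<oplus> s \<otimes> g = q"
            using qc s gc by (intro eqI) (auto simp: hom_add hom_minus)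
          finally show "q \<in> Idl ?A" .
        qed (use A g in auto)
      qed
    qed
    from this[of N] obtain A where A: "A \<subseteq> I" "finite A" "I \<subseteq> Idl A" by auto
    then show ?thesis
      using I.Icarr by (intro exI[of _ A] conjI subset_antisym genideal_minimal[OF I.is_ideal]) auto
  qed
qed

text \<open>Nonunits raise the order, so an element outside \<open>I\<close> of greatest order is a
  solution. The orders are bounded because \<open>I\<close> contains all multiples of
  \<open>x\<close>, hence all series of high order.\<close>

lemma socle_exists:
  assumes x: "x \<in> carrier Q" "x \<noteq> \<zero>" and I: "I \<subseteq> carrier Q" "I \<noteq> carrier Q" "x \<in> I"
    and cl: "\<And>p q. p \<in> carrier Q \<Longrightarrow> q \<in> I \<Longrightarrow> p \<otimes> q \<in> I"
  shows "\<exists>c\<in>carrier Q - I. \<forall>q\<in>carrier Q - Units Q. q \<otimes> c \<in> I"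
proof -
  obtain N where N: "\<And>q. q \<in> carrier Q \<Longrightarrow> (\<And>n. n < N \<Longrightarrow> \<psi> q $ n = 0) \<Longrightarrow> \<exists>s\<in>carrier Q. q = s \<otimes> x"
    using high_order_in_ideal x by metis
  have zero: "\<zero> \<in> I" using cl[of \<zero> x] x I by simp
  obtain c0 where c0: "c0 \<in> carrier Q - I" using I by blast
  have bound: "subdegree (\<psi> c) < N" if "c \<in> carrier Q - I" for c
  proof (rule ccontr)
    assume "\<not> subdegree (\<psi> c) < N"
    then have "\<psi> c $ n = 0" if "n < N" for n
      using that by (intro nth_less_subdegree_zero) simp
    with N[of c] that obtain s where "s \<in> carrier Q" "c = s \<otimes> x" by blast
    with cl[of s x] I(3) that show False by simp
  qed
  obtain c where c: "c \<in> carrier Q - I" "\<And>c'. c' \<in> carrier Q - I \<Longrightarrow> subdegree (\<psi> c') \<le> subdegree (\<psi> c)"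
    using ex_has_greatest_nat[of "\<lambda>c. c \<in> carrier Q - I" c0 "\<lambda>c. subdegree (\<psi> c)" N] c0 bound
    by (metis less_imp_le)
  have "q \<otimes> c \<in> I" if q: "q \<in> carrier Q - Units Q" for q
  proof (cases "q = \<zero>")
    case True
    then show ?thesis using zero c by simp
  next
    case False
    then have q0: "\<psi> q \<noteq> 0" "\<psi> q $ 0 = 0" using q hom_zero_iff Units_iff by auto
    then have "subdegree (\<psi> q) > 0" by (metis nth_subdegree_nonzero gr0I)
    moreover have "\<psi> c \<noteq> 0" using c zero hom_zero_iff by auto
    ultimately have "subdegree (\<psi> (q \<otimes> c)) > subdegree (\<psi> c)"
      using q q0 c by (simp add: hom_mult)
    with c(2)[of "q \<otimes> c"] c(1) q show ?thesis by fastforce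
  qed
  with c(1) show ?thesis by blast
qed

lemma monomialE:
  assumes "int n \<in> S"
  obtains q where "q \<in> carrier Q" "\<psi> q = fps_X ^ n"
  using elemE[of "fps_X ^ n"] assms by (metis fps_X_power_nth)

lemma socle_monomial:
  assumes xu: "x \<in> carrier Q" "u \<in> carrier Q" "\<psi> x = fps_X ^ a" "\<psi> u = fps_X ^ m"
    and soc: "\<And>h. h \<in> S \<Longrightarrow> h \<noteq> 0 \<Longrightarrow> int m + h - int a \<in> S"
    and q: "q \<in> carrier Q - Units Q"
  shows "\<exists>p\<in>carrier Q. q \<otimes> u = x \<otimes> p"
proof -
  define g where "g = fps_shift a (fps_X ^ m * \<psi> q)"
  have q': "q \<in> carrier Q" "\<psi> q $ 0 = 0" using q Units_iff by auto
  have S: "int n - int a \<in> S" if "(fps_X ^ m * \<psi> q) $ n \<noteq> 0" for n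
  proof -
    from that have n: "m \<le> n" "\<psi> q $ (n - m) \<noteq> 0"
      by (auto simp: fps_X_power_mult_nth split: if_splits)
    then have "int (n - m) \<in> S" "n - m \<noteq> 0"
      using supp[OF q'(1), of "n - m"] q'(2) by (simp, intro notI, simp)
    then have "int m + int (n - m) - int a \<in> S" by (intro soc) auto
    with n show ?thesis by simp
  qed
  have "int n \<in> S" if "g $ n \<noteq> 0" for n
    using S[of "n + a"] that by (simp add: g_def)
  then obtain p where p: "p \<in> carrier Q" "\<psi> p = g" using elemE by metis
  have "\<psi> q * fps_X ^ m = fps_X ^ a * g"
  proof (rule fps_ext)
    fix n
    have "(fps_X ^ m * \<psi> q) $ n = 0" if "n < a"
      using S[of n] S_nonneg[of "int n - int a"] that by auto
    then show "(\<psi> q * fps_X ^ m) $ n = (fps_X ^ a * g) $ n"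
      by (simp add: fps_X_power_mult_nth[of a] g_def mult.commute)
  qed
  then show ?thesis
    using p xu q' by (intro bexI[of _ p] eqI) (auto simp: hom_mult)
qed

end

theorem not_gorenstein_of_two_socle_monomials:
  fixes Q :: "('r, 's) ring_scheme" (structure) and \<psi> :: "'r \<Rightarrow> 'k::field fps"
  assumes "semigroup_ring Q \<psi> S" and a: "int a \<in> S" "a > 0"
    and u: "int m \<in> S" "int m - int a \<notin> S" "\<And>h. h \<in> S \<Longrightarrow> h \<noteq> 0 \<Longrightarrow> int m + h - int a \<in> S"
    and v: "int m' \<in> S" "int m' - int a \<notin> S" "\<And>h. h \<in> S \<Longrightarrow> h \<noteq> 0 \<Longrightarrow> int m' + h - int a \<in> S"
    and less: "m' < m"
  shows "\<not> gorenstein_local_ring Q"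
proof
  interpret semigroup_ring Q \<psi> S by fact
  assume "gorenstein_local_ring Q"
  then obtain E :: "nat \<Rightarrow> ('r, 'r list) module" and \<epsilon> d n where res:
    "\<forall>i. injective_module Q (E i)" "\<forall>i>n. carrier (E i) = {\<zero>\<^bsub>E i\<^esub>}"
    "\<epsilon> \<in> linear_maps Q (self_module Q) (E 0)"
    "\<forall>i. d i \<in> linear_maps Q (E i) (E (Suc i))" "inj_on \<epsilon> (carrier (self_module Q))"
    "\<epsilon> ` carrier (self_module Q) = a_kernel (E 0) (E 1) (d 0)"
    "\<forall>i. d i ` carrier (E i) = a_kernel (E (Suc i)) (E (Suc (Suc i))) (d (Suc i))"
    unfolding gorenstein_local_ring_def finite_injective_dimension_def by (elim conjE exE)
  obtain x where x: "x \<in> carrier Q" "\<psi> x = fps_X ^ a" using monomialE[OF a(1)] .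
  obtain y where y: "y \<in> carrier Q" "\<psi> y = fps_X ^ m" using monomialE[OF u(1)] .
  obtain z where z: "z \<in> carrier Q" "\<psi> z = fps_X ^ m'" using monomialE[OF v(1)] .
  have x0: "x \<noteq> \<zero>" using x hom_zero_iff[of x] by auto
  \<comment> \<open>Singleton lists place \<open>Q\<close> in the type of the resolution, so
    injective modules of that type satisfy Baer's criterion.\<close>
  have "inj_on (\<lambda>q :: 'r. [q]) (carrier Q)" by (auto intro: inj_onI)
  then have baer: "baer_module Q (E i)" for i
    using res(1) by (blast intro: injective_imp_baer)
  have "type_two_resolution Q x y z E \<epsilon> d n"
  proof (intro type_two_resolution.intro type_two_resolution_axioms.intro domain)
    show "x \<in> carrier Q - Units Q"
      using x a by (simp add: Units_iff)
    show "\<exists>p\<in>carrier Q. q \<otimes> y = x \<otimes> p" if "q \<in> carrier Q - Units Q" for q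
      using socle_monomial[OF x(1) y(1) x(2) y(2) u(3) that] .
    show "\<exists>p\<in>carrier Q. q \<otimes> z = x \<otimes> p" if "q \<in> carrier Q - Units Q" for q
      using socle_monomial[OF x(1) z(1) x(2) z(2) v(3) that] .
    show "y \<noteq> x \<otimes> p" if p: "p \<in> carrier Q" for p
    proof
      assume "y = x \<otimes> p"
      then have "fps_X ^ m = fps_X ^ a * \<psi> p" using hom_mult[OF x(1) p] x y by simp
      then have "(fps_X ^ a * \<psi> p) $ m = 1" by (metis fps_X_power_nth)
      then have "a \<le> m" "\<psi> p $ (m - a) \<noteq> 0"
        by (auto simp: fps_X_power_mult_nth split: if_splits)
      with supp[OF p, of "m - a"] u(2) show False by simp
    qed
    show "y \<otimes> b \<noteq> z \<oplus> x \<otimes> p" if b: "b \<in> carrier Q" and p: "p \<in> carrier Q" for b p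
    proof
      assume "y \<otimes> b = z \<oplus> x \<otimes> p"
      then have "\<psi> y * \<psi> b = \<psi> z + \<psi> x * \<psi> p"
        using b p x y z by (metis hom_add hom_mult m_closed)
      \<comment> \<open>As \<open>m' < m\<close>, the left side has no term at \<open>m'\<close>; so
        \<open>t^a \<psi> p\<close> must cancel \<open>t^m'\<close>, which is impossible since
        \<open>m' - a\<close> is a gap.\<close>
      then have "(fps_X ^ m * \<psi> b) $ m' = (fps_X ^ m' + fps_X ^ a * \<psi> p) $ m'"
        using x y z by simp
      then have "a \<le> m'" "\<psi> p $ (m' - a) \<noteq> 0"
        using less by (auto simp: fps_X_power_mult_nth split: if_splits)
      with supp[OF p, of "m' - a"] v(2) show False by simp
    qed
    show "\<exists>c\<in>carrier Q - I. \<forall>q\<in>carrier Q - Units Q. q \<otimes> c \<in> I"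
      if "I \<subseteq> carrier Q" "I \<noteq> carrier Q" "x \<in> I" "\<And>p q. p \<in> carrier Q \<Longrightarrow> q \<in> I \<Longrightarrow> p \<otimes> q \<in> I" for I
      by (rule socle_exists[OF x(1) x0 that])
  qed (use x y z x0 res baer in simp_all)
  then show False by (rule type_two_resolution.no_resolution)
qed


text \<open>The functional is given by its graph \<open>V\<close>, a subspace of \<open>F[[t]] \<times> F\<close>.\<close>

lemma functional_on_truncation:
  fixes V :: "('k::field fps \<times> 'k) set"
  assumes add: "\<And>f s g t. (f, s) \<in> V \<Longrightarrow> (g, t) \<in> V \<Longrightarrow> (f + g, s + t) \<in> V"
    and scale: "\<And>c f s. (f, s) \<in> V \<Longrightarrow> (fps_const c * f, c * s) \<in> V"
    and trunc: "\<And>f s. (f, s) \<in> V \<Longrightarrow> (\<And>n. n < N \<Longrightarrow> f $ n = 0) \<Longrightarrow> s = 0"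
  shows "\<exists>\<rho>. \<forall>(f, s)\<in>V. s = (\<Sum>i<N. \<rho> i * f $ i)"
  using assms
proof (induction N arbitrary: V)
  case 0
  then show ?case by auto
next
  case (Suc N)
  show ?case
  proof (cases "\<exists>f s. (f, s) \<in> V \<and> (\<forall>n<N. f $ n = 0) \<and> f $ N \<noteq> 0")
    case False
    have "\<exists>\<rho>. \<forall>(f, s)\<in>V. s = (\<Sum>i<N. \<rho> i * f $ i)"
    proof (rule Suc.IH)
      show "s = 0" if "(f, s) \<in> V" "\<And>n. n < N \<Longrightarrow> f $ n = 0" for f s
        using Suc.prems(3)[OF that(1)] False that by (metis less_Suc_eq)
    qed (use Suc.prems in blast)+
    then obtain \<rho> where \<rho>: "\<forall>(f, s)\<in>V. s = (\<Sum>i<N. \<rho> i * f $ i)" ..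
    show ?thesis
    proof (intro exI[of _ "\<rho>(N := 0)"] ballI, clarify)
      fix f s assume "(f, s) \<in> V"
      then have "s = (\<Sum>i<N. \<rho> i * f $ i)" using \<rho> by blast
      then show "s = (\<Sum>i<Suc N. (\<rho>(N := 0)) i * f $ i)" by simp
    qed
  next
    case True
    then obtain g t where g: "(g, t) \<in> V" "\<And>n. n < N \<Longrightarrow> g $ n = 0" "g $ N \<noteq> 0" by blast
    \<comment> \<open>The value of \<open>\<rho> N\<close> forced by \<open>g\<close>. After its
      contribution is subtracted, the functional no longer sees coefficient \<open>N\<close>,
      because a multiple of \<open>g\<close> can clear that coefficient.\<close>
    define c where "c = t / g $ N"
    define V' where "V' = {(f, s - c * f $ N) | f s. (f, s) \<in> V}"
    have "\<exists>\<rho>. \<forall>(f, s)\<in>V'. s = (\<Sum>i<N. \<rho> i * f $ i)"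
    proof (rule Suc.IH)
      show "(f + f', s + s') \<in> V'" if fs: "(f, s) \<in> V'" "(f', s') \<in> V'" for f s f' s'
      proof -
        from fs obtain u u' where u: "s = u - c * f $ N" "(f, u) \<in> V" "s' = u' - c * f' $ N" "(f', u') \<in> V"
          unfolding V'_def by blast
        have "s + s' = (u + u') - c * (f + f') $ N"
          unfolding u(1,3) by (simp add: algebra_simps)
        with Suc.prems(1)[OF u(2,4)] show ?thesis unfolding V'_def by blast
      qed
      show "(fps_const b * f, b * s) \<in> V'" if fs: "(f, s) \<in> V'" for b f s
      proof -
        from fs obtain u where u: "s = u - c * f $ N" "(f, u) \<in> V" unfolding V'_def by blast
        have "b * s = b * u - c * (fps_const b * f) $ N"
          unfolding u(1) by (simp add: algebra_simps)
        with Suc.prems(2)[OF u(2)] show ?thesis unfolding V'_def by blast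
      qed
      show "s = 0" if fs: "(f, s) \<in> V'" "\<And>n. n < N \<Longrightarrow> f $ n = 0" for f s
      proof -
        from fs obtain u where u: "s = u - c * f $ N" "(f, u) \<in> V" unfolding V'_def by blast
        define b where "b = - (f $ N / g $ N)"
        have "(f + fps_const b * g, u + b * t) \<in> V"
          using Suc.prems(1)[OF u(2) Suc.prems(2)[OF g(1)]] .
        moreover have "(f + fps_const b * g) $ n = 0" if "n < Suc N" for n
          using fs(2)[of n] g(2)[of n] g(3) that by (cases "n = N") (auto simp: b_def)
        ultimately have "u + b * t = 0" using Suc.prems(3) by blast
        then show "s = 0" using g(3) by (simp add: u b_def c_def)
      qed
    qed
    then obtain \<rho> where \<rho>: "\<forall>(f, s)\<in>V'. s = (\<Sum>i<N. \<rho> i * f $ i)" ..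
    show ?thesis
    proof (intro exI[of _ "\<rho>(N := c)"] ballI, clarify)
      fix f s assume "(f, s) \<in> V"
      then have "(f, s - c * f $ N) \<in> V'" unfolding V'_def by blast
      then have "s - c * f $ N = (\<Sum>i<N. \<rho> i * f $ i)" using \<rho> by blast
      then show "s = (\<Sum>i<Suc N. (\<rho>(N := c)) i * f $ i)" by (simp add: algebra_simps)
    qed
  qed
qed

section \<open>The fraction field and its quotient as modules\<close>

context semigroup_ring
begin

definition frac_module :: "('r, 'k fls) module" where
  "frac_module = \<lparr>carrier = UNIV, monoid.mult = (*), one = 1, zero = 0, add = (+),
     module.smult = (\<lambda>q f. fps_to_fls (\<psi> q) * f)\<rparr>"

lemma frac_module_simps [simp]:
  "carrier frac_module = UNIV" "\<zero>\<^bsub>frac_module\<^esub> = 0" "f \<oplus>\<^bsub>frac_module\<^esub> g = f + g"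
  "q \<odot>\<^bsub>frac_module\<^esub> f = fps_to_fls (\<psi> q) * f"
  by (simp_all add: frac_module_def)

lemma module_frac_module: "module Q frac_module"
proof (rule moduleI[OF is_cring abelian_groupI])
  fix f :: "'k fls"
  show "\<exists>g\<in>carrier frac_module. g \<oplus>\<^bsub>frac_module\<^esub> f = \<zero>\<^bsub>frac_module\<^esub>"
    by (intro bexI[of _ "- f"]) simp_all
qed (auto simp: hom_add hom_mult hom_one fls_times_fps_to_fls algebra_simps)

text \<open>Two pairs \<open>(p, y)\<close> and \<open>(q, z)\<close> of the graph satisfy
  \<open>p z = q y\<close>, since both are the value at \<open>p q\<close>. Hence the quotient
  \<open>y / p\<close> is the same for all pairs with nonzero \<open>p\<close>.\<close>

lemma baer_frac_module: "baer_module Q frac_module"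
  unfolding baer_module_def
proof (intro conjI allI impI module_frac_module)
  fix G assume G: "module_graph Q (self_module Q) frac_module G"
  note D = module_graphD[OF G, simplified]
  show "\<exists>e\<in>carrier frac_module. \<forall>(q, z)\<in>G. z = q \<odot>\<^bsub>frac_module\<^esub> e"
  proof (cases "\<exists>p y. (p, y) \<in> G \<and> p \<noteq> \<zero>")
    case False
    then have "z = 0" if "(q, z) \<in> G" for q z
      using that D(6)[of z] by metis
    then show ?thesis by (intro bexI[of _ 0]) auto
  next
    case True
    then obtain p y where p: "(p, y) \<in> G" "p \<noteq> \<zero>" by blast
    have pc: "p \<in> carrier Q" using D(1)[OF p(1)] .
    have p0: "fps_to_fls (\<psi> p) \<noteq> 0" using p pc by (simp add: hom_zero_iff)
    have "z = fps_to_fls (\<psi> q) * (y / fps_to_fls (\<psi> p))" if qz: "(q, z) \<in> G" for q z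
    proof -
      have qc: "q \<in> carrier Q" using D(1)[OF qz] .
      have "(p \<otimes> q, fps_to_fls (\<psi> p) * z) \<in> G" "(q \<otimes> p, fps_to_fls (\<psi> q) * y) \<in> G"
        using D(5)[OF pc qz] D(5)[OF qc p(1)] by auto
      then have "fps_to_fls (\<psi> p) * z = fps_to_fls (\<psi> q) * y"
        using module_graph_unique[OF module_self_module[OF is_cring] module_frac_module G] m_comm[OF pc qc] by metis
      then show ?thesis using p0 by (simp add: field_simps)
    qed
    then show ?thesis by (intro bexI[of _ "y / fps_to_fls (\<psi> p)"]) auto
  qed
qed

text \<open>The quotient \<open>K/A\<close> is represented by the Laurent series without terms of exponent in \<open>S\<close>.\<close>

definition gap_part :: "'k fls \<Rightarrow> 'k fls" where
  "gap_part f = f - fps_to_fls (Abs_fps (\<lambda>n. if int n \<in> S then f $$ int n else 0))"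

lemma gap_part_nth: "gap_part f $$ n = (if n \<in> S then 0 else f $$ n)"
  using S_nonneg[of n] by (auto simp: gap_part_def)

lemma gap_part_add: "gap_part (f + g) = gap_part f + gap_part g"
  by (intro fls_eqI) (simp add: gap_part_nth)

lemma gap_part_zero_iff: "gap_part f = 0 \<longleftrightarrow> (\<exists>q\<in>carrier Q. f = fps_to_fls (\<psi> q))"
proof
  assume 0: "gap_part f = 0"
  define g where "g = Abs_fps (\<lambda>n. if int n \<in> S then f $$ int n else 0)"
  have "f = fps_to_fls g" using 0 by (simp add: gap_part_def g_def)
  moreover have "int n \<in> S" if "g $ n \<noteq> 0" for n
    using that by (auto simp: g_def split: if_splits)
  then obtain q where "q \<in> carrier Q" "\<psi> q = g" using elemE by metis
  ultimately show "\<exists>q\<in>carrier Q. f = fps_to_fls (\<psi> q)" by blast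
next
  assume "\<exists>q\<in>carrier Q. f = fps_to_fls (\<psi> q)"
  then show "gap_part f = 0"
    using supp S_nonneg by (intro fls_eqI) (force simp: gap_part_nth)
qed

text \<open>The discarded part of \<open>f\<close> lies in \<open>A\<close>, and so do its multiples
  by ring elements. This makes the scalar multiplication on \<open>K/A\<close> well defined.\<close>

lemma gap_part_mult_gap_part:
  assumes "q \<in> carrier Q"
  shows "gap_part (fps_to_fls (\<psi> q) * gap_part f) = gap_part (fps_to_fls (\<psi> q) * f)"
proof -
  have "gap_part (f - gap_part f) = 0" by (intro fls_eqI) (simp add: gap_part_nth)
  then obtain p where p: "p \<in> carrier Q" "f - gap_part f = fps_to_fls (\<psi> p)"
    unfolding gap_part_zero_iff by blast
  have "gap_part (fps_to_fls (\<psi> q) * (f - gap_part f)) = 0"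
    unfolding gap_part_zero_iff p using p assms
    by (intro bexI[of _ "q \<otimes> p"]) (auto simp: hom_mult fls_times_fps_to_fls)
  moreover have "fps_to_fls (\<psi> q) * f = fps_to_fls (\<psi> q) * (f - gap_part f) + fps_to_fls (\<psi> q) * gap_part f"
    by (simp add: algebra_simps)
  ultimately show ?thesis by (simp only: gap_part_add) simp
qed

definition cofrac_module :: "('r, 'k fls) module" where
  "cofrac_module = \<lparr>carrier = range gap_part, monoid.mult = (*), one = 1, zero = 0, add = (+),
     module.smult = (\<lambda>q f. gap_part (fps_to_fls (\<psi> q) * f))\<rparr>"

lemma cofrac_module_simps [simp]:
  "carrier cofrac_module = range gap_part" "\<zero>\<^bsub>cofrac_module\<^esub> = 0" "f \<oplus>\<^bsub>cofrac_module\<^esub> g = f + g"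
  "q \<odot>\<^bsub>cofrac_module\<^esub> f = gap_part (fps_to_fls (\<psi> q) * f)"
  by (simp_all add: cofrac_module_def)

lemma gap_part_gap_part [simp]: "gap_part (gap_part f) = gap_part f"
  by (intro fls_eqI) (simp add: gap_part_nth)

lemma gap_part_0 [simp]: "gap_part 0 = 0"
  by (intro fls_eqI) (simp add: gap_part_nth)

lemma mem_range_gap_part: "f \<in> range gap_part \<longleftrightarrow> gap_part f = f"
  by (metis gap_part_gap_part rangeE rangeI)

lemma module_cofrac_module: "module Q cofrac_module"
proof (rule moduleI[OF is_cring abelian_groupI])
  fix f assume "f \<in> carrier cofrac_module"
  then have "gap_part f = f" by (simp add: mem_range_gap_part)
  then have "gap_part (- f) = - f"
    by (metis ab_left_minus add_eq_0_iff gap_part_0 gap_part_add)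
  then show "\<exists>g\<in>carrier cofrac_module. g \<oplus>\<^bsub>cofrac_module\<^esub> f = \<zero>\<^bsub>cofrac_module\<^esub>"
    by (intro bexI[of _ "- f"]) (simp_all add: mem_range_gap_part)
next
  fix p q f assume *: "p \<in> carrier Q" "q \<in> carrier Q" "f \<in> carrier cofrac_module"
  show "(p \<otimes> q) \<odot>\<^bsub>cofrac_module\<^esub> f = p \<odot>\<^bsub>cofrac_module\<^esub> (q \<odot>\<^bsub>cofrac_module\<^esub> f)"
    using * by (simp add: gap_part_mult_gap_part hom_mult fls_times_fps_to_fls mult.assoc)
qed (auto simp: mem_range_gap_part hom_add hom_one gap_part_add distrib_left distrib_right)

end

locale symmetric_semigroup_ring = semigroup_ring Q \<psi> S
  for Q :: "('r, 's) ring_scheme" (structure) and \<psi> :: "'r \<Rightarrow> 'k::field fps" and S :: "int set" +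
  fixes c :: int
  assumes sym: "n \<in> S \<longleftrightarrow> c - n \<notin> S"
begin

lemma c_notin: "c \<notin> S"
  using sym[of c] S_zero by simp

text \<open>By symmetry the gaps are exactly the numbers \<open>c - h\<close> with \<open>h\<close>
  in \<open>S\<close>. So a class modulo \<open>A\<close> is determined by the coefficients at
  \<open>c\<close> of its multiples by \<open>t^h\<close>: the residue pairing is
  nondegenerate.\<close>

lemma gap_part_eq_iff: "gap_part f = gap_part g \<longleftrightarrow> (\<forall>h\<in>S. f $$ (c - h) = g $$ (c - h))"
proof
  assume "gap_part f = gap_part g"
  then have "gap_part f $$ (c - h) = gap_part g $$ (c - h)" for h by simp
  then show "\<forall>h\<in>S. f $$ (c - h) = g $$ (c - h)"
    using sym unfolding gap_part_nth by metis
next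
  assume *: "\<forall>h\<in>S. f $$ (c - h) = g $$ (c - h)"
  have "f $$ n = g $$ n" if "n \<notin> S" for n
    using bspec[OF *, of "c - n"] sym[of n] that by simp
  then show "gap_part f = gap_part g"
    by (intro fls_eqI) (simp add: gap_part_nth)
qed

lemma baer_cofrac_module: "baer_module Q cofrac_module"
  unfolding baer_module_def
proof (intro conjI allI impI module_cofrac_module)
  fix G assume G: "module_graph Q (self_module Q) cofrac_module G"
  note D = module_graphD[OF G, simplified]
  show "\<exists>e\<in>carrier cofrac_module. \<forall>(q, z)\<in>G. z = q \<odot>\<^bsub>cofrac_module\<^esub> e"
  proof (cases "\<exists>p y. (p, y) \<in> G \<and> p \<noteq> \<zero>")
    case False
    then have "z = 0" if "(q, z) \<in> G" for q z
      using that D(6)[of z] by metis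
    then show ?thesis by (intro bexI[of _ 0]) (auto simp: mem_range_gap_part)
  next
    case True
    then obtain p y where p: "(p, y) \<in> G" "p \<noteq> \<zero>" by blast
    have pc: "p \<in> carrier Q" using D(1)[OF p(1)] .
    obtain C where C: "\<And>n. n \<ge> C \<Longrightarrow> n \<in> S" using S_conductor by blast
    obtain B where B: "\<And>q. q \<in> carrier Q \<Longrightarrow> (\<And>n. n < B \<Longrightarrow> \<psi> q $ n = 0) \<Longrightarrow> \<exists>s\<in>carrier Q. q = s \<otimes> p"
      using high_order_in_ideal[OF pc p(2)] by metis
    \<comment> \<open>If \<open>q\<close> has order at least \<open>N\<close>, then
      \<open>q = s p\<close> where the orders of \<open>s\<close> and \<open>y\<close> add up to at
      least the conductor. Then \<open>s y\<close> lies in \<open>A\<close> and the value at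
      \<open>q\<close> is zero.\<close>
    define N where "N = B + subdegree (\<psi> p) + nat (C - fls_subdegree y)"
    have p0: "\<psi> p \<noteq> 0" using p pc hom_zero_iff by simp
    have trunc: "z = 0" if qz: "(q, z) \<in> G" "\<And>n. n < N \<Longrightarrow> \<psi> q $ n = 0" for q z
    proof (cases "\<psi> q = 0")
      case True
      then have "q = \<zero>" using D(1)[OF qz(1)] hom_zero_iff by simp
      with qz D(6) show ?thesis by simp
    next
      case False
      have qc: "q \<in> carrier Q" using D(1)[OF qz(1)] .
      obtain s where s: "s \<in> carrier Q" "q = s \<otimes> p"
        using B[OF qc] qz(2) by (auto simp: N_def)
      have "subdegree (\<psi> q) \<ge> N" using False qz(2) by (intro subdegree_geI) auto
      moreover have ps: "\<psi> q = \<psi> s * \<psi> p" using s pc by (simp add: hom_mult)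
      ultimately have "subdegree (\<psi> s) \<ge> nat (C - fls_subdegree y)" and s0: "\<psi> s \<noteq> 0"
        using p0 False by (auto simp: N_def)
      then have ord: "fls_subdegree (fps_to_fls (\<psi> s)) + fls_subdegree y \<ge> C"
        by (simp add: fls_subdegree_fls_to_fps)
      have "(q, gap_part (fps_to_fls (\<psi> s) * y)) \<in> G"
        using D(5)[OF s(1) p(1)] s(2) by simp
      then have "z = gap_part (fps_to_fls (\<psi> s) * y)"
        using module_graph_unique[OF module_self_module[OF is_cring] module_cofrac_module G] qz(1) by metis
      also have "\<dots> = 0"
      proof (intro fls_eqI)
        fix n
        have "(fps_to_fls (\<psi> s) * y) $$ n = 0" if "n \<notin> S"
          using that C[of n] ord by (intro fls_times_nth_eq0) linarith
        then show "gap_part (fps_to_fls (\<psi> s) * y) $$ n = 0 $$ n" by (simp add: gap_part_nth)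
      qed
      finally show ?thesis .
    qed
    define V where "V = {(\<psi> q, z $$ c) | q z. (q, z) \<in> G}"
    have "\<exists>\<rho>. \<forall>(f, s)\<in>V. s = (\<Sum>i<N. \<rho> i * f $ i)"
    proof (rule functional_on_truncation)
      show "(f + g, s + t) \<in> V" if "(f, s) \<in> V" "(g, t) \<in> V" for f s g t
      proof -
        from that obtain q z q' z' where "(q, z) \<in> G" "f = \<psi> q" "s = z $$ c" "(q', z') \<in> G" "g = \<psi> q'" "t = z' $$ c"
          unfolding V_def by blast
        then show ?thesis unfolding V_def
          using D(4)[of q z q' z'] D(1)[of q z] D(1)[of q' z']
          by (intro CollectI exI[of _ "q \<oplus> q'"] exI[of _ "z + z'"]) (simp add: hom_add)
      qed
      show "(fps_const b * f, b * s) \<in> V" if "(f, s) \<in> V" for b f s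
      proof -
        from that obtain q z where q: "(q, z) \<in> G" "f = \<psi> q" "s = z $$ c"
          unfolding V_def by blast
        obtain t where t: "t \<in> carrier Q" "\<psi> t = fps_const b"
          using elemE[of "fps_const b"] S_zero by (metis fps_nth_fps_const of_nat_0)
        have "gap_part (fls_const b * z) $$ c = b * s"
          using c_notin q(3) by (simp add: gap_part_nth)
        with q t D(5)[OF t(1) q(1)] D(1)[OF q(1)] show ?thesis unfolding V_def
          by (intro CollectI exI[of _ "t \<otimes> q"] exI[of _ "gap_part (fls_const b * z)"]) (simp add: hom_mult)
      qed
      show "s = 0" if "(f, s) \<in> V" "\<And>n. n < N \<Longrightarrow> f $ n = 0" for f s
      proof -
        from that(1) obtain q z where q: "(q, z) \<in> G" "f = \<psi> q" "s = z $$ c"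
          unfolding V_def by blast
        with trunc[OF q(1)] that(2) show ?thesis by simp
      qed
    qed
    then obtain \<rho> where \<rho>: "\<forall>(f, s)\<in>V. s = (\<Sum>i<N. \<rho> i * f $ i)" ..
    \<comment> \<open>Since \<open>t^i\<close> and \<open>t^(c - i)\<close> multiply to
      \<open>t^c\<close>, the coefficient at \<open>c\<close> of \<open>f e\<close> is the
      functional with weights \<open>\<rho>\<close>.\<close>
    define e :: "'k fls" where "e = (\<Sum>i<N. fls_const (\<rho> i) * fls_X_intpow (c - int i))"
    have e_nth: "(fps_to_fls f * e) $$ c = (\<Sum>i<N. \<rho> i * f $ i)" for f
    proof -
      have "(fps_to_fls f * (fls_const b * fls_X_intpow (c - int i))) $$ c = b * f $ i" for b i
      proof -
        have "fps_to_fls f * fls_X_intpow (c - int i) = fls_shift (int i - c) (fps_to_fls f)"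
          by (simp add: fls_shifted_times_simps)
        then show ?thesis
          unfolding mult.left_commute[of "fps_to_fls f"] by simp
      qed
      then show ?thesis
        unfolding e_def by (simp only: sum_distrib_left fls_nth_sum)
    qed
    have "z = gap_part (fps_to_fls (\<psi> q) * gap_part e)" if qz: "(q, z) \<in> G" for q z
    proof -
      have qc: "q \<in> carrier Q" using D(1)[OF qz] .
      have zk: "gap_part z = z" using D(2)[OF qz] by (simp add: mem_range_gap_part)
      \<comment> \<open>The functional records only the coefficient at \<open>c\<close>, but the
        domain of the graph is an ideal. Applying it to \<open>t^h q\<close> gives the coefficient
        at \<open>c - h\<close>, and these determine the class.\<close>
      have "gap_part z = gap_part (fps_to_fls (\<psi> q) * e)"
        unfolding gap_part_eq_iff
      proof
        fix h assume h: "h \<in> S"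
        then have h0: "h \<ge> 0" by (rule S_nonneg)
        obtain t where t: "t \<in> carrier Q" "\<psi> t = fps_X ^ nat h"
          using monomialE[of "nat h"] h h0 by auto
        have sh: "fps_to_fls (fps_X ^ nat h) * f = fls_shift (- h) f" for f :: "'k fls"
          using h0 by (simp add: fps_to_fls_power fls_X_power_times_conv_shift)
        have "(t \<otimes> q, gap_part (fps_to_fls (\<psi> t) * z)) \<in> G"
          using D(5)[OF t(1) qz] by simp
        then have "(\<psi> (t \<otimes> q), gap_part (fps_to_fls (\<psi> t) * z) $$ c) \<in> V"
          unfolding V_def by blast
        then have "gap_part (fps_to_fls (\<psi> t) * z) $$ c = (\<Sum>i<N. \<rho> i * \<psi> (t \<otimes> q) $ i)"
          using \<rho> by blast
        also have "\<dots> = (fps_to_fls (\<psi> (t \<otimes> q)) * e) $$ c"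
          by (simp only: e_nth)
        also have "fps_to_fls (\<psi> (t \<otimes> q)) * e = fps_to_fls (\<psi> t) * (fps_to_fls (\<psi> q) * e)"
          using t qc by (simp add: hom_mult fls_times_fps_to_fls mult.assoc)
        finally show "z $$ (c - h) = (fps_to_fls (\<psi> q) * e) $$ (c - h)"
          using c_notin by (simp add: gap_part_nth t(2) sh)
      qed
      with zk gap_part_mult_gap_part[OF qc] show ?thesis by simp
    qed
    then show ?thesis by (intro bexI[of _ "gap_part e"]) auto
  qed
qed

lemma gorenstein:
  fixes j :: "'k fls \<Rightarrow> 'r list"
  assumes j: "inj j"
  shows "gorenstein_local_ring Q"
  unfolding gorenstein_local_ring_def finite_injective_dimension_def
proof (intro conjI noetherian local_ring)
  have jon: "inj_on j A" for A using j by (rule inj_on_subset) simp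
  define Z :: "('r, 'k fls) module" where "Z = frac_module\<lparr>carrier := {0}\<rparr>"
  have Z [simp]: "carrier Z = {0}" "\<zero>\<^bsub>Z\<^esub> = 0" "f \<oplus>\<^bsub>Z\<^esub> g = f + g" "q \<odot>\<^bsub>Z\<^esub> f = fps_to_fls (\<psi> q) * f" for f g q
    by (simp_all add: Z_def)
  have modZ: "module Q Z"
    by (rule moduleI[OF is_cring abelian_groupI]) auto
  have baerZ: "baer_module Q Z"
    unfolding baer_module_def using modZ by (auto dest: module_graphD(2))
  \<comment> \<open>The resolution ends after \<open>K/A\<close>; from index 2 on it is filled with
    the zero module.\<close>
  define E :: "nat \<Rightarrow> ('r, 'k fls) module" where
    "E i = (if i = 0 then frac_module else if i = 1 then cofrac_module else Z)" for i
  have baerE: "baer_module Q (E i)" for i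
    using baer_frac_module baer_cofrac_module baerZ by (simp add: E_def)
  have modE: "module Q (E i)" for i using baerE by (simp add: baer_module_def)
  define E' where "E' i = module_image j (E i)" for i
  note I = module_image_simps[OF modE jon]
  define \<epsilon> where "\<epsilon> q = j (fps_to_fls (\<psi> q))" for q
  define d where "d i u = (if i = 0 then j (gap_part (inv_into UNIV j u)) else j 0)" for i :: nat and u
  have jj [simp]: "inv_into UNIV j (j f) = f" for f using j by simp
  have dj: "d i (j f) = j (if i = 0 then gap_part f else 0)" for i f by (simp add: d_def)
  have jeq [simp]: "j f = j g \<longleftrightarrow> f = g" for f g using j by (auto dest: injD)
  have zE: "\<zero>\<^bsub>E i\<^esub> = 0" for i by (simp add: E_def)
  have ker: "a_kernel (E' i) (E' (Suc i)) (d i) = j ` {f \<in> carrier (E i). (if i = 0 then gap_part f else 0) = 0}" for i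
    by (cases "i = 0") (auto simp: mem_a_kernel E'_def I dj zE)
  show "\<exists>(E :: nat \<Rightarrow> ('r, 'r list) module) \<epsilon> d n.
        (\<forall>i. injective_module Q (E i)) \<and>
        (\<forall>i>n. carrier (E i) = {\<zero>\<^bsub>E i\<^esub>}) \<and>
        \<epsilon> \<in> linear_maps Q (self_module Q) (E 0) \<and>
        (\<forall>i. d i \<in> linear_maps Q (E i) (E (Suc i))) \<and>
        inj_on \<epsilon> (carrier (self_module Q)) \<and>
        \<epsilon> ` carrier (self_module Q) = a_kernel (E 0) (E 1) (d 0) \<and>
        (\<forall>i. d i ` carrier (E i) = a_kernel (E (Suc i)) (E (Suc (Suc i))) (d (Suc i)))"
  proof (rule exI[of _ E'], rule exI[of _ \<epsilon>], rule exI[of _ d], rule exI[of _ 1], intro conjI allI impI)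
    show "injective_module Q (E' i)" for i
      unfolding E'_def by (intro baer_imp_injective baer_module_image modE jon baerE)
    show "carrier (E' i) = {\<zero>\<^bsub>E' i\<^esub>}" if "i > 1" for i
      using that by (simp add: E'_def I) (simp add: E_def)
    show "\<epsilon> \<in> linear_maps Q (self_module Q) (E' 0)"
      unfolding linear_maps_def E'_def \<epsilon>_def
      by (auto simp: E_def module_image_simps[OF module_frac_module jon] hom_add hom_mult fls_times_fps_to_fls)
    show "d i \<in> linear_maps Q (E' i) (E' (Suc i))" for i
      unfolding linear_maps_def E'_def
      by (cases "i = 0")
        (auto simp: dj E_def module_image_simps[OF module_frac_module jon]
          module_image_simps[OF module_cofrac_module jon] module_image_simps[OF modZ jon]
          gap_part_add gap_part_mult_gap_part)
    show "inj_on \<epsilon> (carrier (self_module Q))"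
      by (auto simp: \<epsilon>_def intro!: inj_onI eqI)
    have "{f. gap_part f = 0} = (\<lambda>q. fps_to_fls (\<psi> q)) ` carrier Q"
      by (auto simp: gap_part_zero_iff)
    then show "\<epsilon> ` carrier (self_module Q) = a_kernel (E' 0) (E' 1) (d 0)"
      using ker[of 0] by (simp add: \<epsilon>_def image_image) (simp add: E_def image_image)
    show "d i ` carrier (E' i) = a_kernel (E' (Suc i)) (E' (Suc (Suc i))) (d (Suc i))" for i
      unfolding ker unfolding E'_def I image_image dj by (cases "i = 0") (auto simp: E_def)
  qed
qed

end


section \<open>Elements of the symbolic powers\<close>

lemma ring_of_type_algebra_simps [simp]:
  "carrier ring_of_type_algebra = UNIV"
  "x \<otimes>\<^bsub>ring_of_type_algebra\<^esub> y = x * y" "x \<oplus>\<^bsub>ring_of_type_algebra\<^esub> y = x + y"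
  "\<one>\<^bsub>ring_of_type_algebra\<^esub> = 1" "\<zero>\<^bsub>ring_of_type_algebra\<^esub> = 0"
  by (simp_all add: ring_of_type_algebra_def)

definition monom4 :: "nat \<Rightarrow> nat \<Rightarrow> nat \<Rightarrow> nat \<Rightarrow> 'k::comm_ring_1 fps4" where
  "monom4 i j k l = var_x ^ i * var_y ^ j * var_z ^ k * var_w ^ l"

lemma coeff4_monom4:
  "coeff4 (monom4 i j k l :: 'k::comm_ring_1 fps4) e = (if e = (i, j, k, l) then 1 else 0)"
proof -
  have "monom4 i j k l = fps_const (fps_const (fps_const (fps_X ^ i) * fps_X ^ j) * fps_X ^ k) * (fps_X ^ l :: 'k fps4)"
    by (simp add: monom4_def fps_const_power[symmetric] fps_const_mult[symmetric] del: fps_const_power fps_const_mult)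
  then show ?thesis
    by (cases e) (auto simp: coeff4_def fps_X_power_iff)
qed

lemma coeff4_add: "coeff4 (f + g) e = coeff4 f e + coeff4 g e"
  and coeff4_diff: "coeff4 (f - h) e = coeff4 f e - coeff4 h e"
  for h :: "'k::comm_ring_1 fps4"
  by (cases e; simp add: coeff4_def)+

lemma coeff4_var_mult:
  fixes f :: "'k::comm_ring_1 fps4"
  shows "coeff4 (var_x * f) (0, j, k, l) = 0" "coeff4 (var_y * f) (i, 0, k, l) = 0"
  by (simp_all add: coeff4_def)

text \<open>Setting \<open>x = y = 0\<close> is a ring homomorphism, so the pure \<open>z\<close>,
  \<open>w\<close> coefficients multiply among themselves.\<close>

lemma coeff4_mult_zw:
  "coeff4 (f * g) (0, 0, i, j) = (\<Sum>i'\<le>i. \<Sum>j'\<le>j. coeff4 f (0, 0, i', j') * coeff4 g (0, 0, i - i', j - j'))"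
proof -
  have "coeff4 (f * g) (0, 0, i, j) = (\<Sum>(i', j')\<in>{..i} \<times> {..j}. coeff4 f (0, 0, i', j') * coeff4 g (0, 0, i - i', j - j'))"
    unfolding coeff4_mult
    by (rule sum.reindex_bij_witness[of _ "\<lambda>(i, j). (0, 0, i, j)" "\<lambda>(_, _, i, j). (i, j)"]) auto
  then show ?thesis by (simp add: sum.cartesian_product)
qed

context
  fixes R :: "'a::comm_ring_1 ring" and P :: "'a set"
  assumes R: "R = ring_of_type_algebra" and P: "ideal P R"
begin

interpretation cring R unfolding R by (rule cring_from_type_algebra)
interpretation ideals: semiring "ideals_set R" by (rule ideals_set_is_semiring)

lemma ideal_power_Suc: "P [^]\<^bsub>ideals_set R\<^esub> Suc n = ideal_prod R (P [^]\<^bsub>ideals_set R\<^esub> n) P"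
proof -
  have "P [^]\<^bsub>ideals_set R\<^esub> Suc n = P [^]\<^bsub>ideals_set R\<^esub> n \<otimes>\<^bsub>ideals_set R\<^esub> P" by (rule ideals.nat_pow_Suc)
  then show ?thesis by (simp add: ideals_set_def)
qed

lemma ideal_power_mult:
  "f \<in> P [^]\<^bsub>ideals_set R\<^esub> n \<Longrightarrow> p \<in> P \<Longrightarrow> f * p \<in> P [^]\<^bsub>ideals_set R\<^esub> Suc n"
  using ideal_prod.prod[of f "P [^]\<^bsub>ideals_set R\<^esub> n" p P R]
  unfolding ideal_power_Suc by (simp add: R)

lemma ideal_ideal_power: "ideal (P [^]\<^bsub>ideals_set R\<^esub> (n::nat)) R"
proof -
  have "P [^]\<^bsub>ideals_set R\<^esub> n \<in> carrier (ideals_set R)"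
    using P by (intro ideals.nat_pow_closed) (simp add: ideals_set_def)
  then show ?thesis by (simp add: ideals_set_def)
qed

lemma ideal_power_closed:
  assumes "f \<in> P [^]\<^bsub>ideals_set R\<^esub> (n::nat)"
  shows "g \<in> P [^]\<^bsub>ideals_set R\<^esub> n \<Longrightarrow> f + g \<in> P [^]\<^bsub>ideals_set R\<^esub> n" "h * f \<in> P [^]\<^bsub>ideals_set R\<^esub> n"
proof -
  interpret I: ideal "P [^]\<^bsub>ideals_set R\<^esub> n" R by (rule ideal_ideal_power)
  show "g \<in> P [^]\<^bsub>ideals_set R\<^esub> n \<Longrightarrow> f + g \<in> P [^]\<^bsub>ideals_set R\<^esub> n" "h * f \<in> P [^]\<^bsub>ideals_set R\<^esub> n"
    using I.a_closed[OF assms, of g] I.I_l_closed[OF assms, of h] by (simp_all add: R)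
qed

lemma ideal_power_diff:
  assumes "f \<in> P [^]\<^bsub>ideals_set R\<^esub> (n::nat)" "g \<in> P [^]\<^bsub>ideals_set R\<^esub> n"
  shows "f - g \<in> P [^]\<^bsub>ideals_set R\<^esub> n"
  using ideal_power_closed(1)[OF assms(1) ideal_power_closed(2)[OF assms(2), of "- 1"]] by simp

lemma ideal_power_2I: "p \<in> P \<Longrightarrow> q \<in> P \<Longrightarrow> p * q \<in> P [^]\<^bsub>ideals_set R\<^esub> (2::nat)"
  using ideal_power_mult[OF ideal_power_mult[of 1 0 p], of q]
  by (simp add: numeral_2_eq_2) (simp add: ideals_set_def R)

lemma ideal_power_3I: "p \<in> P \<Longrightarrow> q \<in> P \<Longrightarrow> s \<in> P \<Longrightarrow> p * q * s \<in> P [^]\<^bsub>ideals_set R\<^esub> (3::nat)"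
  using ideal_power_mult[OF ideal_power_2I[of p q], of s] by (simp add: numeral_3_eq_3 numeral_2_eq_2)

lemma ideal_power_Suc_induct:
  assumes "f \<in> P [^]\<^bsub>ideals_set R\<^esub> Suc n"
    and "\<And>p q. p \<in> P [^]\<^bsub>ideals_set R\<^esub> n \<Longrightarrow> q \<in> P \<Longrightarrow> A (p * q)" and "\<And>f g. A f \<Longrightarrow> A g \<Longrightarrow> A (f + g)"
  shows "A f"
  using assms(1) unfolding ideal_power_Suc
  by (induction rule: ideal_prod.induct) (auto simp: R intro: assms(2,3))

lemma ideal_power_1: "p \<in> P [^]\<^bsub>ideals_set R\<^esub> Suc 0 \<Longrightarrow> p \<in> P"
proof (erule ideal_power_Suc_induct)
  interpret P: ideal P R by (rule P)
  show "\<And>p q. q \<in> P \<Longrightarrow> p * q \<in> P" "\<And>f g. f \<in> P \<Longrightarrow> g \<in> P \<Longrightarrow> f + g \<in> P"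
    using P.I_l_closed P.a_closed by (simp_all add: R)
qed

lemma ideal_power_2_induct:
  assumes "f \<in> P [^]\<^bsub>ideals_set R\<^esub> (2::nat)"
    and "\<And>p q. p \<in> P \<Longrightarrow> q \<in> P \<Longrightarrow> A (p * q)" and "\<And>f g. A f \<Longrightarrow> A g \<Longrightarrow> A (f + g)"
  shows "A f"
  using assms(1) unfolding numeral_2_eq_2
proof (rule ideal_power_Suc_induct)
  show "A (p * q)" if "p \<in> P [^]\<^bsub>ideals_set R\<^esub> Suc 0" "q \<in> P" for p q
    using assms(2) ideal_power_1 that by blast
qed (rule assms(3))

lemma ideal_power_3_induct:
  assumes "f \<in> P [^]\<^bsub>ideals_set R\<^esub> (3::nat)"
    and "\<And>p q s. p \<in> P \<Longrightarrow> q \<in> P \<Longrightarrow> s \<in> P \<Longrightarrow> A (p * q * s)" and "\<And>f g. A f \<Longrightarrow> A g \<Longrightarrow> A (f + g)"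
  shows "A f"
proof -
  have "A (h * s)" if "h \<in> P [^]\<^bsub>ideals_set R\<^esub> (2::nat)" "s \<in> P" for h s
    using that(1) by (rule ideal_power_2_induct) (auto simp: distrib_right that(2) intro: assms(2,3))
  moreover have "f \<in> P [^]\<^bsub>ideals_set R\<^esub> Suc 2" using assms(1) by (simp add: numeral_3_eq_3 numeral_2_eq_2)
  ultimately show ?thesis
    using assms(3) by (elim ideal_power_Suc_induct) auto
qed

end

section \<open>Coefficients that vanish on powers of \<open>P\<close>\<close>

context arith_pair
begin

abbreviation \<phi> :: "'k::field fps4 \<Rightarrow> 'k fps" where
  "\<phi> \<equiv> monomial_subst a (a + r) (a + 2 * r) (a + 3 * r)"

abbreviation P :: "'k::field fps4 set" where
  "P \<equiv> defining_ideal a r"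

lemma pos: "0 < a" "0 < a + r" "0 < a + 2 * r" "0 < a + 3 * r"
  using a_pos by simp_all

lemma mem_P: "f \<in> P \<longleftrightarrow> \<phi> f = 0"
  by (simp add: defining_ideal_def a_kernel_def')

lemma phi_simps [simp]:
  "\<phi> (f + g) = \<phi> f + \<phi> g" "\<phi> (f * g) = \<phi> f * \<phi> g"
  "\<phi> var_x = fps_X ^ a" "\<phi> var_y = fps_X ^ (a + r)" "\<phi> var_z = fps_X ^ (a + 2 * r)" "\<phi> var_w = fps_X ^ (a + 3 * r)"
  by (simp_all only: monomial_subst_add monomial_subst_mult[OF pos] monomial_subst_var[OF pos])

lemma phi_const: "\<phi> (fps_const (fps_const (fps_const (fps_const c)))) = fps_const c"
  by (rule monomial_subst_const[OF pos])

lemma phi_0 [simp]: "\<phi> 0 = 0" and phi_1 [simp]: "\<phi> 1 = 1"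
  using phi_const[of 0] phi_const[of 1] by simp_all

lemma phi_uminus [simp]: "\<phi> (- f) = - \<phi> f"
  using phi_simps(1)[of f "- f"] by (simp add: eq_neg_iff_add_eq_0 add.commute del: phi_simps)

lemma phi_diff [simp]: "\<phi> (f - g) = \<phi> f - \<phi> g"
  using phi_simps(1)[of f "- g"] by simp

lemma phi_power [simp]: "\<phi> (f ^ n) = \<phi> f ^ n"
  by (induction n) simp_all

lemma phi_ring_hom:
  "ring_hom_ring (ring_of_type_algebra :: 'k::field fps4 ring) (ring_of_type_algebra :: 'k fps ring) \<phi>"
  by (intro ring_hom_ringI2 ring_from_type_algebra ring_hom_memI) simp_all

lemma ideal_P: "ideal P ring_of_type_algebra"
proof -
  interpret ring_hom_ring "ring_of_type_algebra :: 'k::field fps4 ring" "ring_of_type_algebra :: 'k fps ring" \<phi>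
    by (rule phi_ring_hom)
  show "ideal (P :: 'k fps4 set) ring_of_type_algebra"
    unfolding defining_ideal_def by (rule kernel_is_ideal)
qed

lemma var_x_notin_P: "var_x \<notin> P"
  by (simp add: mem_P)

lemmas P2I = ideal_power_2I[OF refl ideal_P]
lemmas P3I = ideal_power_3I[OF refl ideal_P]

lemma symbolic_powerI:
  fixes f :: "'k::field fps4"
  assumes "var_x * f \<in> P [^]\<^bsub>ideals_set ring_of_type_algebra\<^esub> (n::nat)"
  shows "f \<in> symbolic_power ring_of_type_algebra P n"
  unfolding symbolic_power_def using assms var_x_notin_P
  by (auto intro!: bexI[of _ var_x])

lemma coeff4_P_unique:
  fixes p :: "'k::field fps4"
  assumes p: "p \<in> P" and ij: "i \<le> 1" "2 * i + 3 * j < a"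
  shows "coeff4 p (0, 0, i, j) = 0"
proof -
  let ?n = "i * (a + 2 * r) + j * (a + 3 * r)"
  have "exps_of_weight a (a + r) (a + 2 * r) (a + 3 * r) ?n = {(0, 0, i, j)}"
    unfolding exps_of_weight_def using unique_weight[OF ij] by auto
  then have "\<phi> p $ ?n = coeff4 p (0, 0, i, j)"
    by (simp add: monomial_subst_def)
  with p show ?thesis by (simp add: mem_P)
qed

text \<open>However \<open>z^3 w^m\<close> is split, one factor contains \<open>z\<close> at most
  once, and that factor has a unique weight.\<close>

lemma coeff4_P2:
  assumes p: "p \<in> P" "q \<in> P" and m: "3 * m + 2 < a"
  shows "coeff4 (p * q) (0, 0, 3, m) = 0"
  unfolding coeff4_mult_zw
proof (intro sum.neutral ballI)
  fix i j assume ij: "i \<in> {..3::nat}" "j \<in> {..m}"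
  show "coeff4 p (0, 0, i, j) * coeff4 q (0, 0, 3 - i, m - j) = 0"
  proof (cases "i \<le> 1")
    case True
    with coeff4_P_unique[OF p(1) True, of j] ij m show ?thesis by simp
  next
    case False
    with coeff4_P_unique[OF p(2), of "3 - i" "m - j"] ij m show ?thesis by simp
  qed
qed

text \<open>A factor without \<open>z\<close> is a power \<open>w^j\<close> of unique weight, as
  \<open>j \<le> k\<close>. Otherwise the \<open>z\<close>-exponents are 2, 1, 1 in some order, and
  of the two factors \<open>z w^j\<close> one has \<open>j < k\<close>, which again makes its weight
  unique. Only \<open>z w^k\<close> itself shares its weight with another monomial.\<close>

lemma coeff4_P3:
  assumes p: "p \<in> P" "q \<in> P" "s \<in> P" and a: "a = 3 * k + 2" and "k > 0"
  shows "coeff4 (p * q * s) (0, 0, 4, k) = 0"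
proof -
  have v0: "coeff4 f (0, 0, 0, j) = 0" if "f \<in> P" "j \<le> k" for f :: "'a fps4" and j
    using coeff4_P_unique[OF that(1), of 0 j] that a by simp
  have v1: "coeff4 f (0, 0, Suc 0, j) = 0" if "f \<in> P" "j < k" for f :: "'a fps4" and j
    using coeff4_P_unique[OF that(1), of 1 j] that a by simp
  have pq: "coeff4 (p * q) (0, 0, i, j) = 0" if "j \<le> k" "i \<le> 2 \<or> i = 3 \<and> j = 0" for i j
    unfolding coeff4_mult_zw
  proof (intro sum.neutral ballI)
    fix i' j' assume ij: "i' \<in> {..i}" "j' \<in> {..j}"
    then have "i' \<le> i" "j' \<le> j" by simp_all
    with that \<open>k > 0\<close> have "i' = 0 \<or> (i' = 1 \<and> j' < k) \<or> (i' = 1 \<and> j' = k \<and> i - i' = 1) \<or>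
        (i' \<ge> 2 \<and> i - i' = 1 \<and> j = 0) \<or> i - i' = 0"
      by presburger
    then show "coeff4 p (0, 0, i', j') * coeff4 q (0, 0, i - i', j - j') = 0"
    proof (elim disjE conjE)
      assume "i' = 0"
      then show ?thesis using v0[OF p(1), of j'] ij that by simp
    next
      assume "i' = 1" "j' < k"
      then show ?thesis using v1[OF p(1), of j'] by simp
    next
      assume "i' = 1" "j' = k" "i - i' = 1"
      then show ?thesis using v1[OF p(2), of "j - j'"] ij that \<open>k > 0\<close> by simp
    next
      assume "i' \<ge> 2" "i - i' = 1" "j = 0"
      then show ?thesis using v1[OF p(2), of "j - j'"] ij that \<open>k > 0\<close> by simp
    next
      assume "i - i' = 0"
      then show ?thesis using v0[OF p(2), of "j - j'"] ij that by simp
    qed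
  qed
  show ?thesis
    unfolding coeff4_mult_zw[of "p * q"]
  proof (intro sum.neutral ballI)
    fix i j assume ij: "i \<in> {..4::nat}" "j \<in> {..k}"
    consider "i \<le> 2" | "i = 3" "j = 0" | "i = 3" "j > 0" | "i = 4"
      using ij by force
    then show "coeff4 (p * q) (0, 0, i, j) * coeff4 s (0, 0, 4 - i, k - j) = 0"
    proof cases
      case 3 then show ?thesis using v1[OF p(3), of "k - j"] \<open>k > 0\<close> by simp
    next
      case 4 then show ?thesis using v0[OF p(3), of "k - j"] by simp
    qed (use pq ij in auto)
  qed
qed

lemma P2_neq_symbolic:
  assumes a: "a = 3 * k \<or> a = 3 * k + 1" "k > 0"
  shows "(P :: 'k::field fps4 set) [^]\<^bsub>ideals_set ring_of_type_algebra\<^esub> (2::nat) \<noteq> symbolic_power ring_of_type_algebra P 2"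
proof -
  obtain m where m: "k = Suc m" using \<open>k > 0\<close> by (cases k) auto
  define x y z w :: "'k fps4" where "x = var_x" and "y = var_y" and "z = var_z" and "w = var_w"
  have \<phi>v: "\<phi> x = fps_X ^ a" "\<phi> y = fps_X ^ (a + r)" "\<phi> z = fps_X ^ (a + 2 * r)" "\<phi> w = fps_X ^ (a + 3 * r)"
    by (simp_all add: x_def y_def z_def w_def)
  \<comment> \<open>A monomial whose image is \<open>t^(2 r)\<close> times that of
    \<open>z w^m\<close>; this requires \<open>x c\<close> to have the weight of
    \<open>z^2 w^m\<close>, and the two residues of \<open>a\<close> give different
    solutions.\<close>
  define c where "c = (if a = 3 * k + 1 then x ^ (k + r) else x ^ (m + r) * y)"
  \<comment> \<open>the determinant of the matrix with rows \<open>(x, y, z)\<close>, \<open>(y, z, w)\<close>, \<open>(z w^m, w^(m + 1), c)\<close>, which has rank one modulo \<open>P\<close>\<close>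
  define D where "D = z * w ^ m * (y * w - z ^ 2) - w ^ Suc m * (x * w - y * z) + c * (x * z - y ^ 2)"
  have \<phi>c: "x * c - z ^ 2 * w ^ m \<in> P"
  proof -
    have e: "a + a * (k + r) = 2 * (a + 2 * r) + m * (a + 3 * r)" if "a = 3 * k + 1"
      unfolding m using that by (simp add: algebra_simps m)
    have e': "a + (a * (m + r) + (a + r)) = 2 * (a + 2 * r) + m * (a + 3 * r)" if "a = 3 * k"
      unfolding m using that by (simp add: algebra_simps m)
    from a(1) show ?thesis
    proof
      assume ak: "a = 3 * k"
      then have c: "c = x ^ (m + r) * y" by (simp add: c_def)
      show ?thesis
        unfolding c mem_P phi_diff phi_simps phi_power \<phi>v power_mult[symmetric] power_add[symmetric]
        using e'[OF ak] by (simp add: mult.commute)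
    next
      assume ak: "a = 3 * k + 1"
      then have c: "c = x ^ (k + r)" by (simp add: c_def)
      show ?thesis
        unfolding c mem_P phi_diff phi_simps phi_power \<phi>v power_mult[symmetric] power_add[symmetric]
        using e[OF ak] by (simp add: mult.commute)
    qed
  qed
  have p1: "x * z - y ^ 2 \<in> P" and p2: "x * w - y * z \<in> P"
    unfolding mem_P phi_diff phi_simps phi_power \<phi>v power_mult[symmetric] power_add[symmetric]
    by (simp_all add: algebra_simps)
  \<comment> \<open>Sylvester's identity: the corner entry times a 3 by 3 determinant is the 2 by 2
    determinant of the minors bordering that entry. All these minors lie in
    \<open>P\<close>.\<close>
  have "x * D = (x * z - y ^ 2) * (x * c - z ^ 2 * w ^ m) - (x * w - y * z) * (w ^ m * (x * w - y * z))"
    by (simp add: D_def algebra_simps power2_eq_square)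
  moreover have "w ^ m * (x * w - y * z) \<in> P"
    using p2 by (simp add: mem_P)
  ultimately have "x * D \<in> P [^]\<^bsub>ideals_set ring_of_type_algebra\<^esub> (2::nat)"
    using P2I[OF p1 \<phi>c] P2I[OF p2] by (simp add: ideal_power_diff[OF refl ideal_P])
  then have sym: "D \<in> symbolic_power ring_of_type_algebra P 2"
    unfolding x_def by (rule symbolic_powerI)
  have "D \<notin> P [^]\<^bsub>ideals_set ring_of_type_algebra\<^esub> (2::nat)"
  proof
    assume "D \<in> P [^]\<^bsub>ideals_set ring_of_type_algebra\<^esub> (2::nat)"
    then have "coeff4 D (0, 0, 3, m) = 0"
    proof (rule ideal_power_2_induct[OF refl ideal_P])
      show "coeff4 (p * q) (0, 0, 3, m) = 0" if "p \<in> P" "q \<in> P" for p q :: "'k fps4"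
        using that a by (intro coeff4_P2) (auto simp: m)
    qed (simp add: coeff4_add)
    moreover have "D = y * (z * w ^ m * w + w ^ Suc m * z) - x * (w ^ Suc m * w) + c * (x * z - y ^ 2) - monom4 0 0 3 m"
      by (simp add: D_def monom4_def x_def y_def z_def w_def algebra_simps power2_eq_square power3_eq_cube)
    moreover have "c * (x * z - y ^ 2) = x * (c * z) - y * (c * y)"
      by (simp add: algebra_simps power2_eq_square)
    ultimately show False
      by (simp add: coeff4_diff coeff4_add coeff4_monom4 x_def y_def coeff4_var_mult)
  qed
  with sym show ?thesis by blast
qed

lemma P3_neq_symbolic:
  assumes a: "a = 3 * k + 2" "k > 0"
  shows "(P :: 'k::field fps4 set) [^]\<^bsub>ideals_set ring_of_type_algebra\<^esub> (3::nat) \<noteq> symbolic_power ring_of_type_algebra P 3"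
proof -
  obtain m where m: "k = Suc m" using \<open>k > 0\<close> by (cases k) auto
  define x y z w :: "'k fps4" where "x = var_x" and "y = var_y" and "z = var_z" and "w = var_w"
  have \<phi>v: "\<phi> x = fps_X ^ a" "\<phi> y = fps_X ^ (a + r)" "\<phi> z = fps_X ^ (a + 2 * r)" "\<phi> w = fps_X ^ (a + 3 * r)"
    by (simp_all add: x_def y_def z_def w_def)
  define p1 p2 p3 where "p1 = x * z - y ^ 2" and "p2 = x * w - y * z" and "p3 = y * w - z ^ 2"
  \<comment> \<open>\<open>\<xi>\<close> is \<open>x^(k + r - 1)\<close>. Splitting off the
    remaining powers of \<open>x\<close> makes the division of the minor by \<open>x\<close>
    explicit.\<close>
  define \<xi> p4 p5 where "\<xi> = x ^ (m + r)" and "p4 = w ^ k * z - \<xi> * x ^ 2" and "p5 = w ^ k * w - \<xi> * x * y"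
  \<comment> \<open>the minor \<open>p2\<^sup>2 p4 - p1 p2 p5 - p1 p3 p4\<close> of the Jacobian dual, divided by \<open>x\<close>\<close>
  define D where "D = w ^ k * p3 ^ 2 - \<xi> * (x * p2 ^ 2 - y * p1 * p2 - x * p1 * p3)"
  have p123: "p1 \<in> P" "p2 \<in> P" "p3 \<in> P"
    unfolding mem_P p1_def p2_def p3_def phi_diff phi_simps phi_power \<phi>v power_mult[symmetric] power_add[symmetric]
    by (simp_all add: algebra_simps)
  have e: "(a + 3 * r) * k + (a + 2 * r) = a * (m + r) + a * 2"
    "(a + 3 * r) * k + (a + 3 * r) = a * (m + r) + a + (a + r)"
    using a by (simp_all add: m algebra_simps)
  have p4: "p4 \<in> P" using e(1)
    unfolding mem_P p4_def \<xi>_def phi_diff phi_simps phi_power \<phi>v power_mult[symmetric] power_add[symmetric]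
    by simp
  have p5: "p5 \<in> P" using e(2)
    unfolding mem_P p5_def \<xi>_def phi_diff phi_simps phi_power \<phi>v power_mult[symmetric] power_add[symmetric]
    by simp
  have "x * D = p2 * p2 * p4 - p1 * p2 * p5 - p1 * p3 * p4"
    by (simp add: D_def p1_def p2_def p3_def p4_def p5_def algebra_simps power2_eq_square)
  then have "x * D \<in> P [^]\<^bsub>ideals_set ring_of_type_algebra\<^esub> (3::nat)"
    using p123 p4 p5 by (simp add: P3I ideal_power_diff[OF refl ideal_P])
  then have sym: "D \<in> symbolic_power ring_of_type_algebra P 3"
    unfolding x_def by (rule symbolic_powerI)
  have "D \<notin> P [^]\<^bsub>ideals_set ring_of_type_algebra\<^esub> (3::nat)"
  proof
    assume "D \<in> P [^]\<^bsub>ideals_set ring_of_type_algebra\<^esub> (3::nat)"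
    then have "coeff4 D (0, 0, 4, k) = 0"
    proof (rule ideal_power_3_induct[OF refl ideal_P])
      show "coeff4 (p * q * s) (0, 0, 4, k) = 0" if "p \<in> P" "q \<in> P" "s \<in> P" for p q s :: "'k fps4"
        using that a by (rule coeff4_P3)
    qed (simp add: coeff4_add)
    moreover have "D = monom4 0 0 4 k + y * (w ^ k * (y * w ^ 2 - 2 * w * z ^ 2) + \<xi> * p1 * p2) - x * (\<xi> * p2 ^ 2 - \<xi> * p1 * p3)"
      by (simp add: D_def monom4_def p3_def x_def y_def z_def w_def algebra_simps power2_eq_square power4_eq_xxxx)
    ultimately show False
      by (simp add: coeff4_diff coeff4_add coeff4_monom4 x_def y_def coeff4_var_mult)
  qed
  with sym show ?thesis by blast
qed

end


section \<open>Generators of the defining ideal\<close>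

definition mk4 :: "(nat \<times> nat \<times> nat \<times> nat \<Rightarrow> 'k::zero) \<Rightarrow> 'k fps4" where
  "mk4 c = Abs_fps (\<lambda>l. Abs_fps (\<lambda>k. Abs_fps (\<lambda>j. Abs_fps (\<lambda>i. c (i, j, k, l)))))"

lemma coeff4_mk4 [simp]: "coeff4 (mk4 c) = c"
  by (auto simp: mk4_def coeff4_def)

lemma fps4_eqI: "(\<And>e. coeff4 f e = coeff4 g e) \<Longrightarrow> f = g"
  by (intro fps_ext) (auto simp: coeff4_def)

lemma coeff4_0 [simp]: "coeff4 0 e = 0"
  by (cases e) (simp add: coeff4_def)

lemma coeff4_sum: "coeff4 (\<Sum>i\<in>A. f i) e = (\<Sum>i\<in>A. coeff4 (f i) e)" for f :: "_ \<Rightarrow> 'k::comm_ring_1 fps4"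
  by (cases e) (simp add: coeff4_def fps_sum_nth)

abbreviation const4 :: "'k::comm_ring_1 \<Rightarrow> 'k fps4" where
  "const4 c \<equiv> fps_const (fps_const (fps_const (fps_const c)))"

lemma coeff4_const4_mult: "coeff4 (const4 c * f) e = c * coeff4 f e"
  by (cases e) (simp add: coeff4_def)

definition generated_by :: "nat \<Rightarrow> (nat \<Rightarrow> 'a::comm_ring_1) \<Rightarrow> 'a set" where
  "generated_by n p = {\<Sum>i<n. q i * p i | q. True}"

lemma generated_byI: "f = (\<Sum>i<n. q i * p i) \<Longrightarrow> f \<in> generated_by n p"
  unfolding generated_by_def by (intro CollectI exI[of _ q]) simp

lemma generated_by_closed:
  assumes "f \<in> generated_by n p"
  shows "g \<in> generated_by n p \<Longrightarrow> f + g \<in> generated_by n p" "h * f \<in> generated_by n p"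
proof -
  from assms obtain q where q: "f = (\<Sum>i<n. q i * p i)" unfolding generated_by_def by blast
  show "f + g \<in> generated_by n p" if "g \<in> generated_by n p"
  proof -
    from that obtain q' where q': "g = (\<Sum>i<n. q' i * p i)" unfolding generated_by_def by blast
    have "f + g = (\<Sum>i<n. (q i + q' i) * p i)" by (simp add: q q' sum.distrib distrib_right)
    then show ?thesis by (rule generated_byI)
  qed
  have "h * f = (\<Sum>i<n. (h * q i) * p i)" by (simp add: q sum_distrib_left mult.assoc)
  then show "h * f \<in> generated_by n p" by (rule generated_byI)
qed

lemma generated_by_0: "0 \<in> generated_by n p"
proof -
  have "0 = (\<Sum>i<n. 0 * p i)" by simp
  then show ?thesis by (rule generated_byI)
qed

lemma generated_by_sum:
  "(\<And>i. i \<in> A \<Longrightarrow> f i \<in> generated_by n p) \<Longrightarrow> (\<Sum>i\<in>A. f i) \<in> generated_by n p"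
  by (induction A rule: infinite_finite_induct) (auto intro: generated_by_0 generated_by_closed(1))

lemma generated_by_gen: "i < n \<Longrightarrow> p i \<in> generated_by n p"
proof -
  assume "i < n"
  then have "p i = (\<Sum>j<n. (if j = i then 1 else 0) * p j)"
    by (simp add: if_distrib[of "\<lambda>x. x * _"] cong: if_cong)
  then show ?thesis by (rule generated_byI)
qed

lemma generated_by_diff_trans:
  "f - g \<in> generated_by n p \<Longrightarrow> g - h \<in> generated_by n p \<Longrightarrow> f - h \<in> generated_by n p"
  using generated_by_closed(1)[of "f - g" n p "g - h"] by simp

lemma generated_by_diff_sym:
  "f - g \<in> generated_by n p \<Longrightarrow> g - f \<in> generated_by n p"
  using generated_by_closed(2)[of "f - g" n p "- 1"] by simp

context arith_pair
begin

definition wt :: "nat \<times> nat \<times> nat \<times> nat \<Rightarrow> nat" where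
  "wt = (\<lambda>(i, j, k, l). i * a + j * (a + r) + k * (a + 2 * r) + l * (a + 3 * r))"

lemma mem_exps_of_weight: "e \<in> exps_of_weight a (a + r) (a + 2 * r) (a + 3 * r) n \<longleftrightarrow> wt e = n"
  by (cases e) (simp add: exps_of_weight_def wt_def)

lemma finite_wt: "finite {e. wt e = n}"
  using finite_exps_of_weight[OF pos, of n] by (simp add: mem_exps_of_weight[symmetric])

lemma phi_nth: "\<phi> f $ n = (\<Sum>e | wt e = n. coeff4 f e)"
proof -
  have "exps_of_weight a (a + r) (a + 2 * r) (a + 3 * r) n = {e. wt e = n}"
    by (auto simp: mem_exps_of_weight)
  then show ?thesis by (simp add: monomial_subst_def)
qed

lemma int_wt: "int (wt (i, j, k, l)) = int (i + j + k + l) * int a + int (j + 2 * k + 3 * l) * int r"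
  by (simp add: wt_def algebra_simps)

lemma wt_in_H: "int (wt e) \<in> H"
proof -
  obtain i j k l where e: "e = (i, j, k, l)" by (cases e)
  show ?thesis unfolding e int_wt by (rule arith_semigroupI) auto
qed

lemma H_imp_wt:
  assumes "int n \<in> H"
  shows "\<exists>e. wt e = n"
proof -
  from assms obtain N I where NI: "int n = N * int a + I * int r" "0 \<le> I" "I \<le> 3 * N"
    unfolding arith_semigroup_def by blast
  define l where "l = I div 3"
  define m where "m = I mod 3"
  \<comment> \<open>Use \<open>w\<close> as often as possible; the remainder 1 or 2 is one factor
    \<open>y\<close> or \<open>z\<close>, for which there is room because \<open>l < N\<close>
    then.\<close>
  have I: "I = 3 * l + m" "0 \<le> m" "m < 3" by (simp_all add: l_def m_def)
  have l: "0 \<le> l" "l \<le> N" "m > 0 \<Longrightarrow> l < N" using NI I by linarith+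
  consider "m = 0" | "m = 1" | "m = 2" using I by linarith
  then show ?thesis
  proof cases
    case 1
    have "int (wt (nat (N - l), 0, 0, nat l)) = int n"
      unfolding int_wt NI(1) using I l 1 by (simp add: nat_diff_distrib)
    then show ?thesis by (metis of_nat_eq_iff)
  next
    case 2
    have "int (wt (nat (N - l - 1), 1, 0, nat l)) = int n"
      unfolding int_wt NI(1) using I l 2 by simp
    then show ?thesis by (metis of_nat_eq_iff)
  next
    case 3
    have "int (wt (nat (N - l - 1), 0, 1, nat l)) = int n"
      unfolding int_wt NI(1) using I l 3 by simp
    then show ?thesis by (metis of_nat_eq_iff)
  qed
qed

lemma range_phi: "range (\<phi> :: 'k::field fps4 \<Rightarrow> 'k fps) = {f. \<forall>n. f $ n \<noteq> 0 \<longrightarrow> int n \<in> H}"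
proof (intro subset_antisym subsetI)
  fix f assume "f \<in> range (\<phi> :: 'k fps4 \<Rightarrow> 'k fps)"
  then obtain g where f: "f = \<phi> g" by blast
  have "int n \<in> H" if n: "f $ n \<noteq> 0" for n
  proof -
    from n obtain e where "wt e = n" unfolding f phi_nth by (metis (mono_tags, lifting) mem_Collect_eq sum.not_neutral_contains_not_neutral)
    then show ?thesis using wt_in_H by blast
  qed
  then show "f \<in> {f. \<forall>n. f $ n \<noteq> 0 \<longrightarrow> int n \<in> H}" by blast
next
  fix f :: "'k fps" assume f: "f \<in> {f. \<forall>n. f $ n \<noteq> 0 \<longrightarrow> int n \<in> H}"
  \<comment> \<open>One monomial is selected for each weight, so each coefficient of
    \<open>f\<close> is placed on exactly one monomial.\<close>
  define s where "s n = (SOME e. wt e = n)" for n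
  define g :: "'k fps4" where "g = mk4 (\<lambda>e. if e = s (wt e) then f $ wt e else 0)"
  have "\<phi> g = f"
  proof (rule fps_ext)
    fix n
    have "\<phi> g $ n = (\<Sum>e | wt e = n. if e = s n then f $ n else 0)"
      unfolding phi_nth g_def by (intro sum.cong) auto
    also have "\<dots> = (if wt (s n) = n then f $ n else 0)"
      using finite_wt[of n] by (simp add: sum.delta)
    also have "\<dots> = f $ n"
    proof (cases "f $ n = 0")
      case False
      with f have "\<exists>e. wt e = n" by (intro H_imp_wt) auto
      then have "wt (s n) = n" unfolding s_def by (rule someI_ex)
      then show ?thesis by simp
    qed simp
    finally show "\<phi> g $ n = f $ n" .
  qed
  then show "f \<in> range (\<phi> :: 'k fps4 \<Rightarrow> 'k fps)" by blast
qed

text \<open>The coefficients of the cofactors in different weights do not interact, so a power series lies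
  in an ideal with weighted homogeneous generators as soon as its weighted components do.\<close>

lemma generated_by_components:
  fixes f :: "'k::field fps4"
  assumes hom: "\<And>i e. i < N \<Longrightarrow> coeff4 (p i) e \<noteq> 0 \<Longrightarrow> wt e = d i"
    and comp: "\<And>n. mk4 (\<lambda>e. if wt e = n then coeff4 f e else 0) \<in> generated_by N p"
  shows "f \<in> generated_by N p"
proof -
  have "\<forall>n. \<exists>q. mk4 (\<lambda>e. if wt e = n then coeff4 f e else 0) = (\<Sum>i<N. q i * p i)"
    using comp unfolding generated_by_def by blast
  then obtain q where q: "\<And>n. mk4 (\<lambda>e. if wt e = n then coeff4 f e else 0) = (\<Sum>i<N. q n i * p i)"
    by metis
  \<comment> \<open>A term of weight \<open>wt e\<close> in the cofactor of \<open>p i\<close>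
    contributes only in weight \<open>wt e + d i\<close>, so it is copied from the solution for that
    weight.\<close>
  define Q where "Q i = mk4 (\<lambda>e. coeff4 (q (wt e + d i) i) e)" for i
  have "f = (\<Sum>i<N. Q i * p i)"
  proof (rule fps4_eqI)
    fix e :: "nat \<times> nat \<times> nat \<times> nat"
    obtain e1 e2 e3 e4 where e: "e = (e1, e2, e3, e4)" by (cases e)
    have eq: "coeff4 (Q i * p i) e = coeff4 (q (wt e) i * p i) e" if i: "i < N" for i
      unfolding e coeff4_mult
    proof (rule sum.cong[OF refl])
      fix u assume u: "u \<in> {..e1} \<times> {..e2} \<times> {..e3} \<times> {..e4}"
      obtain f1 f2 f3 f4 where f: "u = (f1, f2, f3, f4)" by (cases u)
      have "coeff4 (Q i) (f1, f2, f3, f4) = coeff4 (q (wt (e1, e2, e3, e4)) i) (f1, f2, f3, f4)"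
        if ne: "coeff4 (p i) (e1 - f1, e2 - f2, e3 - f3, e4 - f4) \<noteq> 0"
      proof -
        have "int (wt (e1, e2, e3, e4)) = int (wt (f1, f2, f3, f4) + wt (e1 - f1, e2 - f2, e3 - f3, e4 - f4))"
          using u f unfolding of_nat_add int_wt by (simp add: of_nat_diff algebra_simps)
        then have "wt (e1, e2, e3, e4) = wt (f1, f2, f3, f4) + d i"
          unfolding of_nat_eq_iff hom[OF i ne] .
        then show ?thesis by (simp add: Q_def)
      qed
      then show "(case u of (i', j', k', l') \<Rightarrow> coeff4 (Q i) (i', j', k', l') * coeff4 (p i) (e1 - i', e2 - j', e3 - k', e4 - l')) =
        (case u of (i', j', k', l') \<Rightarrow> coeff4 (q (wt (e1, e2, e3, e4)) i) (i', j', k', l') * coeff4 (p i) (e1 - i', e2 - j', e3 - k', e4 - l'))"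
        unfolding f by auto
    qed
    have "coeff4 f e = coeff4 (\<Sum>i<N. q (wt e) i * p i) e"
      unfolding q[symmetric] by simp
    also have "\<dots> = coeff4 (\<Sum>i<N. Q i * p i) e"
      by (simp add: coeff4_sum eq)
    finally show "coeff4 f e = coeff4 (\<Sum>i<N. Q i * p i) e" .
  qed
  then show ?thesis by (rule generated_byI)
qed

text \<open>The coefficients of an element of \<open>P\<close> in a fixed weight sum to zero.
  Subtracting the same reference monomial from each term of that weight does not change the sum, so
  every weighted component is a combination of binomials.\<close>

lemma P_generated_by:
  fixes f :: "'k::field fps4"
  assumes f: "f \<in> P"
    and hom: "\<And>i e. i < N \<Longrightarrow> coeff4 (p i) e \<noteq> 0 \<Longrightarrow> wt e = d i"
    and mon: "\<And>i j k l i' j' k' l'. wt (i, j, k, l) = wt (i', j', k', l') \<Longrightarrow>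
      monom4 i j k l - monom4 i' j' k' l' \<in> generated_by N p"
  shows "f \<in> generated_by N p"
proof (rule generated_by_components[OF hom])
  fix n
  define m :: "nat \<times> nat \<times> nat \<times> nat \<Rightarrow> 'k fps4" where "m = (\<lambda>(i, j, k, l). monom4 i j k l)"
  have cm: "coeff4 (m e) e' = (if e' = e then 1 else 0)" for e e'
    by (cases e) (simp add: m_def coeff4_monom4)
  have mm: "m e - m e' \<in> generated_by N p" if "wt e = wt e'" for e e'
    using mon that by (cases e; cases e') (auto simp: m_def)
  let ?g = "mk4 (\<lambda>e. if wt e = n then coeff4 f e else 0)"
  show "?g \<in> generated_by N p"
  proof (cases "\<exists>e. wt e = n")
    case False
    then have "wt e \<noteq> n" for e by blast
    then have "?g = 0" by (intro fps4_eqI) simp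
    then show ?thesis by (simp add: generated_by_0)
  next
    case True
    then obtain e0 where e0: "wt e0 = n" by blast
    have "(\<Sum>e | wt e = n. coeff4 f e) = 0"
      using f phi_nth[of f n] by (simp add: mem_P)
    moreover have "?g = (\<Sum>e | wt e = n. const4 (coeff4 f e) * m e)"
    proof (rule fps4_eqI)
      fix e
      have "coeff4 (\<Sum>e | wt e = n. const4 (coeff4 f e) * m e) e = (\<Sum>e' | wt e' = n. if e' = e then coeff4 f e' else 0)"
        unfolding coeff4_sum coeff4_const4_mult cm by (intro sum.cong) auto
      also have "\<dots> = (if wt e = n then coeff4 f e else 0)"
        using finite_wt[of n] by (simp add: sum.delta)
      finally show "coeff4 ?g e = coeff4 (\<Sum>e | wt e = n. const4 (coeff4 f e) * m e) e" by simp
    qed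
    moreover have "(\<Sum>e | wt e = n. const4 (coeff4 f e) * m e0) = const4 (\<Sum>e | wt e = n. coeff4 f e) * m e0"
      by (rule fps4_eqI) (simp only: coeff4_sum coeff4_const4_mult sum_distrib_right)
    ultimately have "?g = (\<Sum>e | wt e = n. const4 (coeff4 f e) * (m e - m e0))"
      by (simp add: right_diff_distrib sum_subtractf)
    then show ?thesis
      using e0 by (auto intro!: generated_by_sum generated_by_closed(2) mm)
  qed
qed

text \<open>The first three are the 2 by 2 minors of the matrix with rows \<open>(x, y, z)\<close>
  and \<open>(y, z, w)\<close>. The other two exchange \<open>a\<close> steps of length
  \<open>r\<close> for \<open>r\<close> factors \<open>x\<close>. For \<open>a = 3 k + 2\<close>
  they are the 4 by 4 Pfaffians of a skew 5 by 5 matrix.\<close>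

definition pfaffian :: "nat \<Rightarrow> nat \<Rightarrow> 'k::field fps4" where
  "pfaffian k i = [var_x * var_z - var_y ^ 2, var_x * var_w - var_y * var_z, var_y * var_w - var_z ^ 2,
     var_w ^ k * var_z - var_x ^ (k + r + 1), var_w ^ (k + 1) - var_x ^ (k + r) * var_y] ! i"

lemma pfaffian_simps:
  "pfaffian k 0 = var_x * var_z - var_y ^ 2" "pfaffian k 1 = var_x * var_w - var_y * var_z"
  "pfaffian k 2 = var_y * var_w - var_z ^ 2" "pfaffian k 3 = var_w ^ k * var_z - var_x ^ (k + r + 1)"
  "pfaffian k 4 = var_w ^ (k + 1) - var_x ^ (k + r) * var_y"
  by (simp_all add: pfaffian_def eval_nat_numeral del: power_Suc)

lemma pfaffian_monom:
  "pfaffian k 0 = monom4 1 0 1 0 - monom4 0 2 0 0" "pfaffian k 1 = monom4 1 0 0 1 - monom4 0 1 1 0"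
  "pfaffian k 2 = monom4 0 1 0 1 - monom4 0 0 2 0" "pfaffian k 3 = monom4 0 0 1 k - monom4 (k + r + 1) 0 0 0"
  "pfaffian k 4 = monom4 0 0 0 (k + 1) - monom4 (k + r) 1 0 0"
  unfolding pfaffian_simps monom4_def by (simp_all only: power_0 power_one_right mult_1_left mult_1_right mult.commute)

lemma less_5: "i < (5::nat) \<longleftrightarrow> i = 0 \<or> i = 1 \<or> i = 2 \<or> i = 3 \<or> i = 4"
  by auto

lemma pfaffian_wt:
  assumes a: "a = 3 * k + 2"
  shows "\<exists>d. \<forall>i<5. \<forall>e. coeff4 (pfaffian k i :: 'k::field fps4) e \<noteq> 0 \<longrightarrow> wt e = d i"
proof -
  have 1: "wt (1, 0, 1, 0) = wt (0, 2, 0, 0)" "wt (1, 0, 0, 1) = wt (0, 1, 1, 0)" "wt (0, 1, 0, 1) = wt (0, 0, 2, 0)"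
    by (simp_all add: wt_def)
  have 2: "wt (0, 0, 1, k) = wt (k + r + 1, 0, 0, 0)" "wt (0, 0, 0, k + 1) = wt (k + r, 1, 0, 0)"
    unfolding wt_def prod.case using a by (simp_all add: algebra_simps)
  have b: "wt e = wt (i', j', k', l')"
    if "coeff4 (monom4 i j k l - monom4 i' j' k' l' :: 'k fps4) e \<noteq> 0" "wt (i, j, k, l) = wt (i', j', k', l')"
    for e i j k l i' j' k' l'
    using that by (auto simp: coeff4_diff coeff4_monom4 split: if_splits)
  show ?thesis
    using b[OF _ 1(1)] b[OF _ 1(2)] b[OF _ 1(3)] b[OF _ 2(1)] b[OF _ 2(2)]
    by (intro exI[of _ "\<lambda>i. [wt (0, 2, 0, 0), wt (0, 1, 1, 0), wt (0, 0, 2, 0), wt (k + r + 1, 0, 0, 0), wt (k + r, 1, 0, 0)] ! i"])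
       (auto simp: less_5 pfaffian_monom simp del: One_nat_def)
qed

lemma monom4_mult: "monom4 i j k l * monom4 i' j' k' l' = monom4 (i + i') (j + j') (k + k') (l + l')"
  by (simp only: monom4_def power_add mult_ac)

text \<open>The bound \<open>j' + 2 k' + 3 l' < a\<close> says that the weight is in the normal form \<open>N a + I r\<close> with \<open>I < a\<close>.\<close>

lemma monom4_reduce:
  assumes a: "a = 3 * k + 2" "k > 0"
  shows "\<exists>i' j' k' l'. j' + k' \<le> 1 \<and> j' + 2 * k' + 3 * l' < a \<and> wt (e1, e2, e3, e4) = wt (i', j', k', l') \<and>
    monom4 e1 e2 e3 e4 - monom4 i' j' k' l' \<in> generated_by 5 (pfaffian k :: nat \<Rightarrow> 'k::field fps4)"
  (is "?A e1 e2 e3 e4")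
\<comment> \<open>With these weights the replacement of \<open>y^2\<close> by \<open>x z\<close>
  lowers the measure from 4 to 3 and that of \<open>z^2\<close> by \<open>y w\<close> from 6 to 5;
  \<open>x\<close> is free, so the other three replacements lower it too.\<close>
proof (induction "2 * e2 + 3 * e3 + 3 * e4" arbitrary: e1 e2 e3 e4 rule: less_induct)
  case less
  let ?I = "generated_by 5 (pfaffian k :: nat \<Rightarrow> 'k fps4)"
  have step: "?A e1 e2 e3 e4"
    if "2 * f2 + 3 * f3 + 3 * f4 < 2 * e2 + 3 * e3 + 3 * e4" "wt (e1, e2, e3, e4) = wt (f1, f2, f3, f4)"
      "monom4 e1 e2 e3 e4 - monom4 f1 f2 f3 f4 \<in> ?I" for f1 f2 f3 f4
  proof -
    from less[OF that(1), of f1] obtain i' j' k' l' where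
      "j' + k' \<le> 1" "j' + 2 * k' + 3 * l' < a" "wt (f1, f2, f3, f4) = wt (i', j', k', l')"
      "monom4 f1 f2 f3 f4 - monom4 i' j' k' l' \<in> ?I" by blast
    then show ?thesis
      using that(2) generated_by_diff_trans[OF that(3), of "monom4 i' j' k' l'"]
      by (intro exI[of _ i'] exI[of _ j'] exI[of _ k'] exI[of _ l']) simp
  qed
  have gen: "monom4 i1 i2 i3 i4 * pfaffian k i \<in> ?I" if "i < 5" for i i1 i2 i3 i4
    by (intro generated_by_closed(2) generated_by_gen that)
  consider "e2 \<ge> 2" | "e2 \<ge> 1" "e3 \<ge> 1" | "e3 \<ge> 2" | "e2 + e3 \<le> 1" "e3 \<ge> 1" "e4 \<ge> k" | "e2 + e3 \<le> 1" "e4 \<ge> k + 1"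
    | "e2 + e3 \<le> 1" "e2 + 2 * e3 + 3 * e4 < a"
    using a by linarith
  then show ?case
  proof cases
    case 1
    then obtain m where m: "e2 = m + 2" by (metis le_add_diff_inverse2)
    have "monom4 (e1 + 1) m (e3 + 1) e4 - monom4 e1 e2 e3 e4 \<in> ?I"
      using gen[of 0 e1 m e3 e4] unfolding pfaffian_monom right_diff_distrib monom4_mult by (simp add: m)
    from generated_by_diff_sym[OF this] show ?thesis by (intro step[of m "e3 + 1" e4 "e1 + 1"]) (simp_all add: m wt_def algebra_simps)
  next
    case 2
    then have "e2 = (e2 - 1) + 1" "e3 = (e3 - 1) + 1" by simp_all
    then obtain m n where m: "e2 = m + 1" "e3 = n + 1" by blast
    have "monom4 (e1 + 1) m n (e4 + 1) - monom4 e1 e2 e3 e4 \<in> ?I"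
      using gen[of 1 e1 m n e4] unfolding pfaffian_monom right_diff_distrib monom4_mult by (simp add: m)
    from generated_by_diff_sym[OF this] show ?thesis by (intro step[of m n "e4 + 1" "e1 + 1"]) (simp_all add: m wt_def algebra_simps)
  next
    case 3
    then obtain m where m: "e3 = m + 2" by (metis le_add_diff_inverse2)
    have "monom4 e1 (e2 + 1) m (e4 + 1) - monom4 e1 e2 e3 e4 \<in> ?I"
      using gen[of 2 e1 e2 m e4] unfolding pfaffian_monom right_diff_distrib monom4_mult by (simp add: m)
    from generated_by_diff_sym[OF this] show ?thesis by (intro step[of "e2 + 1" m "e4 + 1" e1]) (simp_all add: m wt_def algebra_simps)
  next
    case 4
    then have "e3 = (e3 - 1) + 1" "e4 = (e4 - k) + k" by simp_all
    then obtain m n where m: "e3 = m + 1" "e4 = n + k" by blast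
    have "wt (e1, e2, e3, e4) = wt (e1 + (k + r + 1), e2, m, n)"
      unfolding wt_def prod.case m using a by (simp add: algebra_simps)
    moreover
    have "monom4 e1 e2 e3 e4 - monom4 (e1 + (k + r + 1)) e2 m n \<in> ?I"
      using gen[of 3 e1 e2 m n] unfolding pfaffian_monom right_diff_distrib monom4_mult by (simp add: m)
    ultimately show ?thesis by (intro step[of e2 m n "e1 + (k + r + 1)"]) (simp_all add: m)
  next
    case 5
    then obtain n where m: "e4 = n + (k + 1)" by (metis le_add_diff_inverse2)
    have "wt (e1, e2, e3, e4) = wt (e1 + (k + r), e2 + 1, e3, n)"
      unfolding wt_def prod.case m using a by (simp add: algebra_simps)
    moreover
    have "monom4 e1 e2 e3 e4 - monom4 (e1 + (k + r)) (e2 + 1) e3 n \<in> ?I"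
      using gen[of 4 e1 e2 e3 n] unfolding pfaffian_monom right_diff_distrib monom4_mult by (simp add: m)
    ultimately show ?thesis by (intro step[of "e2 + 1" e3 n "e1 + (k + r)"]) (simp_all add: m)
  next
    case 6
    have "monom4 e1 e2 e3 e4 - monom4 e1 e2 e3 e4 \<in> ?I" by (simp add: generated_by_0)
    with 6 show ?thesis by blast
  qed
qed

lemma normal_monom_unique:
  assumes "j + k \<le> 1" "j + 2 * k + 3 * l < a" "j' + k' \<le> 1" "j' + 2 * k' + 3 * l' < a"
    and w: "wt (i, j, k, l) = wt (i', j', k', l')"
  shows "i = i' \<and> j = j' \<and> k = k' \<and> l = l'"
proof -
  from w have "int (wt (i, j, k, l)) = int (wt (i', j', k', l'))" by simp
  from same_weight[OF this[unfolded int_wt]] obtain s where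
    s: "int (j' + 2 * k' + 3 * l') = int (j + 2 * k + 3 * l) + s * int a" "int (i + j + k + l) = int (i' + j' + k' + l') + s * int r" .
  have "s = 0"
  proof (rule ccontr)
    assume "s \<noteq> 0"
    then consider "s \<le> -1" | "s \<ge> 1" by linarith
    then show False
    proof cases
      case 1
      then have "s * int a \<le> (-1) * int a" by (intro mult_right_mono) auto
      with s assms show False by linarith
    next
      case 2
      then have "1 * int a \<le> s * int a" by (intro mult_right_mono; simp)
      with s assms show False by linarith
    qed
  qed
  with s have s: "j' + 2 * k' + 3 * l' = j + 2 * k + 3 * l" "i + j + k + l = i' + j' + k' + l'" by simp_all
  moreover have "j + 2 * k < 3" "j' + 2 * k' < 3" using assms(1,3) by linarith+
  ultimately have l: "l = l'" by linarith
  with s(1) have "j' + 2 * k' = j + 2 * k" by simp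
  then have jk: "j' + k' + k' = j + k + k" by linarith
  have "k = k'"
  proof (cases "k = 0 \<or> k' = 0")
    case True
    then show ?thesis using jk assms(1,3) by linarith
  next
    case False
    then have "k = 1" "k' = 1" using assms(1,3) by linarith+
    then show ?thesis by (rule trans[OF _ sym])
  qed
  moreover from this have "j = j'" using jk by linarith
  ultimately show ?thesis using s(2) l by linarith
qed

lemma P_generated_by_pfaffians:
  fixes f :: "'k::field fps4"
  assumes a: "a = 3 * k + 2" "k > 0" and f: "f \<in> P"
  shows "f \<in> generated_by 5 (pfaffian k)"
proof -
  obtain d where d: "\<And>i e. i < 5 \<Longrightarrow> coeff4 (pfaffian k i :: 'k fps4) e \<noteq> 0 \<Longrightarrow> wt e = d i"
    using pfaffian_wt[OF a(1)] by metis
  show ?thesis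
  proof (rule P_generated_by[OF f d])
    fix i j m l i' j' m' l' assume w: "wt (i, j, m, l) = wt (i', j', m', l')"
    obtain e1 e2 e3 e4 where e: "e2 + e3 \<le> 1" "e2 + 2 * e3 + 3 * e4 < a" "wt (i, j, m, l) = wt (e1, e2, e3, e4)"
      "monom4 i j m l - monom4 e1 e2 e3 e4 \<in> generated_by 5 (pfaffian k :: nat \<Rightarrow> 'k fps4)"
      using monom4_reduce[OF a, of i j m l] by blast
    obtain f1 f2 f3 f4 where f: "f2 + f3 \<le> 1" "f2 + 2 * f3 + 3 * f4 < a" "wt (i', j', m', l') = wt (f1, f2, f3, f4)"
      "monom4 i' j' m' l' - monom4 f1 f2 f3 f4 \<in> generated_by 5 (pfaffian k :: nat \<Rightarrow> 'k fps4)"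
      using monom4_reduce[OF a, of i' j' m' l'] by blast
    have "e1 = f1 \<and> e2 = f2 \<and> e3 = f3 \<and> e4 = f4"
      using normal_monom_unique[OF e(1,2) f(1,2)] w e(3) f(3) by simp
    then show "monom4 i j m l - monom4 i' j' m' l' \<in> generated_by 5 (pfaffian k :: nat \<Rightarrow> 'k fps4)"
      using generated_by_diff_trans[OF e(4)] generated_by_diff_sym[OF f(4)] by simp
  qed
qed

end


section \<open>Derivations and the symbolic square\<close>

definition derivation :: "('a::comm_ring_1 \<Rightarrow> 'a) \<Rightarrow> bool" where
  "derivation D \<longleftrightarrow> (\<forall>f g. D (f + g) = D f + D g) \<and> (\<forall>f g. D (f * g) = f * D g + D f * g)"

lemma derivation_add: "derivation D \<Longrightarrow> D (f + g) = D f + D g"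
  and derivation_mult: "derivation D \<Longrightarrow> D (f * g) = f * D g + D f * g"
  by (simp_all add: derivation_def)

lemma derivation_0: "derivation D \<Longrightarrow> D 0 = 0"
  using derivation_add[of D 0 0] by simp

lemma derivation_1: "derivation D \<Longrightarrow> D 1 = 0"
  using derivation_mult[of D 1 1] by simp

lemma derivation_diff: "derivation D \<Longrightarrow> D (f - g) = D f - D g"
  using derivation_add[of D "f - g" g] by simp

lemma derivation_sum: "derivation D \<Longrightarrow> D (\<Sum>i\<in>A. f i) = (\<Sum>i\<in>A. D (f i))"
  by (induction A rule: infinite_finite_induct) (simp_all add: derivation_0 derivation_add)

lemma derivation_power: "derivation D \<Longrightarrow> D (f ^ n) = of_nat n * f ^ (n - 1) * D f"
proof (induction n)
  case (Suc n)
  then show ?case by (cases n) (simp_all add: derivation_mult algebra_simps)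
qed (simp add: derivation_1)

lemma derivation_fps_deriv: "derivation (fps_deriv :: 'a::comm_ring_1 fps \<Rightarrow> 'a fps)"
  by (simp add: derivation_def)

text \<open>In the iterated power series ring a partial derivative by an inner variable is
  \<open>fps_deriv\<close> applied through the outer layers; \<open>x\<close>, the innermost
  variable, takes three of them.\<close>

definition coeffwise :: "('a::comm_ring_1 \<Rightarrow> 'a) \<Rightarrow> 'a fps \<Rightarrow> 'a fps" where
  "coeffwise D f = Abs_fps (\<lambda>n. D (f $ n))"

lemma derivation_coeffwise:
  assumes D: "derivation D"
  shows "derivation (coeffwise D)"
  unfolding derivation_def coeffwise_def
  by (intro conjI allI fps_ext)
    (simp_all add: fps_mult_nth derivation_add[OF D] derivation_sum[OF D] derivation_mult[OF D] sum.distrib)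

lemma coeffwise_const: "derivation D \<Longrightarrow> coeffwise D (fps_const c) = fps_const (D c)"
  by (rule fps_ext) (simp add: coeffwise_def derivation_0)

lemma coeffwise_X: "derivation D \<Longrightarrow> coeffwise D fps_X = 0"
  by (rule fps_ext) (simp add: coeffwise_def derivation_0 derivation_1 fps_X_def)

lemma partial_derivs:
  obtains Dx Dy Dz Dw :: "'k::field fps4 \<Rightarrow> 'k fps4"
  where "derivation Dx" "derivation Dy" "derivation Dz" "derivation Dw"
    "Dx var_x = 1" "Dx var_y = 0" "Dx var_z = 0" "Dx var_w = 0"
    "Dy var_x = 0" "Dy var_y = 1" "Dy var_z = 0" "Dy var_w = 0"
    "Dz var_x = 0" "Dz var_y = 0" "Dz var_z = 1" "Dz var_w = 0"
    "Dw var_x = 0" "Dw var_y = 0" "Dw var_z = 0" "Dw var_w = 1"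
proof (rule that[of "coeffwise (coeffwise (coeffwise fps_deriv))" "coeffwise (coeffwise fps_deriv)"
      "coeffwise fps_deriv" fps_deriv])
qed (simp_all add: coeffwise_const coeffwise_X derivation_coeffwise derivation_fps_deriv)

lemma sum_5: "(\<Sum>i<5. f i) = f 0 + f 1 + f 2 + f 3 + f (4::nat)"
  by (simp add: eval_nat_numeral)

lemma supp_union_split:
  fixes f :: "'k::field fps" and m n :: nat
  assumes "\<And>i. f $ i \<noteq> 0 \<Longrightarrow> int i - int m \<in> arith_semigroup a r \<or> int i - int n \<in> arith_semigroup a r"
  obtains g h where "f = fps_X ^ m * g + fps_X ^ n * h"
    "\<forall>i. g $ i \<noteq> 0 \<longrightarrow> int i \<in> arith_semigroup a r" "\<forall>i. h $ i \<noteq> 0 \<longrightarrow> int i \<in> arith_semigroup a r"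
proof -
  let ?H = "arith_semigroup a r"
  define g where "g = Abs_fps (\<lambda>i. if int i \<in> ?H then f $ (i + m) else 0)"
  \<comment> \<open>Terms that fit both shifts are given to \<open>g\<close>, so that nothing is
    counted twice.\<close>
  define h where "h = Abs_fps (\<lambda>i. if int i \<in> ?H \<and> int i + int n - int m \<notin> ?H then f $ (i + n) else 0)"
  have "f = fps_X ^ m * g + fps_X ^ n * h"
  proof (rule fps_ext)
    fix i
    have m: "int (i - m) \<in> ?H \<and> m \<le> i \<longleftrightarrow> int i - int m \<in> ?H"
      using arith_semigroup_nonneg[of "int i - int m" a r] by (cases "m \<le> i") (auto simp: of_nat_diff)
    have n: "int (i - n) \<in> ?H \<and> n \<le> i \<longleftrightarrow> int i - int n \<in> ?H"
      using arith_semigroup_nonneg[of "int i - int n" a r] by (cases "n \<le> i") (auto simp: of_nat_diff)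
    have "(fps_X ^ m * g) $ i = (if int i - int m \<in> ?H then f $ i else 0)"
      unfolding m[symmetric] by (simp add: fps_X_power_mult_nth g_def)
    moreover have "(fps_X ^ n * h) $ i = (if int i - int n \<in> ?H \<and> int i - int m \<notin> ?H then f $ i else 0)"
      unfolding n[symmetric] by (auto simp add: fps_X_power_mult_nth h_def of_nat_diff)
    ultimately show "f $ i = (fps_X ^ m * g + fps_X ^ n * h) $ i"
      using assms[of i] by (auto simp: fps_add_nth)
  qed
  then show thesis by (rule that) (auto simp: g_def h_def)
qed

context arith_pair
begin

lemma phi_of_nat: "\<phi> (of_nat n :: 'k::field fps4) = of_nat n"
  by (induction n) simp_all

lemma one_notin_P: "1 \<notin> P"
  by (simp add: mem_P)

text \<open>By the Leibniz rule a derivation maps the square of \<open>P\<close> into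
  \<open>P\<close>. In the expansion of \<open>D (s f)\<close> the term with \<open>D s\<close>
  vanishes modulo \<open>P\<close>, and \<open>\<phi> s\<close> can be cancelled in
  \<open>F[[t]]\<close>.\<close>

lemma symbolic_power_2_derivs:
  fixes f :: "'k::field fps4"
  assumes f: "f \<in> symbolic_power ring_of_type_algebra P 2"
  shows "\<phi> f = 0" "derivation D \<Longrightarrow> \<phi> (D f) = 0"
proof -
  from f obtain s where s: "\<phi> s \<noteq> 0" "s * f \<in> P [^]\<^bsub>ideals_set ring_of_type_algebra\<^esub> (2::nat)"
    unfolding symbolic_power_def by (auto simp: mem_P)
  have "\<phi> (s * f) = 0"
    using s(2) by (rule ideal_power_2_induct[OF refl ideal_P]) (auto simp: mem_P)
  with s(1) show f0: "\<phi> f = 0" by simp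
  assume D: "derivation D"
  have "\<phi> (D (s * f)) = 0"
    using s(2) by (rule ideal_power_2_induct[OF refl ideal_P]) (auto simp: mem_P derivation_add[OF D] derivation_mult[OF D])
  with s(1) f0 show "\<phi> (D f) = 0" by (simp add: derivation_mult[OF D])
qed

text \<open>In terms of \<open>T = t^r\<close> the variables map to \<open>x\<close>, \<open>x T\<close>, \<open>x T\<^sup>2\<close>, \<open>x T\<^sup>3\<close>, and \<open>w^k\<close>, \<open>x^(k + r)\<close> to \<open>W\<close>, \<open>W T\<^sup>2\<close>.
  In every characteristic the equations kill the deviation from the kernel, since they yield
  \<open>a C = 0\<close> and \<open>(a + r) C = 0\<close> for it.\<close>

lemma jacobian_kernel:
  fixes x T W :: "'k::field fps"
  assumes nz: "x \<noteq> 0" "T \<noteq> 0" "W \<noteq> 0" and a: "a = 3 * k + 2"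
    and dx: "x * T^2 * G0 + x * T^3 * G1 - of_nat (k + r + 1) * (W * T^2) * G3 - of_nat (k + r) * (W * T^2 * T) * G4 = 0"
    and dy: "- (2 * (x * T) * G0) - x * T^2 * G1 + x * T^3 * G2 - W * T^2 * G4 = 0"
    and dz: "x * G0 - x * T * G1 - 2 * (x * T^2) * G2 + W * G3 = 0"
    and dw: "x * T * G1 + x * T * T * G2 + of_nat k * W * G3 + of_nat (k + 1) * W * T * G4 = 0"
  shows "G0 = T^2 * G2" "G3 = - (T * G4)" "x * G1 = - (x * T * G2) - W * G4"
proof -
  define g0 where "g0 = G0 - T^2 * G2"
  define g3 where "g3 = G3 + T * G4"
  define u where "u = x * G1 + x * T * G2 + W * G4"
  \<comment> \<open>Rescaled in this way, the four equations become linear in \<open>A\<close>,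
    \<open>B\<close>, \<open>C\<close> with integer coefficients.\<close>
  define A where "A = x * g0"
  define B where "B = T * u"
  define C where "C = W * g3"
  have "T^2 * (A + B - of_nat (k + r + 1) * C) = 0"
    using dx unfolding A_def B_def C_def g0_def g3_def u_def
    by (simp add: algebra_simps power2_eq_square power3_eq_cube)
  then have 1: "A + B - of_nat (k + r + 1) * C = 0" using nz by simp
  have "T * (- 2 * A - B) = 0"
    using dy unfolding A_def B_def C_def g0_def g3_def u_def
    by (simp add: algebra_simps power2_eq_square power3_eq_cube)
  then have 2: "- 2 * A - B = 0" using nz by simp
  have 3: "A - B + C = 0"
    using dz unfolding A_def B_def C_def g0_def g3_def u_def
    by (simp add: algebra_simps power2_eq_square power3_eq_cube)
  have 4: "B + of_nat k * C = 0"
    using dw unfolding A_def B_def C_def g0_def g3_def u_def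
    by (simp add: algebra_simps power2_eq_square power3_eq_cube)
  have B: "B = - (of_nat k * C)" using 4 by (simp add: eq_neg_iff_add_eq_0)
  have A: "A = - (of_nat k * C) - C" using 3 unfolding B by (simp add: algebra_simps eq_neg_iff_add_eq_0)
  have "of_nat a * C = 0"
    using 2 unfolding A B a by (simp add: algebra_simps)
  moreover have "of_nat (a + r) * C = 0"
    using 1 unfolding A B a by (simp add: algebra_simps add_eq_0_iff)
  ultimately have ar: "of_nat a * C = 0" "of_nat r * C = 0"
    by (simp_all only: of_nat_add distrib_right add_0_left)
  obtain p q where pq: "p * int a + q * int r = 1"
    using coprime by (metis bezout_int coprime_iff_gcd_eq_1 coprime_int_iff)
  have "C = of_int (p * int a + q * int r) * C" by (simp only: pq of_int_1 mult_1_left)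
  also have "\<dots> = of_int p * (of_nat a * C) + of_int q * (of_nat r * C)"
    by (simp add: algebra_simps)
  finally have C: "C = 0" using ar by simp
  then have "B = 0" "A = 0" using A B by simp_all
  with C nz have "g0 = 0" "g3 = 0" "u = 0" by (simp_all add: A_def B_def C_def)
  then show "G0 = T^2 * G2" "G3 = - (T * G4)" "x * G1 = - (x * T * G2) - W * G4"
    by (simp_all add: g0_def g3_def u_def eq_neg_iff_add_eq_0 algebra_simps)
qed

text \<open>A kernel element of the Jacobian is determined by \<open>\<alpha> = G\<^sub>2\<close> and \<open>\<beta> = - G\<^sub>4\<close>, and the five Pfaffian
  syzygies are the pairs \<open>(x, 0)\<close>, \<open>(y, 0)\<close>, \<open>(0, x)\<close>, \<open>(0, z)\<close> and \<open>(w^k, y)\<close>.\<close>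

lemma syzygy_combination:
  fixes G1 \<alpha> \<beta> :: "'k::field fps"
  assumes a: "a = 3 * k + 2" "k > 0"
    and \<alpha>: "\<And>n. \<alpha> $ n \<noteq> 0 \<Longrightarrow> int n \<in> H" "\<And>n. (fps_X ^ (2 * r) * \<alpha>) $ n \<noteq> 0 \<Longrightarrow> int n \<in> H"
    and \<beta>: "\<And>n. \<beta> $ n \<noteq> 0 \<Longrightarrow> int n \<in> H" "\<And>n. (fps_X ^ r * \<beta>) $ n \<noteq> 0 \<Longrightarrow> int n \<in> H"
    and G1: "\<And>n. G1 $ n \<noteq> 0 \<Longrightarrow> int n \<in> H" "fps_X ^ a * G1 = fps_X ^ (k * (a + 3 * r)) * \<beta> - fps_X ^ (a + r) * \<alpha>"
  obtains q0 q1 q2 q3 c :: "'k fps4" where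
    "\<alpha> = \<phi> (q0 * var_x + q1 * var_y + c * var_w ^ k)"
    "\<beta> = \<phi> (q2 * var_x + q3 * var_z + c * var_y)"
proof -
  let ?\<kappa> = "k * (a + 3 * r)"
  define c where "c = \<alpha> $ ?\<kappa>"
  \<comment> \<open>The relation for \<open>x G1\<close> is read at \<open>a\<close> plus the
    Frobenius number, where the left side vanishes. This ties the two exceptional coefficients
    together: \<open>\<alpha>\<close> at the weight of \<open>w^k\<close> equals
    \<open>\<beta>\<close> at the weight of \<open>y\<close>, so one multiple of the syzygy
    \<open>(w^k, y)\<close> removes both.\<close>
  have "(fps_X ^ a * G1) $ (?\<kappa> + r + a) = 0"
  proof -
    have "int (?\<kappa> + r) \<notin> H" using frobenius_gap[OF a(1)] by (simp add: algebra_simps)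
    then have "G1 $ (?\<kappa> + r) = 0" using G1(1) by blast
    then show ?thesis by (simp add: fps_X_power_mult_nth)
  qed
  then have c: "\<beta> $ (a + r) = c"
    unfolding G1(2) by (simp add: fps_X_power_mult_nth c_def add.assoc add.commute[of r a])
  define \<alpha>' where "\<alpha>' = \<alpha> - fps_const c * fps_X ^ ?\<kappa>"
  define \<beta>' where "\<beta>' = \<beta> - fps_const c * fps_X ^ (a + r)"
  have "int n - int a \<in> H \<or> int n - int (a + r) \<in> H" if "\<alpha>' $ n \<noteq> 0" for n
  proof -
    have "n \<noteq> ?\<kappa>" using that by (auto simp: \<alpha>'_def c_def)
    with that have "\<alpha> $ n \<noteq> 0" by (simp add: \<alpha>'_def)
    then have "int n \<in> H" "int n + 2 * int r \<in> H"
      using \<alpha>(1)[of n] \<alpha>(2)[of "n + 2 * r"] by (simp_all add: fps_X_power_mult_nth)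
    from shift_two[OF a this] \<open>n \<noteq> ?\<kappa>\<close> show ?thesis
      by (metis (mono_tags, lifting) of_nat_add of_nat_mult of_nat_numeral of_nat_eq_iff diff_diff_eq)
  qed
  then obtain Q0 Q1 where Q: "\<alpha>' = fps_X ^ a * Q0 + fps_X ^ (a + r) * Q1"
    "\<forall>i. Q0 $ i \<noteq> 0 \<longrightarrow> int i \<in> H" "\<forall>i. Q1 $ i \<noteq> 0 \<longrightarrow> int i \<in> H"
    by (rule supp_union_split)
  have "int n - int a \<in> H \<or> int n - int (a + 2 * r) \<in> H" if "\<beta>' $ n \<noteq> 0" for n
  proof -
    have "n \<noteq> a + r" using that by (auto simp: \<beta>'_def c)
    with that have "\<beta> $ n \<noteq> 0" by (simp add: \<beta>'_def)
    then have "int n \<in> H" "int n + int r \<in> H"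
      using \<beta>(1)[of n] \<beta>(2)[of "n + r"] by (simp_all add: fps_X_power_mult_nth)
    from shift_one[OF a this] \<open>n \<noteq> a + r\<close> show ?thesis
      by (metis (mono_tags, lifting) of_nat_add of_nat_mult of_nat_numeral of_nat_eq_iff diff_diff_eq)
  qed
  then obtain Q2 Q3 where Q': "\<beta>' = fps_X ^ a * Q2 + fps_X ^ (a + 2 * r) * Q3"
    "\<forall>i. Q2 $ i \<noteq> 0 \<longrightarrow> int i \<in> H" "\<forall>i. Q3 $ i \<noteq> 0 \<longrightarrow> int i \<in> H"
    by (rule supp_union_split)
  have "\<exists>q. \<phi> q = Q" if "\<forall>i. Q $ i \<noteq> 0 \<longrightarrow> int i \<in> H" for Q :: "'k fps"
  proof -
    have "Q \<in> range \<phi>" unfolding range_phi using that by blast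
    then show ?thesis by blast
  qed
  then obtain q0 q1 q2 q3 where q: "\<phi> q0 = Q0" "\<phi> q1 = Q1" "\<phi> q2 = Q2" "\<phi> q3 = Q3"
    using Q Q' by metis
  show thesis
  proof (rule that[of q0 q1 "const4 c" q2 q3])
    show "\<alpha> = \<phi> (q0 * var_x + q1 * var_y + const4 c * var_w ^ k)"
      unfolding phi_simps phi_power phi_const q power_mult[symmetric]
      using Q(1) by (simp add: \<alpha>'_def algebra_simps)
    show "\<beta> = \<phi> (q2 * var_x + q3 * var_z + const4 c * var_y)"
      unfolding phi_simps phi_power phi_const q
      using Q'(1) by (simp add: \<beta>'_def algebra_simps)
  qed
qed

text \<open>This is the injectivity of the conormal map from \<open>P\<close> modulo its square to
  \<open>A^4\<close>, given by the gradient.\<close>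

lemma conormal_injective:
  fixes f :: "'k::field fps4"
  assumes a: "a = 3 * k + 2" "k > 0" and f: "\<phi> f = 0" and df: "\<And>D. derivation D \<Longrightarrow> \<phi> (D f) = 0"
  shows "f \<in> P [^]\<^bsub>ideals_set ring_of_type_algebra\<^esub> (2::nat)"
proof -
  define x y z w :: "'k fps4" where "x = var_x" and "y = var_y" and "z = var_z" and "w = var_w"
  define p where "p i = (pfaffian k i :: 'k fps4)" for i
  have \<phi>v: "\<phi> x = fps_X ^ a" "\<phi> y = fps_X ^ (a + r)" "\<phi> z = fps_X ^ (a + 2 * r)" "\<phi> w = fps_X ^ (a + 3 * r)"
    by (simp_all add: x_def y_def z_def w_def)
  have pd: "p 0 = x * z - y ^ 2" "p 1 = x * w - y * z" "p 2 = y * w - z ^ 2"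
    "p 3 = w ^ k * z - x ^ (k + r + 1)" "p 4 = w ^ (k + 1) - x ^ (k + r) * y"
    by (simp_all only: p_def pfaffian_simps x_def y_def z_def w_def)
  from f have "f \<in> P" by (simp add: mem_P)
  then obtain g :: "nat \<Rightarrow> 'k fps4" where g: "f = g 0 * p 0 + g 1 * p 1 + g 2 * p 2 + g 3 * p 3 + g 4 * p 4"
    using P_generated_by_pfaffians[OF a] unfolding generated_by_def sum_5 p_def by blast
  define T :: "'k fps" where "T = fps_X ^ r"
  define X0 :: "'k fps" where "X0 = fps_X ^ a"
  define W :: "'k fps" where "W = fps_X ^ (k * (a + 3 * r))"
  have v: "\<phi> x = X0" "\<phi> y = X0 * T" "\<phi> z = X0 * T ^ 2" "\<phi> w = X0 * T ^ 3"
    unfolding \<phi>v X0_def T_def power_mult[symmetric] power_add[symmetric] by (simp_all add: mult.commute)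
  have Wk: "\<phi> w ^ k = W" unfolding \<phi>v W_def power_mult[symmetric] by (simp add: mult.commute)
  have "a * (k + r) = k * (a + 3 * r) + r * 2" using a by (simp add: algebra_simps)
  then have Xk: "\<phi> x ^ (k + r) = W * T ^ 2"
    unfolding \<phi>v W_def T_def power_mult[symmetric] power_add[symmetric] by simp
  obtain m where m: "k = Suc m" using a by (cases k) auto
  have Wm: "\<phi> w ^ m * (X0 * T ^ 3) = W" using Wk m v by (simp add: mult.commute)
  have Xm: "\<phi> x ^ (m + r) * X0 = W * T ^ 2" using Xk m v by (simp add: mult.commute)
  have \<phi>p: "\<phi> (p i) = 0" if "i < 5" for i
  proof -
    have "\<phi> x ^ (k + r + 1) = X0 * (W * T ^ 2)" "\<phi> w ^ (k + 1) = X0 * T ^ 3 * W"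
      using Xk Wk v by (simp_all)
    then show ?thesis
      using that Xk Wk unfolding less_5
      by (auto simp only: pd phi_diff phi_simps phi_power v) (simp_all add: algebra_simps power2_eq_square power3_eq_cube)
  qed
  define G where "G i = \<phi> (g i)" for i
  have D: "G 0 * \<phi> (D (p 0)) + G 1 * \<phi> (D (p 1)) + G 2 * \<phi> (D (p 2)) + G 3 * \<phi> (D (p 3)) + G 4 * \<phi> (D (p 4)) = 0"
    if "derivation D" for D
  proof -
    have p0: "\<phi> (p 0) = 0" "\<phi> (p 1) = 0" "\<phi> (p 2) = 0" "\<phi> (p 3) = 0" "\<phi> (p 4) = 0"
      by (simp_all only: \<phi>p less_5 simp_thms)
    have "\<phi> (D f) = G 0 * \<phi> (D (p 0)) + G 1 * \<phi> (D (p 1)) + G 2 * \<phi> (D (p 2)) + G 3 * \<phi> (D (p 3)) + G 4 * \<phi> (D (p 4))"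
      unfolding g derivation_add[OF that] derivation_mult[OF that] phi_simps(1,2) p0 G_def by simp
    with df[OF that] show ?thesis by simp
  qed
  obtain Dx Dy Dz Dw where der: "derivation Dx" "derivation Dy" "derivation Dz" "derivation Dw"
    and Dv: "Dx x = 1" "Dx y = 0" "Dx z = 0" "Dx w = 0" "Dy x = 0" "Dy y = 1" "Dy z = 0" "Dy w = 0"
      "Dz x = 0" "Dz y = 0" "Dz z = 1" "Dz w = 0" "Dw x = 0" "Dw y = 0" "Dw z = 0" "Dw w = 1"
    unfolding x_def y_def z_def w_def by (rule partial_derivs)
  have dp: "D (p 0) = x * D z + D x * z - 2 * y * D y" "D (p 1) = x * D w + D x * w - (y * D z + D y * z)"
    "D (p 2) = y * D w + D y * w - 2 * z * D z"
    "D (p 3) = w ^ k * D z + of_nat k * w ^ m * D w * z - of_nat (k + r + 1) * x ^ (k + r) * D x"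
    "D (p 4) = of_nat (k + 1) * w ^ k * D w - (x ^ (k + r) * D y + of_nat (k + r) * x ^ (m + r) * D x * y)"
    if "derivation D" for D
    unfolding pd derivation_diff[OF that] derivation_mult[OF that] derivation_power[OF that] by (simp_all add: m)
  have Xm': "\<phi> x ^ (m + r) * (X0 * T) = W * T ^ 2 * T" using Xm by (simp add: mult.assoc[symmetric])
  \<comment> \<open>The image of \<open>w^(k - 1) z\<close>, which arises when \<open>p 3\<close> is
    differentiated by \<open>w\<close>. Multiplying that one equation by \<open>T\<close> turns
    \<open>V\<close> into \<open>W\<close>.\<close>
  define V where "V = \<phi> w ^ m * (X0 * T ^ 2)"
  have V: "W = V * T" unfolding Wm[symmetric] V_def by (simp add: power3_eq_cube power2_eq_square mult_ac)
  have phi2: "\<phi> (2 :: 'k fps4) = 2" using phi_of_nat[of 2] by (simp only: of_nat_numeral)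
  have jac1: "X0 * T^2 * G 0 + X0 * T^3 * G 1 - of_nat (k + r + 1) * (W * T^2) * G 3 - of_nat (k + r) * (W * T^2 * T) * G 4 = 0"
  proof -
    have "\<phi> (Dx (p 0)) = X0 * T^2" "\<phi> (Dx (p 1)) = X0 * T^3" "\<phi> (Dx (p 2)) = 0"
      "\<phi> (Dx (p 3)) = - (of_nat (k + r + 1) * (W * T^2))" "\<phi> (Dx (p 4)) = - (of_nat (k + r) * (W * T^2 * T))"
      unfolding dp[OF der(1)] Dv using v Xk Xm' by (simp_all add: phi_of_nat mult.assoc del: of_nat_add of_nat_Suc)
    with D[OF der(1)] show ?thesis by (simp add: algebra_simps del: of_nat_add of_nat_Suc)
  qed
  have jac2: "- (2 * (X0 * T) * G 0) - X0 * T^2 * G 1 + X0 * T^3 * G 2 - W * T^2 * G 4 = 0"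
  proof -
    have "\<phi> (Dy (p 0)) = - (2 * (X0 * T))" "\<phi> (Dy (p 1)) = - (X0 * T^2)" "\<phi> (Dy (p 2)) = X0 * T^3"
      "\<phi> (Dy (p 3)) = 0" "\<phi> (Dy (p 4)) = - (W * T^2)"
      unfolding dp[OF der(2)] Dv phi_diff phi_simps(1,2) phi_power phi2 using v Xk by (simp_all add: mult.assoc)
    with D[OF der(2)] show ?thesis by (simp add: algebra_simps)
  qed
  have jac3: "X0 * G 0 - X0 * T * G 1 - 2 * (X0 * T^2) * G 2 + W * G 3 = 0"
  proof -
    have "\<phi> (Dz (p 0)) = X0" "\<phi> (Dz (p 1)) = - (X0 * T)" "\<phi> (Dz (p 2)) = - (2 * (X0 * T^2))"
      "\<phi> (Dz (p 3)) = W" "\<phi> (Dz (p 4)) = 0"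
      unfolding dp[OF der(3)] Dv phi_diff phi_simps(1,2) phi_power phi2 using v Wk by (simp_all add: mult.assoc)
    with D[OF der(3)] show ?thesis by (simp add: algebra_simps)
  qed
  have jac4: "X0 * T * G 1 + X0 * T * T * G 2 + of_nat k * W * G 3 + of_nat (k + 1) * W * T * G 4 = 0"
  proof -
    have "\<phi> (Dw (p 0)) = 0" "\<phi> (Dw (p 1)) = X0" "\<phi> (Dw (p 2)) = X0 * T"
      "\<phi> (Dw (p 3)) = of_nat k * V" "\<phi> (Dw (p 4)) = of_nat (k + 1) * W"
      unfolding dp[OF der(4)] Dv using v Wk
      by (simp_all add: phi_of_nat V_def mult.assoc del: of_nat_add of_nat_Suc)
    with D[OF der(4)] have 0: "G 1 * X0 + G 2 * (X0 * T) + G 3 * (of_nat k * V) + G 4 * (of_nat (k + 1) * W) = 0"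
      by simp
    have "X0 * T * G 1 + X0 * T * T * G 2 + of_nat k * (V * T) * G 3 + of_nat (k + 1) * W * T * G 4 =
      T * (G 1 * X0 + G 2 * (X0 * T) + G 3 * (of_nat k * V) + G 4 * (of_nat (k + 1) * W))"
      by (simp add: algebra_simps)
    then show ?thesis unfolding 0 V[symmetric] by simp
  qed
  note J = jacobian_kernel[OF _ _ _ a(1) jac1 jac2 jac3 jac4]
  have nz: "X0 \<noteq> 0" "T \<noteq> 0" "W \<noteq> 0" by (simp_all add: X0_def T_def W_def)
  have supp: "int n \<in> H" if "G i $ n \<noteq> 0" for i n
  proof -
    have "G i \<in> range (\<phi> :: 'k fps4 \<Rightarrow> _)" unfolding G_def by blast
    with that show ?thesis unfolding range_phi by blast
  qed
  obtain q0 q1 q2 q3 c :: "'k fps4" where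
    \<alpha>: "G 2 = \<phi> (q0 * var_x + q1 * var_y + c * var_w ^ k)" and
    \<beta>: "- G 4 = \<phi> (q2 * var_x + q3 * var_z + c * var_y)"
  proof (rule syzygy_combination[OF a, of "G 2" "- G 4" "G 1"])
    show "int n \<in> H" if "(fps_X ^ (2 * r) * G 2) $ n \<noteq> 0" for n
    proof -
      have "fps_X ^ (2 * r) * G 2 = G 0"
        using J(1)[OF nz] by (simp add: T_def power_mult mult.commute[of 2])
      with that supp show ?thesis by metis
    qed
    show "int n \<in> H" if "(fps_X ^ r * (- G 4)) $ n \<noteq> 0" for n
    proof -
      have "fps_X ^ r * (- G 4) = G 3"
        using J(2)[OF nz] by (simp add: T_def)
      with that supp show ?thesis by metis
    qed
    show "fps_X ^ a * G 1 = fps_X ^ (k * (a + 3 * r)) * (- G 4) - fps_X ^ (a + r) * G 2"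
      using J(3)[OF nz] by (simp add: X0_def T_def W_def power_add)
  qed (use supp in auto)
  define h where "h i = [q0 * z + q1 * w + c * x ^ (k + r), q2 * w ^ k + q3 * x ^ (k + r) - q0 * y - q1 * z,
     q0 * x + q1 * y + c * w ^ k, q2 * y + q3 * w + c * z, - (q2 * x + q3 * z + c * y)] ! i" for i :: nat
  have hd: "h 0 = q0 * z + q1 * w + c * x ^ (k + r)" "h 1 = q2 * w ^ k + q3 * x ^ (k + r) - q0 * y - q1 * z"
    "h 2 = q0 * x + q1 * y + c * w ^ k" "h 3 = q2 * y + q3 * w + c * z" "h 4 = - (q2 * x + q3 * z + c * y)"
    by (simp_all add: h_def eval_nat_numeral)
  have h2: "\<phi> (h 2) = G 2" unfolding hd \<alpha> x_def y_def w_def ..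
  have h4: "\<phi> (h 4) = G 4" unfolding hd phi_uminus using \<beta> unfolding x_def y_def z_def by (metis minus_minus)
  have h0: "\<phi> (h 0) = G 0"
    unfolding J(1)[OF nz] h2[symmetric] hd phi_simps phi_power Xk Wk unfolding v
    by (simp add: algebra_simps power2_eq_square power3_eq_cube)
  have h3: "\<phi> (h 3) = G 3"
    unfolding J(2)[OF nz] h4[symmetric] hd phi_simps phi_uminus phi_power Xk Wk unfolding v
    by (simp add: algebra_simps power2_eq_square power3_eq_cube)
  have "X0 * \<phi> (h 1) = X0 * G 1"
    unfolding J(3)[OF nz] h2[symmetric] h4[symmetric] hd phi_simps phi_uminus phi_diff phi_power Xk Wk unfolding v
    by (simp add: algebra_simps power2_eq_square power3_eq_cube)
  with nz have h1: "\<phi> (h 1) = G 1" by simp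
  have gh: "g i - h i \<in> P" if "i < 5" for i
    using that h0 h1 h2 h3 h4 unfolding less_5 by (auto simp: mem_P G_def)
  have hp: "h 0 * p 0 + h 1 * p 1 + h 2 * p 2 + h 3 * p 3 + h 4 * p 4 = 0"
    unfolding hd pd by (simp add: algebra_simps power2_eq_square)
  have "f = (g 0 - h 0) * p 0 + (g 1 - h 1) * p 1 + (g 2 - h 2) * p 2 + (g 3 - h 3) * p 3 + (g 4 - h 4) * p 4
      + (h 0 * p 0 + h 1 * p 1 + h 2 * p 2 + h 3 * p 3 + h 4 * p 4)"
    unfolding g by (simp add: algebra_simps)
  then have "f = (g 0 - h 0) * p 0 + (g 1 - h 1) * p 1 + (g 2 - h 2) * p 2 + (g 3 - h 3) * p 3 + (g 4 - h 4) * p 4"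
    unfolding hp by simp
  moreover have "(g i - h i) * p i \<in> P [^]\<^bsub>ideals_set ring_of_type_algebra\<^esub> (2::nat)" if "i < 5" for i
    using gh[OF that] \<phi>p[OF that] by (intro P2I) (simp_all add: mem_P)
  ultimately show ?thesis
    by (simp add: ideal_power_closed(1)[OF refl ideal_P])
qed

lemma P2_eq_symbolic:
  assumes a: "a = 3 * k + 2" "k > 0"
  shows "(P :: 'k::field fps4 set) [^]\<^bsub>ideals_set ring_of_type_algebra\<^esub> (2::nat) = symbolic_power ring_of_type_algebra P 2"
proof (intro subset_antisym subsetI)
  fix f :: "'k fps4" assume "f \<in> P [^]\<^bsub>ideals_set ring_of_type_algebra\<^esub> (2::nat)"
  then show "f \<in> symbolic_power ring_of_type_algebra P 2"
    unfolding symbolic_power_def using one_notin_P by (auto intro!: bexI[of _ 1])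
next
  fix f :: "'k fps4" assume "f \<in> symbolic_power ring_of_type_algebra P 2"
  from symbolic_power_2_derivs[OF this] show "f \<in> P [^]\<^bsub>ideals_set ring_of_type_algebra\<^esub> (2::nat)"
    by (intro conormal_injective[OF a])
qed

end


section \<open>The dichotomy\<close>

context arith_pair
begin

text \<open>First isomorphism theorem: \<open>\<phi>\<close> is constant on a coset of
  \<open>P\<close>, and \<open>the_elem\<close> extracts its value there.\<close>

lemma semigroup_ring_Quot:
  "semigroup_ring (ring_of_type_algebra Quot (P :: 'k::field fps4 set)) (\<lambda>C. the_elem ((\<phi> :: 'k fps4 \<Rightarrow> 'k fps) ` C)) H"
proof -
  let ?R = "ring_of_type_algebra :: 'k fps4 ring" and ?S = "ring_of_type_algebra :: 'k fps ring"
  let ?Q = "?R Quot (P :: 'k fps4 set)" and ?\<psi> = "\<lambda>C. the_elem ((\<phi> :: 'k fps4 \<Rightarrow> 'k fps) ` C)"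
  interpret h: ring_hom_ring ?R ?S \<phi> by (rule phi_ring_hom)
  have P: "P = a_kernel ?R ?S \<phi>" by (simp add: defining_ideal_def)
  have hom: "?\<psi> \<in> ring_hom ?Q ?S" unfolding P by (rule h.the_elem_hom)
  show ?thesis
  proof (intro semigroup_ring.intro semigroup_ring_axioms.intro)
    show "cring ?Q"
      using ideal.quotient_is_cring[OF ideal_P cring_from_type_algebra] .
    show "inj_on ?\<psi> (carrier ?Q)"
      unfolding P using h.the_elem_inj by (intro inj_onI) blast
    show "?\<psi> ` carrier ?Q = {f. \<forall>n. f $ n \<noteq> 0 \<longrightarrow> int n \<in> H}"
      unfolding P h.the_elem_surj using range_phi by simp
  qed (use ring_hom_mult[OF hom] ring_hom_add[OF hom] ring_hom_one[OF hom] conductor in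
      \<open>auto simp: arith_semigroup_0 arith_semigroup_add arith_semigroup_nonneg\<close>)
qed

lemma not_gorenstein:
  assumes a: "a = 3 * k \<or> a = 3 * k + 1" "k > 0"
  shows "\<not> gorenstein_local_ring (ring_of_type_algebra Quot (P :: 'k::field fps4 set))"
proof -
  define m where "m j = k * a + (3 * k - j) * r" for j
  have m: "int (m j) = int k * int a + (3 * int k - int j) * int r" if "j \<le> 2" for j
    using that \<open>k > 0\<close> by (simp add: m_def of_nat_diff)
  note soc = socle_weight[OF a]
  have "m 2 < m 1"
    using \<open>k > 0\<close> r_pos by (simp add: m_def)
  then show ?thesis
    using soc[of 1] soc[of 2] arith_semigroup_gen[of a r] a_pos m[of 1] m[of 2]
    by (intro not_gorenstein_of_two_socle_monomials[OF semigroup_ring_Quot, of a "m 1" "m 2"]) simp_all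
qed

lemma gorenstein:
  assumes a: "a = 3 * k + 2"
  shows "gorenstein_local_ring (ring_of_type_algebra Quot (P :: 'k::field fps4 set))"
proof -
  interpret symmetric_semigroup_ring "ring_of_type_algebra Quot (P :: 'k fps4 set)"
    "\<lambda>C. the_elem ((\<phi> :: 'k fps4 \<Rightarrow> 'k fps) ` C)" H "int k * (int a + 3 * int r) + int r"
    by (intro symmetric_semigroup_ring.intro symmetric_semigroup_ring_axioms.intro semigroup_ring_Quot symmetric[OF a])
  \<comment> \<open>Elements of the quotient are sets of power series, so a series in
    \<open>t\<close> is coded as a singleton. Two of them, for the nonnegative and the nonpositive
    exponents, encode a Laurent series as a list.\<close>
  define c :: "'k fps \<Rightarrow> 'k fps4 set" where "c f = {fps_const (fps_const (fps_const f))}" for f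
  have "inj (\<lambda>f :: 'k fls. [c (fls_regpart f), c (Abs_fps (\<lambda>n. f $$ (- int n)))])"
  proof (rule injI)
    fix f g :: "'k fls"
    assume "[c (fls_regpart f), c (Abs_fps (\<lambda>n. f $$ (- int n)))] = [c (fls_regpart g), c (Abs_fps (\<lambda>n. g $$ (- int n)))]"
    then have *: "fls_regpart f = fls_regpart g" "(\<lambda>n. f $$ (- int n)) = (\<lambda>n. g $$ (- int n))"
      by (simp_all add: c_def Abs_fps_inject)
    have "f $$ n = g $$ n" for n
    proof (cases "n \<ge> 0")
      case True
      then show ?thesis using arg_cong[OF *(1), of "\<lambda>f. f $ nat n"] by simp
    next
      case False
      then show ?thesis using fun_cong[OF *(2), of "nat (- n)"] by simp
    qed
    then show "f = g" by (rule fls_eqI)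
  qed
  then show ?thesis by (rule gorenstein)
qed

end

theorem theorem2p3:
  fixes a r :: nat
    and R :: "('k::field) fps4 ring"
    and P :: "'k fps4 set"
  assumes "a > 0" and "r > 0" and "coprime a r"
    and "nonredundant_generators [a, a + r, a + 2 * r, a + 3 * r]"
    and "R = ring_of_type_algebra"
    and "P = defining_ideal a r"
  shows "((\<exists>k>0. a = 3 * k \<or> a = 3 * k + 1) \<longrightarrow>
           \<not> gorenstein_local_ring (R Quot P) \<and>
           P [^]\<^bsub>ideals_set R\<^esub> (2::nat) \<noteq> symbolic_power R P 2) \<and>
         ((\<exists>k>0. a = 3 * k + 2) \<longrightarrow>
           gorenstein_local_ring (R Quot P) \<and>
           P [^]\<^bsub>ideals_set R\<^esub> (2::nat) = symbolic_power R P 2 \<and>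
           P [^]\<^bsub>ideals_set R\<^esub> (3::nat) \<noteq> symbolic_power R P 3)"
proof -
  interpret arith_pair a r
    using assms by unfold_locales
  show ?thesis
    unfolding assms(5,6)
    using not_gorenstein P2_neq_symbolic gorenstein P2_eq_symbolic P3_neq_symbolic by blast
qed

end
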